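(* Let $\mathfrak{h}$ be a vector space over $\mathbb{C}$ with a symmetric bilinear form $(\cdot|\cdot)$, $\varepsilon:\mathfrak{h}\times\mathfrak{h}\to\mathbb{C}^\times$ a 2-cocycle, and $L\subset\mathfrak{h}$ a lattice with a $\mathbb{Z}$-basis $B$ that is also a $\mathbb{C}$-basis of $\mathfrak{h}$. Let $W_L^\varepsilon(B)$ be the generalized principal subspace of $V_L^\varepsilon$, i.e. the generalized vertex subalgebra generated by $\{e^\beta\mid\beta\in B\}$. Fix a total order $\le$ on $B$. Then the set $\mathcal{C}(W_L^\varepsilon(B),B,\mathcal{N})$ of all vectors $$\Psi(e^{\beta_1},m_1;\cdots;e^{\beta_k},m_k)=e^{\beta_k}\bigl(m_k-\textstyle\sum_{j=1}^{k-1}(\beta_k|\beta_j)\bigr)\cdots e^{\beta_2}\bigl(m_2-(\beta_2|\beta_1)\bigr)\,e^{\beta_1}(m_1)\,|0\rangle$$ with $k\ge0$, $\beta_1\le\cdots\le\beta_k$ in $B$, and negative integers $m_1,\ldots,m_k$ such that $m_i\ge m_j$ whenever $i<j$ and $\beta_i=\beta_j$, is a basis of $W_L^\varepsilon(B)$.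
   Context: $V_{\mathfrak{h}}$ is the following generalized vertex algebra. $M(1)=S(\mathfrak{h}\otimes t^{-1}\mathbb{C}[t^{-1}])$; write $h(n)=h\otimes t^n$; for $n<0$, $h(n)$ acts on $M(1)$ by multiplication, and for $n>0$ as the derivation with $h(n)\cdot h'(-m)=n(h|h')\delta_{n,m}$. $V_{\mathfrak{h}}=M(1)\otimes_{\mathbb{C}}\mathbb{C}[\mathfrak{h}]$, where $\mathbb{C}[\mathfrak{h}]$ is the group algebra of the additive group $\mathfrak{h}$ with basis $e^\alpha$ ($\alpha\in\mathfrak{h}$); $1\otimes e^\alpha$ is written $e^\alpha$, $h(0)$ acts on $M(1)\otimes e^\alpha$ as the scalar $(h|\alpha)$, and $|0\rangle=1\otimes e^0$. The state-field correspondence is determined by $Y(h(-1)|0\rangle,z)=\sum_{n\in\mathbb{Z}}h(n)z^{-n-1}$ and $$Y(e^\alpha,z)=e^\alpha z^{\alpha(0)}\exp\Bigl(\sum_{n>0}\tfrac{\alpha(-n)}{n}z^n\Bigr)\exp\Bigl(-\sum_{n>0}\tfrac{\alpha(n)}{n}z^{-n}\Bigr),$$ where the operator $e^\alpha$ sends $u\otimes e^\beta$ to $u\otimes e^{\alpha+\beta}$ and $z^{\alpha(0)}$ acts on $M(1)\otimes e^\beta$ as $z^{(\alpha|\beta)}$. For a vector $a$ write $Y(a,z)=\sum_{n\in\mathbb{C}}a(n)z^{-n-1}$. The vectors in $M(1)\otimes e^\alpha$ have charge $\alpha$. For a subgroup $L\subset\mathfrak{h}$, $V_L=\bigoplus_{\alpha\in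 L}M(1)\otimes e^\alpha$. A 2-cocycle satisfies $\varepsilon(\alpha,\beta)\varepsilon(\alpha+\beta,\gamma)=\varepsilon(\beta,\gamma)\varepsilon(\alpha,\beta+\gamma)$ and $\varepsilon(\alpha,0)=\varepsilon(0,\alpha)=1$. The $\varepsilon$-modified GVA $V_L^\varepsilon$ has the same space, vacuum and translation operator, with $Y^\varepsilon(a,z)b=\varepsilon(\alpha,\beta)Y(a,z)b$ for $a,b$ of charges $\alpha,\beta$; in the claim, the modes $e^\beta(n)$ are those of $Y^\varepsilon$. The generalized vertex subalgebra generated by a set is the smallest translation-invariant subspace containing it and $|0\rangle$ and closed under all products $u(n)v$, $n\in\mathbb{C}$. Here $\mathcal{N}(e^\alpha,e^\beta)=-(\alpha|\beta)$ for $\alpha,\beta\in B$. *)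

theory Defs
  imports Complex_Main "HOL-Library.Multiset" "HOL-Library.Poly_Mapping"
    "HOL-Library.Function_Algebras"
begin

section \<open>Complex vector spaces\<close>

class complex_vec = ab_group_add +
  fixes scaleC :: "complex \<Rightarrow> 'a \<Rightarrow> 'a" (infixr \<open>*\<^sub>C\<close> 75)
  assumes scaleC_add_right: "c *\<^sub>C (x + y) = c *\<^sub>C x + c *\<^sub>C y"
    and scaleC_add_left: "(c + d) *\<^sub>C x = c *\<^sub>C x + d *\<^sub>C x"
    and scaleC_scaleC: "c *\<^sub>C d *\<^sub>C x = (c * d) *\<^sub>C x"
    and scaleC_one: "1 *\<^sub>C x = x"

interpretation cvec: vector_space scaleC
  by standard (simp_all add: scaleC_add_right scaleC_add_left scaleC_scaleC scaleC_one)

abbreviation clinear :: "('a::complex_vec \<Rightarrow> 'b::complex_vec) \<Rightarrow> bool" where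
  "clinear \<equiv> Vector_Spaces.linear scaleC scaleC"

lemma clinear_iff:
  "clinear f \<longleftrightarrow> (\<forall>x y. f (x + y) = f x + f y) \<and> (\<forall>c x. f (c *\<^sub>C x) = c *\<^sub>C f x)"
  by (auto simp: Vector_Spaces.linear_iff cvec.vector_space_axioms)

instantiation complex :: complex_vec
begin
definition scaleC_complex :: "complex \<Rightarrow> complex \<Rightarrow> complex" where "scaleC_complex = (*)"
instance by standard (simp_all add: scaleC_complex_def algebra_simps)
end

instantiation "fun" :: (type, complex_vec) complex_vec
begin
definition scaleC_fun :: "complex \<Rightarrow> ('a \<Rightarrow> 'b) \<Rightarrow> 'a \<Rightarrow> 'b" where
  "scaleC_fun c f = (\<lambda>x. c *\<^sub>C f x)"
instance
  by standard (simp_all add: scaleC_fun_def plus_fun_def scaleC_add_right scaleC_add_left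
      scaleC_scaleC scaleC_one)
end

instantiation poly_mapping :: (type, complex_vec) complex_vec
begin
definition scaleC_poly_mapping :: "complex \<Rightarrow> ('a \<Rightarrow>\<^sub>0 'b) \<Rightarrow> 'a \<Rightarrow>\<^sub>0 'b" where
  "scaleC_poly_mapping c = Poly_Mapping.map (scaleC c)"

lemma lookup_scaleC: "Poly_Mapping.lookup (c *\<^sub>C f) k = c *\<^sub>C Poly_Mapping.lookup (f :: 'a \<Rightarrow>\<^sub>0 'b) k"
  by (simp add: scaleC_poly_mapping_def Poly_Mapping.map.rep_eq when_def)

instance
  by standard (auto intro!: poly_mapping_eqI simp: lookup_scaleC lookup_add scaleC_add_right
      scaleC_add_left scaleC_scaleC scaleC_one)
end


section \<open>The Fock space\<close>

text \<open>
  The symmetric algebra of \<open>h \<otimes> t\<^sup>-\<^sup>1 \<complex>[t\<^sup>-\<^sup>1]\<close> is the free commutative algebra on symbols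
  \<open>(x, k)\<close>, standing for \<open>x \<otimes> t\<^sup>-\<^sup>k\<^sup>-\<^sup>1\<close>, modulo linearity of the symbols in \<open>x\<close>.
\<close>

type_synonym 'h free_fock = "('h \<times> nat) multiset \<Rightarrow>\<^sub>0 complex"

definition sym :: "'h \<Rightarrow> nat \<Rightarrow> 'h free_fock" where
  "sym x k = Poly_Mapping.single {#(x, k)#} 1"

inductive_set lin_ideal :: "'h::complex_vec free_fock set" where
  sym_add: "sym (x + y) k - sym x k - sym y k \<in> lin_ideal"
| sym_scale: "sym (c *\<^sub>C x) k - Poly_Mapping.single {#} c * sym x k \<in> lin_ideal"
| add: "p \<in> lin_ideal \<Longrightarrow> q \<in> lin_ideal \<Longrightarrow> p + q \<in> lin_ideal"
| mult: "p \<in> lin_ideal \<Longrightarrow> r * p \<in> lin_ideal"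

lemma lin_ideal_zero: "0 \<in> lin_ideal"
  using lin_ideal.mult[OF lin_ideal.sym_add, of 0] by simp

lemma lin_ideal_uminus: "p \<in> lin_ideal \<Longrightarrow> - p \<in> lin_ideal"
  using lin_ideal.mult[of p "-1"] by simp

lemma lin_ideal_diff: "p \<in> lin_ideal \<Longrightarrow> q \<in> lin_ideal \<Longrightarrow> p - q \<in> lin_ideal"
  using lin_ideal.add[of p "- q"] lin_ideal_uminus[of q] by simp

lemma lookup_mult_empty:
  fixes p q :: "'h free_fock"
  shows "Poly_Mapping.lookup (p * q) {#} = Poly_Mapping.lookup p {#} * Poly_Mapping.lookup q {#}"
proof -
  have *: "(\<Sum>s. Poly_Mapping.lookup q s when {#} = l + s) = (Poly_Mapping.lookup q {#} when l = {#})"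
    for l :: "('h \<times> nat) multiset"
    by (cases "l = {#}") (simp_all)
  show ?thesis
    unfolding lookup_mult * by (simp add: mult_when)
qed

lemma lin_ideal_const: "p \<in> lin_ideal \<Longrightarrow> Poly_Mapping.lookup p {#} = 0"
  by (induction rule: lin_ideal.induct)
    (simp_all add: lookup_minus lookup_add lookup_mult_empty sym_def lookup_single)

quotient_type (overloaded) 'h fock = "'h::complex_vec free_fock" / "\<lambda>p q. p - q \<in> lin_ideal"
proof (rule equivpI)
  show "reflp (\<lambda>p q :: 'h free_fock. p - q \<in> lin_ideal)"
    by (simp add: reflp_def lin_ideal_zero)
  show "symp (\<lambda>p q :: 'h free_fock. p - q \<in> lin_ideal)"
    by (rule sympI) (use lin_ideal_uminus in fastforce)
  show "transp (\<lambda>p q :: 'h free_fock. p - q \<in> lin_ideal)"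
    by (rule transpI) (use lin_ideal.add in fastforce)
qed

instantiation fock :: (complex_vec) comm_ring_1
begin
lift_definition zero_fock :: "'a fock" is 0 .
lift_definition one_fock :: "'a fock" is 1 .
lift_definition plus_fock :: "'a fock \<Rightarrow> 'a fock \<Rightarrow> 'a fock" is "(+)"
  using lin_ideal.add by (fastforce simp: add_diff_add)
lift_definition uminus_fock :: "'a fock \<Rightarrow> 'a fock" is uminus
  using lin_ideal_uminus by fastforce
lift_definition minus_fock :: "'a fock \<Rightarrow> 'a fock \<Rightarrow> 'a fock" is "(-)"
proof -
  fix p q r s :: "'a free_fock"
  assume "p - q \<in> lin_ideal" "r - s \<in> lin_ideal"
  hence "(p - q) - (r - s) \<in> lin_ideal"
    by (rule lin_ideal_diff)
  thus "(p - r) - (q - s) \<in> lin_ideal"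
    by (simp add: algebra_simps)
qed
lift_definition times_fock :: "'a fock \<Rightarrow> 'a fock \<Rightarrow> 'a fock" is "(*)"
proof -
  fix p q r s :: "'a free_fock"
  assume "p - q \<in> lin_ideal" "r - s \<in> lin_ideal"
  hence "r * (p - q) + q * (r - s) \<in> lin_ideal"
    by (intro lin_ideal.add lin_ideal.mult)
  thus "p * r - q * s \<in> lin_ideal"
    by (simp add: algebra_simps)
qed
instance
proof
  show "(0::'a fock) \<noteq> 1"
  proof transfer
    show "0 - (1 :: 'a free_fock) \<notin> lin_ideal"
      using lin_ideal_const[of "0 - (1 :: 'a free_fock)"]
      by (auto simp: lookup_minus lookup_one zero_multiset_def)
  qed
qed (transfer; simp add: algebra_simps lin_ideal_zero; fail)+
end

instantiation fock :: (complex_vec) complex_vec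
begin
lift_definition scaleC_fock :: "complex \<Rightarrow> 'a fock \<Rightarrow> 'a fock" is
  "\<lambda>c p. Poly_Mapping.single {#} c * p"
  by (simp add: lin_ideal.mult flip: right_diff_distrib)
instance
proof
  fix a b :: complex and x y :: "'a fock"
  show "a *\<^sub>C (x + y) = a *\<^sub>C x + a *\<^sub>C y"
    by transfer (simp add: distrib_left lin_ideal_zero)
  show "(a + b) *\<^sub>C x = a *\<^sub>C x + b *\<^sub>C x"
    by transfer (simp add: distrib_right single_add lin_ideal_zero)
  show "a *\<^sub>C b *\<^sub>C x = (a * b) *\<^sub>C x"
    by transfer (simp add: mult_single lin_ideal_zero flip: mult.assoc)
  show "1 *\<^sub>C x = x"
    by transfer (simp add: lin_ideal_zero flip: zero_multiset_def)
qed
end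


lift_definition fgen :: "'h::complex_vec \<Rightarrow> nat \<Rightarrow> 'h fock" is sym .

lemma fgen_add: "fgen (x + y) k = fgen x k + fgen y k"
  by transfer (use lin_ideal.sym_add in \<open>simp add: diff_diff_add\<close>)

lemma fgen_scaleC: "fgen (c *\<^sub>C x) k = c *\<^sub>C fgen x k"
  by transfer (rule lin_ideal.sym_scale)

lemma scaleC_mult_fock: "(c *\<^sub>C u) * v = c *\<^sub>C (u * v)"
  and mult_scaleC_fock: "u * (c *\<^sub>C v) = c *\<^sub>C (u * v)" for u v :: "'h::complex_vec fock"
  by (transfer; simp add: mult.assoc mult.left_commute lin_ideal_zero)+

lemma poly_mapping_induct [case_names single add]:
  fixes p :: "'a \<Rightarrow>\<^sub>0 'b::ab_group_add"
  assumes "\<And>k c. P (Poly_Mapping.single k c)" "\<And>p q. P p \<Longrightarrow> P q \<Longrightarrow> P (p + q)"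
  shows "P p"
proof (induction p rule: Poly_Mapping.update_induct)
  case (const)
  show ?case using assms(1)[of undefined 0] by simp
next
  case (update f a b)
  have "Poly_Mapping.update a b f = f + Poly_Mapping.single a b"
    using update(1) by (auto intro!: poly_mapping_eqI
        simp: lookup_update lookup_add lookup_single in_keys_iff when_def)
  thus ?case using assms update by simp
qed

lemma fock_induct [case_names one fgen add scale]:
  fixes u :: "'h::complex_vec fock"
  assumes one: "P 1" and gen: "\<And>x k u. P u \<Longrightarrow> P (fgen x k * u)"
    and add: "\<And>u v. P u \<Longrightarrow> P v \<Longrightarrow> P (u + v)"
    and scale: "\<And>c u. P u \<Longrightarrow> P (c *\<^sub>C u)"
  shows "P u"
proof -
  have mon: "P (abs_fock (Poly_Mapping.single M 1))" for M
  proof (induction M)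
    case empty
    show ?case using one by (simp add: one_fock.abs_eq flip: zero_multiset_def)
  next
    case (add xk M)
    obtain x k where xk: "xk = (x, k)" by (cases xk)
    have "Poly_Mapping.single (add_mset xk M) 1 = sym x k * Poly_Mapping.single M 1"
      by (simp add: sym_def xk mult_single)
    thus ?case using gen[OF add, of x k] by (simp add: fgen.abs_eq times_fock.abs_eq)
  qed
  have "P (abs_fock p)" for p
  proof (induction p rule: poly_mapping_induct)
    case (single M c)
    show ?case using scale[OF mon, of c M] by (simp add: scaleC_fock.abs_eq mult_single)
  next
    case (add p q)
    thus ?case using assms(3) by (metis plus_fock.abs_eq)
  qed
  thus ?thesis using Quotient_abs_rep[OF Quotient_fock, of u] by metis
qed


section \<open>The generalized vertex algebra\<close>

text \<open>The group algebra of the additive group of \<open>'h\<close> with coefficients in the Fock space.\<close>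

type_synonym 'h gva = "'h \<Rightarrow>\<^sub>0 'h fock"

definition vexp :: "'h::complex_vec \<Rightarrow> 'h gva" where
  "vexp \<alpha> = Poly_Mapping.single \<alpha> 1"

abbreviation vac :: "'h::complex_vec gva" where
  "vac \<equiv> vexp 0"

definition symmetric_bilinear :: "('h::complex_vec \<Rightarrow> 'h \<Rightarrow> complex) \<Rightarrow> bool" where
  "symmetric_bilinear form \<longleftrightarrow>
     (\<forall>x. clinear (form x)) \<and> (\<forall>x y. form x y = form y x)"

definition fock_derivation :: "('h::complex_vec fock \<Rightarrow> 'h fock) \<Rightarrow> bool" where
  "fock_derivation d \<longleftrightarrow> clinear d \<and> (\<forall>u v. d (u * v) = d u * v + u * d v)"

definition annih :: "('h::complex_vec \<Rightarrow> 'h \<Rightarrow> complex) \<Rightarrow> 'h \<Rightarrow> nat \<Rightarrow> 'h fock \<Rightarrow> 'h fock" where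
  "annih form h n = (THE d. fock_derivation d \<and>
     (\<forall>x k. d (fgen x k) = (if n = k + 1 then of_nat n * form h x else 0) *\<^sub>C 1))"

definition heis :: "('h::complex_vec \<Rightarrow> 'h \<Rightarrow> complex) \<Rightarrow> 'h \<Rightarrow> int \<Rightarrow> 'h gva \<Rightarrow> 'h gva" where
  "heis form h n v =
     (if n < 0 then Poly_Mapping.single 0 (fgen h (nat (- n - 1))) * v
      else if n = 0 then Poly_Mapping.mapp (\<lambda>\<beta> u. form h \<beta> *\<^sub>C u) v
      else Poly_Mapping.map (annih form h (nat n)) v)"

text \<open>
  \<open>series_exp A n\<close> is the coefficient of \<open>w\<^sup>n\<close> in \<open>exp (\<Sum>j\<ge>1. A j w\<^sup>j)\<close>, and
  \<open>series_pow A k n\<close> that in the \<open>k\<close>-th power of the exponent.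
\<close>

primrec series_pow :: "(nat \<Rightarrow> 'v::complex_vec \<Rightarrow> 'v) \<Rightarrow> nat \<Rightarrow> nat \<Rightarrow> 'v \<Rightarrow> 'v" where
  "series_pow A 0 n v = (if n = 0 then v else 0)"
| "series_pow A (Suc k) n v = (\<Sum>j=1..n. A j (series_pow A k (n - j) v))"

definition series_exp :: "(nat \<Rightarrow> 'v::complex_vec \<Rightarrow> 'v) \<Rightarrow> nat \<Rightarrow> 'v \<Rightarrow> 'v" where
  "series_exp A n v = (\<Sum>k\<le>n. (1 / fact k) *\<^sub>C series_pow A k n v)"

text \<open>The coefficient of \<open>z\<^sup>s\<close> in \<open>z\<^sup>\<alpha>\<^sup>(\<^sup>0\<^sup>) v\<close>.\<close>

definition zpow :: "('h::complex_vec \<Rightarrow> 'h \<Rightarrow> complex) \<Rightarrow> 'h \<Rightarrow> complex \<Rightarrow> 'h gva \<Rightarrow> 'h gva" where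
  "zpow form \<alpha> s v = Poly_Mapping.mapp (\<lambda>\<beta> u. if form \<alpha> \<beta> = s then u else 0) v"

text \<open>
  The coefficient of \<open>z\<^sup>-\<^sup>n\<^sup>-\<^sup>1\<close> in \<open>Y(e\<^sup>\<alpha>, z) v\<close>; here \<open>p\<close> and \<open>q\<close> are the exponents of \<open>z\<close> and
  \<open>z\<^sup>-\<^sup>1\<close> taken from the two exponentials.  Almost all summands vanish.
\<close>

definition vertex_mode ::
    "('h::complex_vec \<Rightarrow> 'h \<Rightarrow> complex) \<Rightarrow> 'h \<Rightarrow> complex \<Rightarrow> 'h gva \<Rightarrow> 'h gva" where
  "vertex_mode form \<alpha> n v =
     Sum_any (\<lambda>(p, q). Poly_Mapping.single \<alpha> 1 * zpow form \<alpha> (- n - 1 - of_nat p + of_nat q)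
        (series_exp (\<lambda>j. (1 / of_nat j) *\<^sub>C heis form \<alpha> (- int j)) p
          (series_exp (\<lambda>j. (- 1 / of_nat j) *\<^sub>C heis form \<alpha> (int j)) q v)))"

text \<open>
  The modes of the normally ordered product \<open>:\<partial>\<^sup>(\<^sup>m\<^sup>-\<^sup>1\<^sup>)h(z) F(z):\<close>, \<open>m \<ge> 1\<close>, where
  \<open>\<partial>\<^sup>(\<^sup>m\<^sup>-\<^sup>1\<^sup>) = \<partial>\<^sup>m\<^sup>-\<^sup>1 / (m - 1)!\<close> and \<open>h(z) = \<Sum>n. h(n) z\<^sup>-\<^sup>n\<^sup>-\<^sup>1\<close>: the part of \<open>\<partial>\<^sup>(\<^sup>m\<^sup>-\<^sup>1\<^sup>)h(z)\<close> with
  nonnegative powers of \<open>z\<close> acts after \<open>F(z)\<close>, the remaining part before \<open>F(z)\<close>.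
\<close>

definition normal_ordered :: "('h::complex_vec \<Rightarrow> 'h \<Rightarrow> complex) \<Rightarrow> 'h \<Rightarrow> nat \<Rightarrow>
    (complex \<Rightarrow> 'h gva \<Rightarrow> 'h gva) \<Rightarrow> complex \<Rightarrow> 'h gva \<Rightarrow> 'h gva" where
  "normal_ordered form h m F n v =
     Sum_any (\<lambda>j::nat. of_nat (m - 1 + j choose j) *\<^sub>C
        (heis form h (- int (m + j)) (F (n + of_nat j) v)
         - (- 1) ^ m *\<^sub>C F (n - of_nat (m + j)) (heis form h (int j) v)))"

text \<open>
  \<open>Y a n v\<close> is the vector \<open>a(n) v\<close>.  The field of \<open>h(-m) a\<close> is the normally ordered product of
  \<open>\<partial>\<^sup>(\<^sup>m\<^sup>-\<^sup>1\<^sup>)h(z)\<close> with the field of \<open>a\<close>; for \<open>m = 1\<close> and \<open>a = |0\<rangle>\<close> this is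
  \<open>Y(h(-1)|0\<rangle>, z) = h(z)\<close>.
\<close>

definition is_state_field :: "('h::complex_vec \<Rightarrow> 'h \<Rightarrow> complex) \<Rightarrow>
    ('h gva \<Rightarrow> complex \<Rightarrow> 'h gva \<Rightarrow> 'h gva) \<Rightarrow> bool" where
  "is_state_field form Y \<longleftrightarrow>
     clinear Y \<and>
     (\<forall>\<alpha>. Y (vexp \<alpha>) = vertex_mode form \<alpha>) \<and>
     (\<forall>h m a. m \<ge> 1 \<longrightarrow> Y (heis form h (- int m) a) = normal_ordered form h m (Y a))"

definition state_field :: "('h::complex_vec \<Rightarrow> 'h \<Rightarrow> complex) \<Rightarrow>
    'h gva \<Rightarrow> complex \<Rightarrow> 'h gva \<Rightarrow> 'h gva" where
  "state_field form = (THE Y. is_state_field form Y)"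

text \<open>\<open>T a = a(-2)|0\<rangle>\<close>.\<close>

definition translation :: "('h::complex_vec \<Rightarrow> 'h \<Rightarrow> complex) \<Rightarrow> 'h gva \<Rightarrow> 'h gva" where
  "translation form a = state_field form a (- 2) vac"

definition two_cocycle :: "('h::complex_vec \<Rightarrow> 'h \<Rightarrow> complex) \<Rightarrow> bool" where
  "two_cocycle \<epsilon> \<longleftrightarrow>
     (\<forall>\<alpha> \<beta>. \<epsilon> \<alpha> \<beta> \<noteq> 0) \<and>
     (\<forall>\<alpha> \<beta> \<gamma>. \<epsilon> \<alpha> \<beta> * \<epsilon> (\<alpha> + \<beta>) \<gamma> = \<epsilon> \<beta> \<gamma> * \<epsilon> \<alpha> (\<beta> + \<gamma>)) \<and>
     (\<forall>\<alpha>. \<epsilon> \<alpha> 0 = 1 \<and> \<epsilon> 0 \<alpha> = 1)"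

definition charge_part :: "'h \<Rightarrow> 'h::complex_vec gva \<Rightarrow> 'h gva" where
  "charge_part \<alpha> a = Poly_Mapping.single \<alpha> (Poly_Mapping.lookup a \<alpha>)"

definition modified_field :: "('h::complex_vec \<Rightarrow> 'h \<Rightarrow> complex) \<Rightarrow> ('h \<Rightarrow> 'h \<Rightarrow> complex) \<Rightarrow>
    'h gva \<Rightarrow> complex \<Rightarrow> 'h gva \<Rightarrow> 'h gva" where
  "modified_field form \<epsilon> a n b =
     (\<Sum>\<alpha>\<in>Poly_Mapping.keys a. \<Sum>\<beta>\<in>Poly_Mapping.keys b.
        \<epsilon> \<alpha> \<beta> *\<^sub>C state_field form (charge_part \<alpha> a) n (charge_part \<beta> b))"

definition gva_on :: "'h set \<Rightarrow> 'h::complex_vec gva set" where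
  "gva_on L = {v. Poly_Mapping.keys v \<subseteq> L}"

definition gv_subalgebra :: "('h::complex_vec \<Rightarrow> 'h \<Rightarrow> complex) \<Rightarrow> ('h \<Rightarrow> 'h \<Rightarrow> complex) \<Rightarrow>
    'h set \<Rightarrow> 'h gva set \<Rightarrow> bool" where
  "gv_subalgebra form \<epsilon> L U \<longleftrightarrow>
     U \<subseteq> gva_on L \<and> cvec.subspace U \<and> vac \<in> U \<and>
     (\<forall>u\<in>U. translation form u \<in> U) \<and>
     (\<forall>u\<in>U. \<forall>v\<in>U. \<forall>n. modified_field form \<epsilon> u n v \<in> U)"

definition generated_gv_subalgebra :: "('h::complex_vec \<Rightarrow> 'h \<Rightarrow> complex) \<Rightarrow>
    ('h \<Rightarrow> 'h \<Rightarrow> complex) \<Rightarrow> 'h set \<Rightarrow> 'h gva set \<Rightarrow> 'h gva set" where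
  "generated_gv_subalgebra form \<epsilon> L S = \<Inter> {U. gv_subalgebra form \<epsilon> L U \<and> S \<subseteq> U}"

definition principal_subspace :: "('h::complex_vec \<Rightarrow> 'h \<Rightarrow> complex) \<Rightarrow>
    ('h \<Rightarrow> 'h \<Rightarrow> complex) \<Rightarrow> 'h set \<Rightarrow> 'h set \<Rightarrow> 'h gva set" where
  "principal_subspace form \<epsilon> L B = generated_gv_subalgebra form \<epsilon> L (vexp ` B)"

definition int_scale :: "int \<Rightarrow> 'h::complex_vec \<Rightarrow> 'h" where
  "int_scale n x = of_int n *\<^sub>C x"

interpretation zmod: module int_scale
  by standard (simp_all add: int_scale_def scaleC_add_right scaleC_add_left scaleC_scaleC scaleC_one)

text \<open>A lattice is a subgroup of \<open>'h\<close> having such a basis.\<close>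

definition Z_basis :: "'h::complex_vec set \<Rightarrow> 'h set \<Rightarrow> bool" where
  "Z_basis B L \<longleftrightarrow> zmod.independent B \<and> zmod.span B = L"

definition C_basis :: "'v::complex_vec set \<Rightarrow> 'v set \<Rightarrow> bool" where
  "C_basis B V \<longleftrightarrow> cvec.independent B \<and> cvec.span B = V"

text \<open>
  \<open>Psi_rev\<close> takes the pairs \<open>(\<beta>\<^sub>i, m\<^sub>i)\<close> in the order \<open>i = k, \<dots>, 1\<close>, in which the operators are
  written; \<open>Psi\<close> takes them in the order \<open>i = 1, \<dots>, k\<close>.
\<close>

primrec Psi_rev :: "('h::complex_vec \<Rightarrow> 'h \<Rightarrow> complex) \<Rightarrow> ('h \<Rightarrow> 'h \<Rightarrow> complex) \<Rightarrow>
    ('h \<times> int) list \<Rightarrow> 'h gva" where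
  "Psi_rev form \<epsilon> [] = vac"
| "Psi_rev form \<epsilon> (\<beta>m # xs) =
     modified_field form \<epsilon> (vexp (fst \<beta>m))
       (of_int (snd \<beta>m) - (\<Sum>x\<leftarrow>xs. form (fst \<beta>m) (fst x)))
       (Psi_rev form \<epsilon> xs)"

definition Psi :: "('h::complex_vec \<Rightarrow> 'h \<Rightarrow> complex) \<Rightarrow> ('h \<Rightarrow> 'h \<Rightarrow> complex) \<Rightarrow>
    ('h \<times> int) list \<Rightarrow> 'h gva" where
  "Psi form \<epsilon> xs = Psi_rev form \<epsilon> (rev xs)"

definition Psi_index :: "('h \<times> 'h) set \<Rightarrow> 'h set \<Rightarrow> ('h \<times> int) list set" where
  "Psi_index r B =
     {xs. fst ` set xs \<subseteq> B \<and> snd ` set xs \<subseteq> {..<0} \<and>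
          (\<forall>i j. i < j \<longrightarrow> j < length xs \<longrightarrow>
             (fst (xs ! i), fst (xs ! j)) \<in> r \<and>
             (fst (xs ! i) = fst (xs ! j) \<longrightarrow> snd (xs ! i) \<ge> snd (xs ! j)))}"


section \<open>Well-definedness of the operators and of the state-field correspondence\<close>

lemma clinear_add: "clinear f \<Longrightarrow> f (x + y) = f x + f y"
  and clinear_scale: "clinear f \<Longrightarrow> f (c *\<^sub>C x) = c *\<^sub>C f x"
  by (simp_all add: clinear_iff)

lemma clinear_zero: "clinear f \<Longrightarrow> f 0 = 0"
  using clinear_scale[of f 0 0] by simp

lemma clinear_diff: "clinear f \<Longrightarrow> f (x - y) = f x - f y"
  using clinear_add[of f "x - y" y] by (simp add: algebra_simps)

lemma clinear_minus: "clinear f \<Longrightarrow> f (- y) = - f y"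
  using clinear_diff[of f 0 y] by (simp add: clinear_zero)

lemma clinear_sum: "clinear f \<Longrightarrow> f (sum g A) = (\<Sum>x\<in>A. f (g x))"
  by (induction A rule: infinite_finite_induct) (simp_all add: clinear_zero clinear_add)

lemma clinearI: "(\<And>x y. f (x + y) = f x + f y) \<Longrightarrow> (\<And>c x. f (c *\<^sub>C x) = c *\<^sub>C f x) \<Longrightarrow> clinear f"
  by (simp add: clinear_iff)

text \<open>
  Commuting operators, depending linearly on the vectors of \<open>'h\<close>, make a space a module over the
  symmetric algebra.
\<close>

lemma fock_act_exists:
  fixes N :: "'h::complex_vec \<Rightarrow> nat \<Rightarrow> 'f::complex_vec \<Rightarrow> 'f"
  assumes S: "cvec.subspace S" "f0 \<in> S"
    and inv: "\<And>x k f. f \<in> S \<Longrightarrow> N x k f \<in> S"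
    and add: "\<And>x k f g. f \<in> S \<Longrightarrow> g \<in> S \<Longrightarrow> N x k (f + g) = N x k f + N x k g"
    and scale: "\<And>x k c f. f \<in> S \<Longrightarrow> N x k (c *\<^sub>C f) = c *\<^sub>C N x k f"
    and addx: "\<And>x y k f. f \<in> S \<Longrightarrow> N (x + y) k f = N x k f + N y k f"
    and scalex: "\<And>x k c f. f \<in> S \<Longrightarrow> N (c *\<^sub>C x) k f = c *\<^sub>C N x k f"
    and comm: "\<And>x k y l f. f \<in> S \<Longrightarrow> N x k (N y l f) = N y l (N x k f)"
  shows "\<exists>A :: 'h fock \<Rightarrow> 'f. clinear A \<and> A 1 = f0 \<and> range A \<subseteq> S \<and>
           (\<forall>x k u. A (fgen x k * u) = N x k (A u))"
proof -
  define N' where "N' = (\<lambda>xk f. if f \<in> S then N (fst xk) (snd xk) f else f)"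
  interpret c: comp_fun_commute N'
    by standard (auto simp: N'_def fun_eq_iff inv comm)
  define mon where "mon M = fold_mset N' f0 M" for M
  have N'S: "N' xk f \<in> S" if "f \<in> S" for xk f
    using that by (simp add: N'_def inv)
  have monS: "mon M \<in> S" for M
    by (induction M) (simp_all add: mon_def S N'S)
  have mon_add: "mon (add_mset (x, k) M) = N x k (mon M)" for x k M
  proof -
    have "mon (add_mset (x, k) M) = N' (x, k) (mon M)"
      by (simp add: mon_def)
    thus ?thesis using monS[of M] by (simp add: N'_def)
  qed
  define A where "A p = (\<Sum>M\<in>Poly_Mapping.keys p. Poly_Mapping.lookup p M *\<^sub>C mon M)" for p
  have A_eq: "A p = (\<Sum>M\<in>K. Poly_Mapping.lookup p M *\<^sub>C mon M)"
    if "finite K" "Poly_Mapping.keys p \<subseteq> K" for p K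
    unfolding A_def by (rule sum.mono_neutral_left) (use that in \<open>auto simp: in_keys_iff\<close>)
  have A_add: "A (p + q) = A p + A q" for p q
  proof -
    let ?K = "Poly_Mapping.keys p \<union> Poly_Mapping.keys q"
    have "A (p + q) = (\<Sum>M\<in>?K. Poly_Mapping.lookup (p + q) M *\<^sub>C mon M)"
      by (rule A_eq) (auto simp: Poly_Mapping.keys_add)
    also have "\<dots> = A p + A q"
      by (simp add: A_eq[of ?K p] A_eq[of ?K q] lookup_add scaleC_add_left sum.distrib)
    finally show ?thesis .
  qed
  have A_single: "A (Poly_Mapping.single M c) = c *\<^sub>C mon M" for M c
    by (cases "c = 0") (simp_all add: A_def)
  have AS: "A p \<in> S" for p
    unfolding A_def using S monS by (auto intro!: cvec.subspace_sum cvec.subspace_scale)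
  have A_minus: "A (- p) = - A p" for p
    using A_add[of p "- p"] A_single[of "{#}" 0] by (simp add: add_eq_0_iff)
  have A_diff: "A (p - q) = A p - A q" for p q
    using A_add[of p "- q"] A_minus[of q] by simp
  have A_const: "A (Poly_Mapping.single {#} c * p) = c *\<^sub>C A p" for c p
    by (induction p rule: poly_mapping_induct)
      (simp_all add: mult_single A_single A_add distrib_left scaleC_add_right)
  have A_sym: "A (sym x k * p) = N x k (A p)" for x k p
    by (induction p rule: poly_mapping_induct)
      (simp_all add: sym_def mult_single A_single A_add distrib_left mon_add monS scale add AS)
  have N0: "N x k 0 = 0" for x k
    using scale[of f0 x k 0] S by simp
  have A_mult0: "A (r * p) = 0" if p: "A p = 0" for r p
  proof (induction r rule: poly_mapping_induct)
    case (single M c)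
    show ?case
    proof (induction M)
      case empty
      show ?case by (simp add: A_const p)
    next
      case (add xk M)
      have "Poly_Mapping.single (add_mset xk M) c * p =
          sym (fst xk) (snd xk) * (Poly_Mapping.single M c * p)"
        by (simp add: sym_def mult_single flip: mult.assoc)
      thus ?case using add by (simp add: A_sym N0)
    qed
  next
    case (add r s)
    thus ?case by (simp add: distrib_right A_add)
  qed
  have A_symx: "A (sym x k) = N x k f0" for x k
    using A_single[of "{#(x, k)#}" 1] mon_add[of x k "{#}"] by (simp add: sym_def mon_def)
  have A_ideal: "A p = 0" if "p \<in> lin_ideal" for p
    using that
  proof induction
    case (sym_add x y k)
    show ?case by (simp add: A_diff A_symx addx S)
  next
    case (sym_scale c x k)
    show ?case by (simp add: A_diff A_const A_symx scalex S)
  next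
    case (add p q)
    thus ?case by (simp add: A_add)
  next
    case (mult p r)
    thus ?case by (simp add: A_mult0)
  qed
  define B where "B u = A (rep_fock u)" for u
  have B_abs: "B (abs_fock p) = A p" for p
  proof -
    have "rep_fock (abs_fock p) - p \<in> lin_ideal"
      using Quotient_rep_abs[OF Quotient_fock, of p] by (simp add: lin_ideal_zero)
    from A_ideal[OF this] show ?thesis
      by (simp add: B_def A_diff)
  qed
  have ex: "\<exists>p. u = abs_fock p" for u :: "'h fock"
    using Quotient_abs_rep[OF Quotient_fock, of u] by metis
  have "clinear B"
  proof (rule clinearI)
    fix u v :: "'h fock" and c :: complex
    obtain p q where [simp]: "u = abs_fock p" "v = abs_fock q"
      using ex by blast
    show "B (u + v) = B u + B v"
      by (simp add: plus_fock.abs_eq B_abs A_add)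
    show "B (c *\<^sub>C u) = c *\<^sub>C B u"
      by (simp add: scaleC_fock.abs_eq B_abs A_const)
  qed
  moreover have "B 1 = f0"
    using A_single[of "{#}" 1] by (simp add: one_fock.abs_eq B_abs mon_def flip: zero_multiset_def)
  moreover have "range B \<subseteq> S"
    using AS by (auto simp: B_def)
  moreover have "B (fgen x k * u) = N x k (B u)" for x k u
  proof -
    obtain p where "u = abs_fock p" using ex by blast
    thus ?thesis by (simp add: fgen.abs_eq times_fock.abs_eq B_abs A_sym)
  qed
  ultimately show ?thesis by blast
qed

lemma fock_derivation_unique:
  assumes "fock_derivation d" "fock_derivation e" "\<And>x k. d (fgen x k) = e (fgen x k)"
  shows "d = e"
proof
  have one: "f 1 = 0" if "fock_derivation f" for f :: "'a fock \<Rightarrow> 'a fock"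
    using that unfolding fock_derivation_def
    by (metis add_cancel_right_right mult.right_neutral mult_1)
  fix u
  show "d u = e u"
    by (induction u rule: fock_induct)
      (use assms one[OF assms(1)] one[OF assms(2)] in \<open>auto simp: fock_derivation_def clinear_iff\<close>)
qed

lemma fock_derivation_exists:
  fixes c :: "'h::complex_vec \<Rightarrow> nat \<Rightarrow> 'h fock"
  assumes add: "\<And>x y k. c (x + y) k = c x k + c y k"
    and scale: "\<And>a x k. c (a *\<^sub>C x) k = a *\<^sub>C c x k"
  shows "\<exists>d. fock_derivation d \<and> (\<forall>x k. d (fgen x k) = c x k)"
proof -
  define N :: "'h \<Rightarrow> nat \<Rightarrow> (bool \<Rightarrow> 'h fock) \<Rightarrow> bool \<Rightarrow> 'h fock" where
    "N x k f = (\<lambda>b. if b then fgen x k * f True else fgen x k * f False + c x k * f True)" for x k f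
  have "\<exists>A :: 'h fock \<Rightarrow> bool \<Rightarrow> 'h fock. clinear A \<and> A 1 = (\<lambda>b. if b then 1 else 0) \<and>
      range A \<subseteq> UNIV \<and> (\<forall>x k u. A (fgen x k * u) = N x k (A u))"
    by (rule fock_act_exists)
      (auto simp: N_def fun_eq_iff plus_fun_def scaleC_fun_def algebra_simps fgen_add fgen_scaleC
        add scale scaleC_mult_fock mult_scaleC_fock scaleC_add_right)
  then obtain A :: "'h fock \<Rightarrow> bool \<Rightarrow> 'h fock" where A: "clinear A" "A 1 = (\<lambda>b. if b then 1 else 0)"
      "\<And>x k u. A (fgen x k * u) = N x k (A u)"
    by blast
  have AT: "A u True = u" for u
    by (induction u rule: fock_induct)
      (use A in \<open>auto simp: clinear_iff N_def plus_fun_def scaleC_fun_def\<close>)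
  define d where "d u = A u False" for u
  have lin: "d (u + v) = d u + d v" "d (a *\<^sub>C u) = a *\<^sub>C d u" for u v a
    using A by (auto simp: d_def clinear_iff plus_fun_def scaleC_fun_def)
  have gen: "d (fgen x k * u) = fgen x k * d u + c x k * u" for x k u
    by (simp add: d_def A N_def AT)
  have one: "d 1 = 0"
    by (simp add: d_def A)
  have "d (u * v) = d u * v + u * d v" for u v
  proof (induction u rule: fock_induct)
    case (fgen x k u)
    have "d (fgen x k * u * v) = fgen x k * d (u * v) + c x k * (u * v)"
      using gen[of x k "u * v"] by (simp add: mult.assoc)
    thus ?case by (simp only: fgen gen) (simp add: algebra_simps)
  qed (simp_all add: one lin distrib_right scaleC_mult_fock mult_scaleC_fock scaleC_add_right)
  moreover have "d (fgen x k) = c x k" for x k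
    using gen[of x k 1] by (simp add: one)
  ultimately show ?thesis
    using lin by (auto simp: fock_derivation_def clinear_iff)
qed

context
  fixes form :: "'h::complex_vec \<Rightarrow> 'h \<Rightarrow> complex"
  assumes form: "symmetric_bilinear form"
begin

lemma form_simps:
  "form (x + y) z = form x z + form y z" "form x (y + z) = form x y + form x z"
  "form (c *\<^sub>C x) z = c * form x z" "form x (c *\<^sub>C z) = c * form x z"
proof -
  have sym: "form x y = form y x" for x y
    using form by (auto simp: symmetric_bilinear_def)
  have r: "form x (y + z) = form x y + form x z" "form x (c *\<^sub>C z) = c * form x z" for x y z c
  proof -
    have lin: "clinear (form x)" using form by (simp add: symmetric_bilinear_def)
    show "form x (y + z) = form x y + form x z" by (rule clinear_add[OF lin])
    show "form x (c *\<^sub>C z) = c * form x z"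
      using clinear_scale[OF lin, of c z] by (simp add: scaleC_complex_def)
  qed
  show "form (x + y) z = form x z + form y z" "form x (y + z) = form x y + form x z"
    "form (c *\<^sub>C x) z = c * form x z" "form x (c *\<^sub>C z) = c * form x z"
    using r sym by metis+
qed

lemma annih:
  shows fock_derivation_annih: "fock_derivation (annih form h n)"
    and annih_fgen: "annih form h n (fgen x k) = (if n = k + 1 then of_nat n * form h x else 0) *\<^sub>C 1"
proof -
  let ?c = "\<lambda>x k. (if n = k + 1 then of_nat n * form h x else 0) *\<^sub>C (1 :: 'h fock)"
  have "\<exists>d. fock_derivation d \<and> (\<forall>x k. d (fgen x k) = ?c x k)"
    by (rule fock_derivation_exists) (auto simp: form_simps algebra_simps scaleC_add_left scaleC_scaleC)
  hence "\<exists>!d. fock_derivation d \<and> (\<forall>x k. d (fgen x k) = ?c x k)"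
    using fock_derivation_unique by (metis (no_types, lifting))
  from theI'[OF this]
  show "fock_derivation (annih form h n)"
    and "annih form h n (fgen x k) = (if n = k + 1 then of_nat n * form h x else 0) *\<^sub>C 1"
    unfolding annih_def by blast+
qed

lemma clinear_annih: "clinear (annih form h n)"
  using fock_derivation_annih by (simp add: fock_derivation_def)

lemmas annih_lin = clinear_add[OF clinear_annih] clinear_scale[OF clinear_annih]
  clinear_zero[OF clinear_annih]

lemma annih_mult: "annih form h n (u * v) = annih form h n u * v + u * annih form h n v"
  using fock_derivation_annih[of h n] by (simp add: fock_derivation_def)

lemma annih_one: "annih form h n 1 = 0"
  using annih_mult[of h n 1 1] by simp

lemma annih_fgen_mult: "annih form h n (fgen x k * u) =
    (if n = k + 1 then of_nat n * form h x else 0) *\<^sub>C u + fgen x k * annih form h n u"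
  by (simp add: annih_mult annih_fgen scaleC_mult_fock)

lemma annih_linear_left:
  "annih form (x + y) n u = annih form x n u + annih form y n u"
  "annih form (c *\<^sub>C x) n u = c *\<^sub>C annih form x n u"
  by (induction u rule: fock_induct)
    (simp_all add: annih_one annih_lin annih_fgen_mult form_simps distrib_left scaleC_add_left
      scaleC_add_right cvec.scale_left_commute add.assoc add.left_commute mult_scaleC_fock
      scaleC_scaleC mult.left_commute[where ?'a = complex] mult.commute[where ?'a = complex])

lemma annih_commute: "annih form x m (annih form y n u) = annih form y n (annih form x m u)"
  by (induction u rule: fock_induct)
    (simp_all add: annih_one annih_lin annih_fgen_mult distrib_left scaleC_add_right add.assoc
      add.left_commute mult_scaleC_fock)

text \<open>Vectors of bounded degree.\<close>

inductive in_fil :: "nat \<Rightarrow> 'h fock \<Rightarrow> bool" where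
  "in_fil d 0"
| "in_fil d 1"
| "in_fil d u \<Longrightarrow> d + k + 1 \<le> e \<Longrightarrow> in_fil e (fgen x k * u)"
| "in_fil d u \<Longrightarrow> in_fil d v \<Longrightarrow> in_fil d (u + v)"
| "in_fil d u \<Longrightarrow> in_fil d (c *\<^sub>C u)"

definition fil :: "nat \<Rightarrow> 'h fock set" where
  "fil d = {u. in_fil d u}"

lemma in_fil_iff: "in_fil d u \<longleftrightarrow> u \<in> fil d"
  by (simp add: fil_def)

lemmas fil_intros = in_fil.intros[unfolded in_fil_iff]
lemmas fil_induct = in_fil.induct[unfolded in_fil_iff, consumes 1, case_names zero one gen add scale]

lemma fil_mono: "u \<in> fil d \<Longrightarrow> d \<le> e \<Longrightarrow> u \<in> fil e"
proof (induction arbitrary: e rule: fil_induct)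
  case (gen d u k e' x)
  thus ?case by (intro fil_intros(3)[of u d k]) auto
qed (auto intro: fil_intros)

lemma fil_exhaust: "\<exists>d. u \<in> fil d"
proof (induction u rule: fock_induct)
  case (add u v)
  then obtain d e where "u \<in> fil d" "v \<in> fil e" by blast
  hence "u \<in> fil (max d e)" "v \<in> fil (max d e)" by (auto intro: fil_mono)
  thus ?case by (blast intro: fil_intros)
qed (blast intro: fil_intros)+

lemma annih_fil:
  assumes "u \<in> fil d" "n \<ge> 1"
  shows "annih form h n u \<in> fil (d - n) \<and> (n > d \<longrightarrow> annih form h n u = 0)"
  using assms
proof (induction rule: fil_induct)
  case (gen d u k e x)
  have "fgen x k * annih form h n u \<in> fil (e - n)"
  proof (cases "n > d")
    case True
    thus ?thesis using gen by (simp add: fil_intros(1))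
  next
    case False
    thus ?thesis using gen by (auto intro: fil_intros(3)[of _ "d - n"])
  qed
  moreover have "c *\<^sub>C u \<in> fil (e - n)" if "n = k + 1" for c
    using gen that by (intro fil_intros(5)) (auto intro: fil_mono)
  ultimately show ?case
    using gen by (auto simp: annih_fgen_mult intro!: fil_intros(4))
qed (auto simp: annih_lin annih_one intro: fil_intros)

definition Fil :: "nat \<Rightarrow> 'h gva set" where
  "Fil d = {v. \<forall>\<beta>. Poly_Mapping.lookup v \<beta> \<in> fil d}"

lemma Fil_subspace: "cvec.subspace (Fil d)"
  by (auto simp: cvec.subspace_def Fil_def lookup_add lookup_scaleC intro: fil_intros)

lemma Fil_mono: "v \<in> Fil d \<Longrightarrow> d \<le> e \<Longrightarrow> v \<in> Fil e"
  by (auto simp: Fil_def intro: fil_mono)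

lemma Fil_exhaust: "\<exists>d. v \<in> Fil d"
proof -
  have "\<forall>\<beta>. \<exists>d. Poly_Mapping.lookup v \<beta> \<in> fil d" using fil_exhaust by blast
  then obtain f where "\<forall>\<beta>. Poly_Mapping.lookup v \<beta> \<in> fil (f \<beta>)"
    by (rule choice[THEN exE])
  hence f: "Poly_Mapping.lookup v \<beta> \<in> fil (f \<beta>)" for \<beta> by blast
  have "Poly_Mapping.lookup v \<beta> \<in> fil (\<Sum>\<gamma>\<in>Poly_Mapping.keys v. f \<gamma>)" for \<beta>
  proof (cases "\<beta> \<in> Poly_Mapping.keys v")
    case True
    thus ?thesis by (intro fil_mono[OF f]) (simp add: member_le_sum)
  next
    case False
    thus ?thesis by (simp add: in_keys_iff fil_intros(1))
  qed
  thus ?thesis by (auto simp: Fil_def)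
qed

lemma lookup_single_0_mult:
  "Poly_Mapping.lookup (Poly_Mapping.single 0 g * v) \<beta> = g * Poly_Mapping.lookup v \<beta>"
  for v :: "'h gva"
  by (simp add: Poly_Mapping.map.rep_eq when_def flip: mult_map_scale_conv_mult)

lemma lookup_single_mult:
  "Poly_Mapping.lookup (Poly_Mapping.single \<alpha> g * v) \<beta> = g * Poly_Mapping.lookup v (\<beta> - \<alpha>)"
  for v :: "'h gva"
proof (induction v rule: poly_mapping_induct)
  case (single k c)
  have "\<alpha> + k = \<beta> \<longleftrightarrow> k = \<beta> - \<alpha>" by (auto simp: algebra_simps)
  thus ?case by (simp add: mult_single lookup_single when_def)
qed (simp add: distrib_left lookup_add)

lemma lookup_heis: "Poly_Mapping.lookup (heis form h n v) \<beta> =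
   (if n < 0 then fgen h (nat (- n - 1)) * Poly_Mapping.lookup v \<beta>
    else if n = 0 then form h \<beta> *\<^sub>C Poly_Mapping.lookup v \<beta>
    else annih form h (nat n) (Poly_Mapping.lookup v \<beta>))"
  by (auto simp: heis_def lookup_single_0_mult lookup_mapp Poly_Mapping.map.rep_eq when_def
      annih_lin in_keys_iff)

lemma clinear_heis: "clinear (heis form h n)"
  by (rule clinearI; rule poly_mapping_eqI)
    (auto simp: lookup_heis lookup_add lookup_scaleC distrib_left mult_scaleC_fock
      scaleC_add_right cvec.scale_left_commute annih_lin)

lemma heis_linear_left:
  "heis form (x + y) n v = heis form x n v + heis form y n v"
  "heis form (c *\<^sub>C x) n v = c *\<^sub>C heis form x n v"
  by (rule poly_mapping_eqI;
      auto simp: lookup_heis lookup_add lookup_scaleC distrib_right scaleC_mult_fock fgen_add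
        fgen_scaleC scaleC_add_left scaleC_scaleC annih_linear_left form_simps)+

lemma heis_commute_neg: "m < 0 \<Longrightarrow> n < 0 \<Longrightarrow>
    heis form x m (heis form y n v) = heis form y n (heis form x m v)"
  by (rule poly_mapping_eqI) (simp add: lookup_heis mult.left_commute)

lemma heis_commute_nonneg: "m \<ge> 0 \<Longrightarrow> n \<ge> 0 \<Longrightarrow>
    heis form x m (heis form y n v) = heis form y n (heis form x m v)"
  by (rule poly_mapping_eqI) (auto simp: lookup_heis annih_lin annih_commute scaleC_scaleC mult.commute)

lemma heis_Fil:
  assumes "v \<in> Fil d"
  shows "heis form h (int n) v \<in> Fil (d - n)" "n > d \<Longrightarrow> heis form h (int n) v = 0"
proof -
  show "heis form h (int n) v \<in> Fil (d - n)"
    using assms annih_fil[of _ d n] by (cases "n = 0") (auto simp: Fil_def lookup_heis intro: fil_intros(5))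
  show "heis form h (int n) v = 0" if "n > d"
    using assms annih_fil[of _ d n] that
    by (auto intro!: poly_mapping_eqI simp: Fil_def lookup_heis)
qed

lemma heis_Fil_le: "v \<in> Fil d \<Longrightarrow> heis form h (int n) v \<in> Fil d"
  using heis_Fil(1) Fil_mono by (metis diff_le_self)

lemma series_pow_linear:
  assumes "\<And>j. j \<ge> 1 \<Longrightarrow> clinear (A j :: 'v::complex_vec \<Rightarrow> 'v)"
  shows "clinear (series_pow A k n)"
proof (induction k arbitrary: n)
  case 0
  show ?case by (rule clinearI) auto
next
  case (Suc k)
  show ?case
    by (rule clinearI)
      (simp_all add: clinear_add[OF Suc] clinear_scale[OF Suc] clinear_add[OF assms]
        clinear_scale[OF assms] sum.distrib cvec.scale_sum_right)
qed

lemma series_exp_linear: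
  assumes "\<And>j. j \<ge> 1 \<Longrightarrow> clinear (A j :: 'v::complex_vec \<Rightarrow> 'v)"
  shows "clinear (series_exp A n)"
  by (rule clinearI)
    (simp_all add: series_exp_def clinear_add[OF series_pow_linear[OF assms]]
      clinear_scale[OF series_pow_linear[OF assms]] scaleC_add_right sum.distrib
      cvec.scale_sum_right mult.commute)

definition "raise_op \<alpha> j = (1 / of_nat j) *\<^sub>C heis form \<alpha> (- int j)"
definition "lower_op \<alpha> j = (- 1 / of_nat j) *\<^sub>C heis form \<alpha> (int j)"

lemma clinear_scaled_heis: "clinear (c *\<^sub>C heis form h n)"
  by (rule clinearI)
    (simp_all add: scaleC_fun_def clinear_add[OF clinear_heis] clinear_scale[OF clinear_heis]
      scaleC_add_right scaleC_scaleC mult.commute)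

lemma clinear_raise_lower: "clinear (raise_op \<alpha> j)" "clinear (lower_op \<alpha> j)"
  unfolding raise_op_def lower_op_def by (rule clinear_scaled_heis)+

lemmas clinear_series = series_exp_linear[OF clinear_raise_lower(1)]
  series_exp_linear[OF clinear_raise_lower(2)]

lemma lower_pow_Fil:
  assumes "v \<in> Fil d"
  shows "series_pow (lower_op \<alpha>) k n v \<in> Fil (d - n) \<and>
    (n > d \<longrightarrow> series_pow (lower_op \<alpha>) k n v = 0)"
proof (induction k arbitrary: n)
  case 0
  show ?case using assms cvec.subspace_0[OF Fil_subspace] by auto
next
  case (Suc k)
  have *: "lower_op \<alpha> j (series_pow (lower_op \<alpha>) k (n - j) v) \<in> Fil (d - n) \<and>
      (n > d \<longrightarrow> lower_op \<alpha> j (series_pow (lower_op \<alpha>) k (n - j) v) = 0)"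
    if j: "j \<in> {1..n}" for j
  proof -
    let ?w = "series_pow (lower_op \<alpha>) k (n - j) v"
    show ?thesis
    proof (cases "n - j > d")
      case True
      hence "?w = 0" using Suc by blast
      thus ?thesis
        by (simp add: clinear_zero[OF clinear_raise_lower(2)] cvec.subspace_0[OF Fil_subspace])
    next
      case False
      have w: "?w \<in> Fil (d - (n - j))" using Suc by blast
      have eq: "d - (n - j) - j = d - n" using False j by auto
      have "heis form \<alpha> (int j) ?w \<in> Fil (d - n)"
        using heis_Fil(1)[OF w, of \<alpha> j] unfolding eq .
      moreover have "heis form \<alpha> (int j) ?w = 0" if "n > d"
        using heis_Fil(2)[OF w] that False j by auto
      ultimately show ?thesis
        unfolding lower_op_def scaleC_fun_def
        by (intro conjI impI cvec.subspace_scale[OF Fil_subspace]) (simp_all only: cvec.scale_zero_right)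
    qed
  qed
  show ?case
    using * by (auto intro!: cvec.subspace_sum[OF Fil_subspace] sum.neutral)
qed

lemma lower_exp_zero:
  "v \<in> Fil d \<Longrightarrow> q > d \<Longrightarrow> series_exp (lower_op \<alpha>) q v = 0"
  using lower_pow_Fil by (simp add: series_exp_def)

lemma lookup_zpow:
  "Poly_Mapping.lookup (zpow form \<alpha> s v) \<beta> = (if form \<alpha> \<beta> = s then Poly_Mapping.lookup v \<beta> else 0)"
  by (auto simp: zpow_def lookup_mapp when_def in_keys_iff)

lemma clinear_zpow: "clinear (zpow form \<alpha> s)"
  by (rule clinearI; rule poly_mapping_eqI) (auto simp: lookup_zpow lookup_add lookup_scaleC)

lemma heis_keys: "Poly_Mapping.keys (heis form h n v) \<subseteq> Poly_Mapping.keys v"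
  by (auto simp: in_keys_iff lookup_heis annih_lin split: if_splits)

lemma keys_supp_subspace: "cvec.subspace {v :: 'h gva. Poly_Mapping.keys v \<subseteq> K}"
  unfolding cvec.subspace_def
  by (auto simp: lookup_add lookup_scaleC subset_iff in_keys_iff) (metis add.right_neutral)

lemma series_pow_keys:
  fixes A :: "nat \<Rightarrow> 'h gva \<Rightarrow> 'h gva"
  assumes "\<And>j v. Poly_Mapping.keys (A j v) \<subseteq> Poly_Mapping.keys v"
  shows "Poly_Mapping.keys (series_pow A k n v) \<subseteq> Poly_Mapping.keys v"
proof (induction k arbitrary: n)
  case (Suc k)
  have "(\<Sum>j = 1..n. A j (series_pow A k (n - j) v)) \<in> {w. Poly_Mapping.keys w \<subseteq> Poly_Mapping.keys v}"
    by (rule cvec.subspace_sum[OF keys_supp_subspace]) (use assms Suc in blast)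
  thus ?case by simp
qed auto

lemma series_exp_keys:
  fixes A :: "nat \<Rightarrow> 'h gva \<Rightarrow> 'h gva"
  assumes "\<And>j v. Poly_Mapping.keys (A j v) \<subseteq> Poly_Mapping.keys v"
  shows "Poly_Mapping.keys (series_exp A n v) \<subseteq> Poly_Mapping.keys v"
proof -
  have "series_exp A n v \<in> {w. Poly_Mapping.keys w \<subseteq> Poly_Mapping.keys v}"
    unfolding series_exp_def
    by (intro cvec.subspace_sum[OF keys_supp_subspace] cvec.subspace_scale[OF keys_supp_subspace])
      (use series_pow_keys[OF assms] in auto)
  thus ?thesis by simp
qed

lemma scaled_heis_keys: "Poly_Mapping.keys ((c *\<^sub>C heis form h n) v) \<subseteq> Poly_Mapping.keys v"
  using heis_keys[of h n v] by (auto simp: scaleC_fun_def in_keys_iff lookup_scaleC)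

lemma raise_lower_keys: "Poly_Mapping.keys (raise_op \<alpha> j v) \<subseteq> Poly_Mapping.keys v"
  "Poly_Mapping.keys (lower_op \<alpha> j v) \<subseteq> Poly_Mapping.keys v"
  unfolding raise_op_def lower_op_def by (rule scaled_heis_keys)+

definition vertex_summand :: "'h \<Rightarrow> complex \<Rightarrow> 'h gva \<Rightarrow> nat \<times> nat \<Rightarrow> 'h gva" where
  "vertex_summand \<alpha> n v = (\<lambda>(p, q). Poly_Mapping.single \<alpha> 1 *
     zpow form \<alpha> (- n - 1 - of_nat p + of_nat q)
       (series_exp (raise_op \<alpha>) p (series_exp (lower_op \<alpha>) q v)))"

lemma vertex_mode_alt: "vertex_mode form \<alpha> n v = Sum_any (vertex_summand \<alpha> n v)"
  by (simp add: vertex_mode_def vertex_summand_def raise_op_def[abs_def] lower_op_def[abs_def])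

lemma vertex_summand_linear: "clinear (\<lambda>v. vertex_summand \<alpha> n v pq)"
  by (cases pq, rule clinearI)
    (simp_all add: vertex_summand_def clinear_add[OF clinear_zpow] clinear_scale[OF clinear_zpow]
      clinear_series[THEN clinear_add] clinear_series[THEN clinear_scale] distrib_left,
     auto intro!: poly_mapping_eqI simp: lookup_single_mult lookup_scaleC mult_scaleC_fock)

lemma vertex_summand_nonzero:
  assumes "vertex_summand \<alpha> n v (p, q) \<noteq> 0" "v \<in> Fil d"
  shows "q \<le> d \<and> (\<exists>\<beta>\<in>Poly_Mapping.keys v. of_nat p = - n - 1 + of_nat q - form \<alpha> \<beta>)"
proof
  show "q \<le> d"
  proof (rule ccontr)
    assume "\<not> q \<le> d"
    hence "series_exp (lower_op \<alpha>) q v = 0"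
      using lower_exp_zero[OF assms(2)] by auto
    thus False using assms(1)
      by (simp add: vertex_summand_def clinear_zero[OF clinear_zpow]
          clinear_series[THEN clinear_zero])
  qed
  let ?w = "series_exp (raise_op \<alpha>) p (series_exp (lower_op \<alpha>) q v)"
  have w: "Poly_Mapping.keys ?w \<subseteq> Poly_Mapping.keys v"
    using series_exp_keys[of "raise_op \<alpha>", OF raise_lower_keys(1)]
      series_exp_keys[of "lower_op \<alpha>", OF raise_lower_keys(2)] by blast
  have "zpow form \<alpha> (- n - 1 - of_nat p + of_nat q) ?w \<noteq> 0"
    using assms(1) by (auto simp: vertex_summand_def)
  then obtain \<beta> where "Poly_Mapping.lookup (zpow form \<alpha> (- n - 1 - of_nat p + of_nat q) ?w) \<beta> \<noteq> 0"
    by (metis poly_mapping_eqI lookup_zero)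
  hence "form \<alpha> \<beta> = - n - 1 - of_nat p + of_nat q" "\<beta> \<in> Poly_Mapping.keys ?w"
    by (auto simp: lookup_zpow in_keys_iff split: if_splits)
  thus "\<exists>\<beta>\<in>Poly_Mapping.keys v. of_nat p = - n - 1 + of_nat q - form \<alpha> \<beta>"
    using w by (intro bexI[of _ \<beta>]) auto
qed

lemma vertex_summand_finite: "finite {pq. vertex_summand \<alpha> n v pq \<noteq> 0}"
proof -
  obtain d where d: "v \<in> Fil d" using Fil_exhaust by blast
  let ?f = "\<lambda>(\<beta>, q). (SOME p. of_nat p = - n - 1 + of_nat q - form \<alpha> \<beta> :: nat, q :: nat)"
  have "{pq. vertex_summand \<alpha> n v pq \<noteq> 0} \<subseteq> ?f ` (Poly_Mapping.keys v \<times> {..d})"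
  proof safe
    fix p q
    assume nz: "vertex_summand \<alpha> n v (p, q) \<noteq> 0"
    from vertex_summand_nonzero[OF nz d] obtain \<beta> where b: "q \<le> d" "\<beta> \<in> Poly_Mapping.keys v"
      "of_nat p = - n - 1 + of_nat q - form \<alpha> \<beta>" by blast
    have "(SOME p. of_nat p = - n - 1 + of_nat q - form \<alpha> \<beta>) = p"
      by (rule some_equality, rule b(3)) (metis b(3) of_nat_eq_iff)
    thus "(p, q) \<in> ?f ` (Poly_Mapping.keys v \<times> {..d})"
      using b by (intro image_eqI[of _ _ "(\<beta>, q)"]) auto
  qed
  thus ?thesis by (rule finite_subset) auto
qed

lemma Sum_any_linear:
  assumes "clinear f" "finite {i. g i \<noteq> 0}"
  shows "f (Sum_any g) = Sum_any (\<lambda>i. f (g i))"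
proof -
  have "Sum_any (\<lambda>i. f (g i)) = (\<Sum>i\<in>{i. g i \<noteq> 0}. f (g i))"
    by (rule Sum_any.expand_superset) (use assms clinear_zero[OF assms(1)] in auto)
  thus ?thesis by (simp add: Sum_any.expand_set clinear_sum[OF assms(1)])
qed

lemma clinear_Sum_any:
  fixes g :: "'v::complex_vec \<Rightarrow> 'i \<Rightarrow> 'w::complex_vec"
  assumes "\<And>i. clinear (\<lambda>v. g v i)" "\<And>v. finite {i. g v i \<noteq> 0}"
  shows "clinear (\<lambda>v. Sum_any (g v))"
proof (rule clinearI)
  fix x y :: 'v and c :: complex
  show "Sum_any (g (x + y)) = Sum_any (g x) + Sum_any (g y)"
    using Sum_any.distrib[OF assms(2)[of x] assms(2)[of y]] assms(1) by (simp add: clinear_iff)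
  have "clinear (\<lambda>w :: 'w. c *\<^sub>C w)"
    by (rule clinearI) (simp_all add: scaleC_add_right scaleC_scaleC mult.commute)
  from Sum_any_linear[OF this assms(2)[of x]]
  show "Sum_any (g (c *\<^sub>C x)) = c *\<^sub>C Sum_any (g x)"
    using assms(1) by (simp add: clinear_iff)
qed

definition fields :: "(complex \<Rightarrow> 'h gva \<Rightarrow> 'h gva) set" where
  "fields = {F. (\<forall>n. clinear (F n)) \<and> (\<forall>v n. \<exists>N::nat. \<forall>j\<ge>N. F (n + of_nat j) v = 0)}"

lemma vertex_mode_fields: "vertex_mode form \<alpha> \<in> fields"
  unfolding fields_def
proof (intro CollectI conjI allI)
  fix n
  show "clinear (vertex_mode form \<alpha> n)"
    using clinear_Sum_any[OF vertex_summand_linear vertex_summand_finite]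
    by (simp add: vertex_mode_alt[abs_def])
next
  fix v n
  obtain d where d: "v \<in> Fil d" using Fil_exhaust by blast
  obtain N :: nat where N: "\<And>\<beta>. \<beta> \<in> Poly_Mapping.keys v \<Longrightarrow>
      real N \<ge> Re (- n - 1 - form \<alpha> \<beta>) + real d + 1"
  proof -
    have "finite ((\<lambda>\<beta>. Re (- n - 1 - form \<alpha> \<beta>) + real d + 1) ` Poly_Mapping.keys v)" by simp
    then obtain M where "\<forall>x\<in>(\<lambda>\<beta>. Re (- n - 1 - form \<alpha> \<beta>) + real d + 1) ` Poly_Mapping.keys v. x \<le> M"
      by (meson finite_has_maximal bdd_above_finite bdd_above_def)
    moreover obtain N :: nat where "M \<le> real N" using real_arch_simple by blast
    ultimately have "Re (- n - 1 - form \<alpha> \<beta>) + real d + 1 \<le> real N"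
      if "\<beta> \<in> Poly_Mapping.keys v" for \<beta>
      using that by (meson imageI order_trans)
    thus thesis by (rule that)
  qed
  have 0: "vertex_summand \<alpha> (n + of_nat j) v (p, q) = 0" if "j \<ge> N" for j p q
  proof (rule ccontr)
    assume nz: "vertex_summand \<alpha> (n + of_nat j) v (p, q) \<noteq> 0"
    from vertex_summand_nonzero[OF nz d] obtain \<beta> where b: "q \<le> d" "\<beta> \<in> Poly_Mapping.keys v"
      "of_nat p = - (n + of_nat j) - 1 + of_nat q - form \<alpha> \<beta>" by blast
    have "real p = Re (- (n + of_nat j) - 1 + of_nat q - form \<alpha> \<beta>)"
      using arg_cong[OF b(3), of Re] by simp
    thus False using N[OF b(2)] b(1) that by simp
  qed
  hence "vertex_mode form \<alpha> (n + of_nat j) v = 0" if "j \<ge> N" for j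
  proof -
    have "vertex_summand \<alpha> (n + of_nat j) v = (\<lambda>_. 0)"
      using that 0
      by (auto simp: fun_eq_iff)
    thus ?thesis by (simp add: vertex_mode_alt)
  qed
  thus "\<exists>N. \<forall>j\<ge>N. vertex_mode form \<alpha> (n + of_nat j) v = 0" by blast
qed

lemma fields_subspace: "cvec.subspace fields"
  unfolding cvec.subspace_def
proof (intro conjI ballI allI)
  show "0 \<in> fields" by (auto simp: fields_def zero_fun_def clinear_iff)
next
  fix F G assume F: "F \<in> fields" and G: "G \<in> fields"
  show "F + G \<in> fields"
    unfolding fields_def
  proof (intro CollectI conjI allI)
    fix n show "clinear ((F + G) n)"
      using F G by (auto simp: fields_def clinear_iff plus_fun_def scaleC_add_right)
  next
    fix v n
    obtain M N where "\<forall>j\<ge>M. F (n + of_nat j) v = 0" "\<forall>j\<ge>N. G (n + of_nat j) v = 0"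
      using F G unfolding fields_def by blast
    thus "\<exists>N. \<forall>j\<ge>N. (F + G) (n + of_nat j) v = 0"
      by (intro exI[of _ "max M N"]) (auto simp: plus_fun_def)
  qed
next
  fix c F assume F: "F \<in> fields"
  thus "c *\<^sub>C F \<in> fields"
    unfolding fields_def
    by (fastforce simp: scaleC_fun_def clinear_iff scaleC_add_right scaleC_scaleC mult.commute)
qed

text \<open>The two parts of the normally ordered product.\<close>

definition nop where
  "nop h m F n v = Sum_any (\<lambda>j::nat. of_nat (m - 1 + j choose j) *\<^sub>C
     heis form h (- int (m + j)) (F (n + of_nat j) v))"

definition noq where
  "noq h m F n v = Sum_any (\<lambda>j::nat. (- ((- 1) ^ m) * of_nat (m - 1 + j choose j)) *\<^sub>C
     F (n - of_nat (m + j)) (heis form h (int j) v))"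

lemma fieldsD: "F \<in> fields \<Longrightarrow> clinear (F n)"
  "F \<in> fields \<Longrightarrow> \<exists>N::nat. \<forall>j\<ge>N. F (n + of_nat j) v = 0"
  by (auto simp: fields_def)

lemma finite_bounded: "(\<And>j::nat. j \<ge> N \<Longrightarrow> f j = 0) \<Longrightarrow> finite {j. f j \<noteq> 0}"
  by (rule finite_subset[of _ "{..<N}"]) (auto simp: not_less[symmetric])

lemma nop_support: "F \<in> fields \<Longrightarrow>
    finite {j. c j *\<^sub>C heis form h (k j) (F (n + of_nat j) v) \<noteq> 0}"
proof -
  assume "F \<in> fields"
  then obtain N where "\<forall>j\<ge>N. F (n + of_nat j) v = 0" using fieldsD(2) by blast
  thus ?thesis by (intro finite_bounded[of N]) (auto simp: clinear_zero[OF clinear_heis])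
qed

lemma noq_support: "F \<in> fields \<Longrightarrow> finite {j. c j *\<^sub>C F (k j) (heis form h (int j) v) \<noteq> 0}"
proof -
  assume F: "F \<in> fields"
  obtain d where "v \<in> Fil d" using Fil_exhaust by blast
  thus ?thesis
    by (intro finite_bounded[of "Suc d"]) (auto simp: heis_Fil clinear_zero[OF fieldsD(1)[OF F]])
qed

lemma normal_ordered_split: "F \<in> fields \<Longrightarrow> normal_ordered form h m F n v = nop h m F n v + noq h m F n v"
  unfolding normal_ordered_def nop_def noq_def
  by (subst Sum_any.distrib[symmetric])
    (erule nop_support | erule noq_support
      | simp add: cvec.scale_right_diff_distrib scaleC_scaleC mult.commute del: of_nat_add)+

lemma clinear_scaled: "clinear f \<Longrightarrow> clinear (\<lambda>v. c *\<^sub>C f v)"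
  by (auto simp: clinear_iff scaleC_add_right scaleC_scaleC mult.commute)

lemma clinear_compose: "clinear f \<Longrightarrow> clinear g \<Longrightarrow> clinear (\<lambda>v. f (g v))"
  by (auto simp: clinear_iff)

lemma nop_fields: "F \<in> fields \<Longrightarrow> nop h m F \<in> fields"
proof -
  assume F: "F \<in> fields"
  show ?thesis
    unfolding fields_def
  proof (intro CollectI conjI allI)
    fix n
    show "clinear (nop h m F n)"
      unfolding nop_def[abs_def]
      by (intro clinear_Sum_any nop_support F clinear_scaled clinear_compose[OF clinear_heis] fieldsD(1))
  next
    fix v n
    obtain N where N: "\<forall>j\<ge>N. F (n + of_nat j) v = 0" using fieldsD(2)[OF F] by blast
    have "F (n + of_nat i + of_nat j) v = 0" if "i \<ge> N" for i j
      using N[rule_format, of "i + j"] that by (simp add: add.assoc)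
    thus "\<exists>N. \<forall>j\<ge>N. nop h m F (n + of_nat j) v = 0"
      by (intro exI[of _ N]) (auto simp: nop_def clinear_zero[OF clinear_heis])
  qed
qed

lemma uniform_bound:
  assumes F: "F \<in> fields"
  shows "\<exists>N. \<forall>i<d::nat. \<forall>j\<ge>N. F (k i + of_nat j) (w i) = 0"
proof -
  have "\<forall>i. \<exists>N::nat. \<forall>j\<ge>N. F (k i + of_nat j) (w i) = 0" using fieldsD(2)[OF F] by blast
  then obtain f :: "nat \<Rightarrow> nat" where "\<forall>i. \<forall>j\<ge>f i. F (k i + of_nat j) (w i) = 0"
    by (rule choice[THEN exE])
  hence f: "F (k i + of_nat j) (w i) = 0" if "j \<ge> f i" for i j using that by blast
  show ?thesis
  proof (intro exI[of _ "\<Sum>i<d. f i"] allI impI)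
    fix i j assume "i < d" "(\<Sum>i<d. f i) \<le> j"
    moreover have "f i \<le> (\<Sum>i<d. f i)" using \<open>i < d\<close> by (intro member_le_sum) auto
    ultimately show "F (k i + of_nat j) (w i) = 0" by (intro f) auto
  qed
qed

lemma noq_fields: "F \<in> fields \<Longrightarrow> noq h m F \<in> fields"
proof -
  assume F: "F \<in> fields"
  show ?thesis
    unfolding fields_def
  proof (intro CollectI conjI allI)
    fix n
    show "clinear (noq h m F n)"
      unfolding noq_def[abs_def]
      by (intro clinear_Sum_any noq_support F clinear_scaled clinear_compose[OF _ clinear_heis] fieldsD(1))
  next
    fix v n
    obtain d where d: "v \<in> Fil d" using Fil_exhaust by blast
    obtain N where N: "\<forall>i<Suc d. \<forall>j\<ge>N. F (n - of_nat (m + i) + of_nat j) (heis form h (int i) v) = 0"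
      using uniform_bound[OF F, of "Suc d" "\<lambda>i. n - of_nat (m + i)" "\<lambda>i. heis form h (int i) v"]
      by blast
    have "F (n + of_nat j - of_nat (m + i)) (heis form h (int i) v) = 0" if "j \<ge> N" for i j
    proof (cases "i < Suc d")
      case True
      thus ?thesis using N that by (simp add: algebra_simps)
    next
      case False
      thus ?thesis using heis_Fil(2)[OF d] by (simp add: clinear_zero[OF fieldsD(1)[OF F]])
    qed
    thus "\<exists>N. \<forall>j\<ge>N. noq h m F (n + of_nat j) v = 0"
      by (intro exI[of _ N]) (auto simp: noq_def)
  qed
qed

lemma normal_ordered_eq: "F \<in> fields \<Longrightarrow> normal_ordered form h m F = nop h m F + noq h m F"
  by (auto simp: fun_eq_iff plus_fun_def normal_ordered_split)

lemma normal_ordered_fields: "F \<in> fields \<Longrightarrow> normal_ordered form h m F \<in> fields"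
  by (simp add: normal_ordered_eq cvec.subspace_add[OF fields_subspace] nop_fields noq_fields)

lemma nop_add: "F \<in> fields \<Longrightarrow> G \<in> fields \<Longrightarrow> nop h m (F + G) = nop h m F + nop h m G"
  unfolding fun_eq_iff nop_def plus_fun_def
  by (subst Sum_any.distrib[symmetric])
    (erule nop_support | simp add: clinear_add[OF clinear_heis] scaleC_add_right)+

lemma noq_add: "F \<in> fields \<Longrightarrow> G \<in> fields \<Longrightarrow> noq h m (F + G) = noq h m F + noq h m G"
  unfolding fun_eq_iff noq_def plus_fun_def
  by (subst Sum_any.distrib[symmetric]) (erule noq_support | simp add: scaleC_add_right)+

lemma Sum_any_scaleC: "finite {i. g i \<noteq> 0} \<Longrightarrow> Sum_any (\<lambda>i. c *\<^sub>C g i) = c *\<^sub>C Sum_any g"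
  for g :: "'i \<Rightarrow> 'w::complex_vec"
  by (rule Sum_any_linear[symmetric])
    (auto intro!: clinearI simp: scaleC_add_right scaleC_scaleC mult.commute)

lemma nop_scale: "F \<in> fields \<Longrightarrow> nop h m (c *\<^sub>C F) = c *\<^sub>C nop h m F"
  unfolding fun_eq_iff nop_def scaleC_fun_def
  by (subst Sum_any_scaleC[symmetric])
    (erule nop_support | simp add: clinear_scale[OF clinear_heis] scaleC_scaleC mult.commute)+

lemma noq_scale: "F \<in> fields \<Longrightarrow> noq h m (c *\<^sub>C F) = c *\<^sub>C noq h m F"
  unfolding fun_eq_iff noq_def scaleC_fun_def
  by (subst Sum_any_scaleC[symmetric])
    (erule noq_support | simp add: scaleC_scaleC mult.commute)+

lemma nop_left: "F \<in> fields \<Longrightarrow> nop (x + y) m F = nop x m F + nop y m F"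
  "F \<in> fields \<Longrightarrow> nop (c *\<^sub>C x) m F = c *\<^sub>C nop x m F"
  unfolding fun_eq_iff nop_def scaleC_fun_def plus_fun_def
  by (subst Sum_any_scaleC[symmetric] Sum_any.distrib[symmetric];
     (erule nop_support | simp add: heis_linear_left scaleC_scaleC scaleC_add_right mult.commute)+)+

lemma noq_left: "F \<in> fields \<Longrightarrow> noq (x + y) m F = noq x m F + noq y m F"
  "F \<in> fields \<Longrightarrow> noq (c *\<^sub>C x) m F = c *\<^sub>C noq x m F"
  unfolding fun_eq_iff noq_def scaleC_fun_def plus_fun_def
  by (subst Sum_any_scaleC[symmetric] Sum_any.distrib[symmetric];
     (erule noq_support | simp add: heis_linear_left clinear_add[OF fieldsD(1)]
       clinear_scale[OF fieldsD(1)] scaleC_scaleC scaleC_add_right mult.commute)+)+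

lemma Sum_any_swap_bounded:
  fixes g :: "nat \<Rightarrow> nat \<Rightarrow> 'w::comm_monoid_add"
  assumes "\<And>i j. g i j \<noteq> 0 \<Longrightarrow> i < M \<and> j < N"
  shows "Sum_any (\<lambda>i. Sum_any (g i)) = Sum_any (\<lambda>j. Sum_any (\<lambda>i. g i j))"
  by (rule Sum_any.swap[of "{..<M} \<times> {..<N}"]) (use assms in auto)

lemma clinear_scaleC: "clinear (\<lambda>w :: 'w::complex_vec. c *\<^sub>C w)"
  by (rule clinearI) (simp_all add: scaleC_add_right scaleC_scaleC mult.commute)

lemma nop_nop:
  assumes F: "F \<in> fields" and m: "m \<ge> 1" "m' \<ge> 1"
  shows "nop x m (nop y m' F) = nop y m' (nop x m F)"
proof (intro ext)
  fix n v
  obtain N where N: "\<And>j. j \<ge> N \<Longrightarrow> F (n + of_nat j) v = 0" using fieldsD(2)[OF F] by blast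
  define g where "g i j = (of_nat (m - 1 + i choose i) * of_nat (m' - 1 + j choose j)) *\<^sub>C
      heis form x (- int (m + i)) (heis form y (- int (m' + j)) (F (n + of_nat (i + j)) v))" for i j
  have exp: "nop a k (nop b l F) n v = Sum_any (\<lambda>i. Sum_any (\<lambda>j.
      (of_nat (k - 1 + i choose i) * of_nat (l - 1 + j choose j)) *\<^sub>C
      heis form a (- int (k + i)) (heis form b (- int (l + j)) (F (n + of_nat (i + j)) v))))"
    for a b k l
    unfolding nop_def
    by (subst Sum_any_linear[OF clinear_compose[OF clinear_scaleC clinear_heis] nop_support[OF F]])
      (simp add: clinear_scale[OF clinear_heis] scaleC_scaleC add.assoc)
  have "nop x m (nop y m' F) n v = Sum_any (\<lambda>i. Sum_any (g i))"
    by (simp add: exp g_def)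
  also have "\<dots> = Sum_any (\<lambda>j. Sum_any (\<lambda>i. g i j))"
  proof (rule Sum_any_swap_bounded[of _ N N])
    fix i j assume "g i j \<noteq> 0"
    hence "F (n + of_nat (i + j)) v \<noteq> 0"
      by (auto simp: g_def clinear_zero[OF clinear_heis])
    hence "\<not> i + j \<ge> N" using N by blast
    thus "i < N \<and> j < N" by auto
  qed
  also have "\<dots> = nop y m' (nop x m F) n v"
    unfolding exp g_def using m
    by (subst heis_commute_neg) (simp_all add: mult.commute add.commute)
  finally show "nop x m (nop y m' F) n v = nop y m' (nop x m F) n v" .
qed

lemma noq_noq:
  assumes F: "F \<in> fields"
  shows "noq x m (noq y m' F) = noq y m' (noq x m F)"
proof (intro ext)
  fix n v
  obtain d where d: "v \<in> Fil d" using Fil_exhaust by blast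
  define c where "c m j = - ((- 1) ^ m) * (of_nat (m - 1 + j choose j) :: complex)" for m j :: nat
  define g where "g i j = (c m i * c m' j) *\<^sub>C
      F (n - of_nat (m + i) - of_nat (m' + j)) (heis form y (int j) (heis form x (int i) v))" for i j
  have exp: "noq a k (noq b l F) n v = Sum_any (\<lambda>i. Sum_any (\<lambda>j. (c k i * c l j) *\<^sub>C
      F (n - of_nat (k + i) - of_nat (l + j)) (heis form b (int j) (heis form a (int i) v))))"
    for a b k l
    unfolding noq_def c_def[symmetric]
    by (subst Sum_any_linear[OF clinear_scaleC noq_support[OF F]]) (simp add: scaleC_scaleC)
  have "noq x m (noq y m' F) n v = Sum_any (\<lambda>i. Sum_any (g i))"
    by (simp add: exp g_def)
  also have "\<dots> = Sum_any (\<lambda>j. Sum_any (\<lambda>i. g i j))"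
  proof (rule Sum_any_swap_bounded[of _ "Suc d" "Suc d"])
    fix i j assume "g i j \<noteq> 0"
    hence "heis form y (int j) (heis form x (int i) v) \<noteq> 0"
      by (auto simp: g_def clinear_zero[OF fieldsD(1)[OF F]])
    thus "i < Suc d \<and> j < Suc d"
      using heis_Fil(2)[OF d] heis_Fil(2)[OF heis_Fil_le[OF d]] clinear_zero[OF clinear_heis]
      by (metis not_less_eq)
  qed
  also have "\<dots> = noq y m' (noq x m F) n v"
    unfolding exp g_def
    by (subst heis_commute_nonneg) (simp_all add: mult.commute algebra_simps)
  finally show "noq x m (noq y m' F) n v = noq y m' (noq x m F) n v" .
qed

lemma nop_noq:
  assumes F: "F \<in> fields"
  shows "nop x m (noq y m' F) = noq y m' (nop x m F)"
proof (intro ext)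
  fix n v
  obtain d where d: "v \<in> Fil d" using Fil_exhaust by blast
  define c where "c m j = - ((- 1) ^ m) * (of_nat (m - 1 + j choose j) :: complex)" for m j :: nat
  define b where "b j = (of_nat (m - 1 + j choose j) :: complex)" for j :: nat
  define g where "g i j = (b i * c m' j) *\<^sub>C
      heis form x (- int (m + i)) (F (n + of_nat i - of_nat (m' + j)) (heis form y (int j) v))" for i j
  obtain N where N: "\<forall>j<Suc d. \<forall>i\<ge>N. F (n - of_nat (m' + j) + of_nat i) (heis form y (int j) v) = 0"
    using uniform_bound[OF F, of "Suc d" "\<lambda>j. n - of_nat (m' + j)" "\<lambda>j. heis form y (int j) v"]
    by blast
  have "nop x m (noq y m' F) n v = Sum_any (\<lambda>i. Sum_any (g i))"
    unfolding nop_def noq_def c_def[symmetric] b_def[symmetric]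
    by (subst Sum_any_linear[OF clinear_compose[OF clinear_scaleC clinear_heis] noq_support[OF F]])
      (simp add: clinear_scale[OF clinear_heis] scaleC_scaleC g_def)
  also have "\<dots> = Sum_any (\<lambda>j. Sum_any (\<lambda>i. g i j))"
  proof (rule Sum_any_swap_bounded[of _ N "Suc d"])
    fix i j assume "g i j \<noteq> 0"
    hence nz: "F (n + of_nat i - of_nat (m' + j)) (heis form y (int j) v) \<noteq> 0"
      by (auto simp: g_def clinear_zero[OF clinear_heis])
    hence "heis form y (int j) v \<noteq> 0"
      by (auto simp: clinear_zero[OF fieldsD(1)[OF F]])
    hence j: "j < Suc d" using heis_Fil(2)[OF d] by (metis not_less_eq)
    moreover have "i < N"
      using N j nz by (metis add_diff_eq add.commute not_le diff_add_eq)
    ultimately show "i < N \<and> j < Suc d" by blast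
  qed
  also have "\<dots> = noq y m' (nop x m F) n v"
    unfolding nop_def noq_def c_def[symmetric] b_def[symmetric]
    by (subst Sum_any_linear[OF clinear_scaleC nop_support[OF F]])
      (simp add: scaleC_scaleC g_def mult.commute diff_add_eq)
  finally show "nop x m (noq y m' F) n v = noq y m' (nop x m F) n v" .
qed

lemma normal_ordered_add: "F \<in> fields \<Longrightarrow> G \<in> fields \<Longrightarrow>
    normal_ordered form h m (F + G) = normal_ordered form h m F + normal_ordered form h m G"
  by (simp only: normal_ordered_eq nop_add noq_add cvec.subspace_add[OF fields_subspace]
      add.assoc add.left_commute)

lemma normal_ordered_scale: "F \<in> fields \<Longrightarrow>
    normal_ordered form h m (c *\<^sub>C F) = c *\<^sub>C normal_ordered form h m F"
  by (simp only: normal_ordered_eq nop_scale noq_scale cvec.subspace_scale[OF fields_subspace]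
      scaleC_add_right)

lemma normal_ordered_left: "F \<in> fields \<Longrightarrow>
    normal_ordered form (x + y) m F = normal_ordered form x m F + normal_ordered form y m F"
  "F \<in> fields \<Longrightarrow> normal_ordered form (c *\<^sub>C x) m F = c *\<^sub>C normal_ordered form x m F"
  by (simp_all only: normal_ordered_eq nop_left noq_left scaleC_add_right add.assoc add.left_commute)

lemma normal_ordered_commute:
  assumes F: "F \<in> fields" and m: "m \<ge> 1" "m' \<ge> 1"
  shows "normal_ordered form x m (normal_ordered form y m' F) =
    normal_ordered form y m' (normal_ordered form x m F)"
proof -
  have *: "normal_ordered form a k (normal_ordered form b l F) =
      (nop a k (nop b l F) + nop a k (noq b l F)) + (noq a k (nop b l F) + noq a k (noq b l F))"
    for a b k l
    by (simp only: normal_ordered_eq F normal_ordered_fields nop_fields noq_fields nop_add noq_add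
        cvec.subspace_add[OF fields_subspace])
  show ?thesis
    unfolding * nop_nop[OF F m, of x y] noq_noq[OF F, of x m y m'] nop_noq[OF F, of x m y m']
      nop_noq[OF F, of y m' x m]
    by (simp only: add.assoc add.commute add.left_commute)
qed

lemma is_state_field_exists: "\<exists>Y. is_state_field form Y"
proof -
  have "\<forall>\<alpha>. \<exists>A :: 'h fock \<Rightarrow> complex \<Rightarrow> 'h gva \<Rightarrow> 'h gva. clinear A \<and> A 1 = vertex_mode form \<alpha> \<and>
      range A \<subseteq> fields \<and> (\<forall>x k u. A (fgen x k * u) = normal_ordered form x (k + 1) (A u))"
    by (intro allI fock_act_exists fields_subspace vertex_mode_fields normal_ordered_fields
        normal_ordered_add normal_ordered_scale normal_ordered_left normal_ordered_commute) auto
  then obtain A :: "'h \<Rightarrow> 'h fock \<Rightarrow> complex \<Rightarrow> 'h gva \<Rightarrow> 'h gva" where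
    A: "\<And>\<alpha>. clinear (A \<alpha>)" "\<And>\<alpha>. A \<alpha> 1 = vertex_mode form \<alpha>" "\<And>\<alpha> u. A \<alpha> u \<in> fields"
      "\<And>\<alpha> x k u. A \<alpha> (fgen x k * u) = normal_ordered form x (k + 1) (A \<alpha> u)"
    by (metis range_subsetD)
  define Y where "Y a = (\<Sum>\<alpha>\<in>Poly_Mapping.keys a. A \<alpha> (Poly_Mapping.lookup a \<alpha>))" for a
  have Y_eq: "Y a = (\<Sum>\<alpha>\<in>K. A \<alpha> (Poly_Mapping.lookup a \<alpha>))"
    if "finite K" "Poly_Mapping.keys a \<subseteq> K" for a K
    unfolding Y_def by (rule sum.mono_neutral_left)
      (use that in \<open>auto simp: in_keys_iff clinear_zero[OF A(1)]\<close>)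
  have "clinear Y"
  proof (rule clinearI)
    fix a b :: "'h gva" and c
    let ?K = "Poly_Mapping.keys a \<union> Poly_Mapping.keys b"
    show "Y (a + b) = Y a + Y b"
      using Poly_Mapping.keys_add[of a b]
      by (simp add: Y_eq[of ?K] lookup_add clinear_add[OF A(1)] sum.distrib)
    have "Poly_Mapping.keys (c *\<^sub>C a) \<subseteq> Poly_Mapping.keys a"
      by (auto simp: in_keys_iff lookup_scaleC)
    thus "Y (c *\<^sub>C a) = c *\<^sub>C Y a"
      by (simp add: Y_eq[of "Poly_Mapping.keys a"] lookup_scaleC clinear_scale[OF A(1)]
          cvec.scale_sum_right)
  qed
  moreover have "Y (vexp \<alpha>) = vertex_mode form \<alpha>" for \<alpha>
    by (simp add: Y_def vexp_def A(2))
  moreover have "Y (heis form h (- int m) a) = normal_ordered form h m (Y a)" if "m \<ge> 1" for h m a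
  proof -
    have clin: "normal_ordered form h m (sum g K) = (\<Sum>\<alpha>\<in>K. normal_ordered form h m (g \<alpha>))"
      if "\<And>\<alpha>. g \<alpha> \<in> fields" for g and K :: "'h set"
    proof -
      have 0: "normal_ordered form h m 0 = 0"
        using normal_ordered_scale[OF that, of h m 0] by simp
      have "sum g K \<in> fields \<and> normal_ordered form h m (sum g K) = (\<Sum>\<alpha>\<in>K. normal_ordered form h m (g \<alpha>))"
      proof (induction K rule: infinite_finite_induct)
        case (insert x K)
        thus ?case using that[of x]
          by (simp only: sum.insert normal_ordered_add cvec.subspace_add[OF fields_subspace] simp_thms)
      qed (simp_all only: sum.infinite sum.empty 0 cvec.subspace_0[OF fields_subspace] simp_thms not_False_eq_True)
      thus ?thesis ..
    qed
    have l: "Poly_Mapping.lookup (heis form h (- int m) a) \<alpha> = fgen h (m - 1) * Poly_Mapping.lookup a \<alpha>" for \<alpha>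
    proof -
      have "nat (int m - 1) = m - 1" by simp
      thus ?thesis using \<open>m \<ge> 1\<close> by (simp add: lookup_heis)
    qed
    have "Y (heis form h (- int m) a) =
        (\<Sum>\<alpha>\<in>Poly_Mapping.keys a. A \<alpha> (Poly_Mapping.lookup (heis form h (- int m) a) \<alpha>))"
      by (rule Y_eq) (use heis_keys in auto)
    also have "\<dots> = (\<Sum>\<alpha>\<in>Poly_Mapping.keys a. normal_ordered form h m (A \<alpha> (Poly_Mapping.lookup a \<alpha>)))"
      using \<open>m \<ge> 1\<close> by (intro sum.cong refl) (simp only: l A(4) le_add_diff_inverse2)
    also have "\<dots> = normal_ordered form h m (Y a)"
      unfolding Y_def by (rule clin[symmetric]) (rule A(3))
    finally show ?thesis .
  qed
  ultimately show ?thesis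
    unfolding is_state_field_def by blast
qed

lemma is_state_field_unique:
  assumes "is_state_field form Y" "is_state_field form Y'"
  shows "Y = Y'"
proof
  fix a
  show "Y a = Y' a"
  proof (induction a rule: poly_mapping_induct)
    case (single \<alpha> u)
    show ?case
    proof (induction u rule: fock_induct)
      case one
      show ?case using assms by (metis is_state_field_def vexp_def)
    next
      case (fgen x k u)
      have "Poly_Mapping.single \<alpha> (fgen x k * u) = heis form x (- int (k + 1)) (Poly_Mapping.single \<alpha> u)"
        by (simp add: heis_def mult_single)
      thus ?case using assms fgen by (metis is_state_field_def le_add2)
    next
      case (add u v)
      thus ?case using assms by (simp add: is_state_field_def clinear_iff single_add)
    next
      case (scale c u)
      have "Poly_Mapping.single \<alpha> (c *\<^sub>C u) = c *\<^sub>C Poly_Mapping.single \<alpha> u"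
        by (rule poly_mapping_eqI) (auto simp: lookup_scaleC lookup_single when_def)
      thus ?case using assms scale by (simp add: is_state_field_def clinear_iff)
    qed
  next
    case (add a b)
    thus ?case using assms by (simp add: is_state_field_def clinear_iff)
  qed
qed

lemma is_state_field: "is_state_field form (state_field form)"
  unfolding state_field_def
  by (rule theI'[of "is_state_field form"]) (use is_state_field_exists is_state_field_unique in blast)

text \<open>The two prescribed generating fields: \<open>Y(h(-1)|0\<rangle>, z) = \<Sum>n. h(n) z\<^sup>-\<^sup>n\<^sup>-\<^sup>1\<close> and \<open>Y(e\<^sup>\<alpha>, z)\<close>.\<close>

lemma heis_zero_left: "heis form 0 n v = 0"
  using heis_linear_left(2)[of 0 0 n v] by simp

lemma series_exp_zero: "(\<And>j v. A j v = 0) \<Longrightarrow> series_exp A n v = (if n = 0 then v else 0)"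
proof -
  assume A: "\<And>j v. A j v = 0"
  have pow: "series_pow A k n v = (if k = 0 \<and> n = 0 then v else 0)" for k n
    by (cases k) (auto simp: A)
  show ?thesis
    unfolding series_exp_def pow by (cases "n = 0") auto
qed

lemma vertex_mode_vac: "vertex_mode form 0 n v = (if n = - 1 then v else 0)"
proof -
  have f0: "form 0 \<beta> = 0" for \<beta>
    using form_simps(3)[of 0 0 \<beta>] by simp
  have z: "zpow form 0 s w = (if s = 0 then w else 0)" for s w
    by (rule poly_mapping_eqI) (auto simp: lookup_zpow f0)
  have o: "raise_op 0 j w = 0" "lower_op 0 j w = 0" for j w
    by (simp_all add: raise_op_def lower_op_def scaleC_fun_def heis_zero_left)
  have e: "series_exp (raise_op 0) p w = (if p = 0 then w else 0)"
    "series_exp (lower_op 0) p w = (if p = 0 then w else 0)" for p w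
    by (rule series_exp_zero, rule o)+
  have "vertex_summand 0 n v = (\<lambda>pq. (if n = - 1 then v else 0) when pq = (0, 0))"
  proof
    fix pq :: "nat \<times> nat"
    have n: "- n = 1 \<longleftrightarrow> n = - 1"
      by (metis minus_minus)
    obtain p q where pq: "pq = (p, q)" by (cases pq)
    show "vertex_summand 0 n v pq = ((if n = - 1 then v else 0) when pq = (0, 0))"
      by (cases "p = 0"; cases "q = 0") (simp_all add: pq vertex_summand_def e z n)
  qed
  thus ?thesis by (simp add: vertex_mode_alt)
qed

lemma state_field_heis: "state_field form (heis form h (- 1) vac) (of_int n) v = heis form h n v"
proof -
  have "state_field form (heis form h (- int 1) vac) = normal_ordered form h 1 (vertex_mode form 0)"
    using is_state_field unfolding is_state_field_def by (metis order_refl)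
  moreover have "normal_ordered form h 1 (vertex_mode form 0) (of_int n) v = heis form h n v"
  proof -
    have "(of_int n + of_nat j = (- 1 :: complex)) = (int j = - 1 - n)" for j
    proof -
      have "(of_int n + of_nat j = (- 1 :: complex)) = (of_int (n + int j) = (of_int (- 1) :: complex))"
        by simp
      thus ?thesis unfolding of_int_eq_iff by linarith
    qed
    moreover have "(of_int n - of_nat (1 + j) = (- 1 :: complex)) = (int j = n)" for j
    proof -
      have "(of_int n - of_nat (1 + j) = (- 1 :: complex)) = (of_int (n - int (1 + j)) = (of_int (- 1) :: complex))"
        by simp
      thus ?thesis unfolding of_int_eq_iff by linarith
    qed
    ultimately have *: "normal_ordered form h 1 (vertex_mode form 0) (of_int n) v =
        Sum_any (\<lambda>j. heis form h n v when (int j = n \<or> int j = - 1 - n))"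
      unfolding normal_ordered_def vertex_mode_vac
      by (intro arg_cong[where f = Sum_any] ext)
        (auto simp: when_def clinear_zero[OF clinear_heis])
    have "(\<lambda>j. heis form h n v when (int j = n \<or> int j = - 1 - n)) =
        (\<lambda>j. heis form h n v when j = (if n \<ge> 0 then nat n else nat (- 1 - n)))"
      by (rule ext, rule when_cong) auto
    thus ?thesis unfolding * by (simp only: Sum_any_when_equal)
  qed
  ultimately show ?thesis by simp
qed

lemma state_field_vexp: "state_field form (vexp \<alpha>) = vertex_mode form \<alpha>"
  using is_state_field by (simp add: is_state_field_def)

end

end

theory Submission
  imports Defs "HOL-Computational_Algebra.Formal_Laurent_Series"
begin

text \<open>
  Let \<open>s\<^sub>p(\<beta>)\<close> be the coefficients of \<open>exp (\<Sum>n>0. \<beta>(-n) z\<^sup>n / n)\<close>.  The span \<open>U\<close> of the products of the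
  vectors \<open>s\<^sub>p(\<beta>) e\<^sup>\<beta>\<close>, \<open>\<beta> \<in> B\<close>, is closed under the annihilation operators, because these map
  \<open>s\<^sub>p(\<beta>)\<close> to multiples of \<open>s\<^sub>p\<^sub>-\<^sub>j(\<beta>)\<close>.  It is a generalized vertex subalgebra: a factor \<open>s\<^sub>p(\<beta>)\<close> of
  the state contributes to its field the creation part \<open>exp (\<Sum>n>0. \<beta>(-n) (z + w)\<^sup>n / n)\<close>, divided by its
  value at \<open>w = 0\<close>, and the missing denominators are the creation part of the field of \<open>e\<^sup>\<alpha>\<close>; hence
  the coefficients are again combinations of the \<open>s\<^sub>q(\<beta>)\<close>.

  The vector \<open>\<Psi>\<close> with exponents \<open>m\<^sub>i = - 1 - p\<^sub>i\<close> is a nonzero multiple of \<open>\<Prod>i. s\<^sub>p\<^sub>i(\<beta>\<^sub>i) e\<^sup>\<beta>\<^sup>i\<close> plus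
  products whose exponents, read from the outermost operator, are lexicographically larger.  Since the
  \<open>s\<^sub>p(\<beta>)\<close> with \<open>p > 0\<close> are algebraically independent and a weakly decreasing list is the largest
  among its rearrangements, the vectors \<open>\<Psi>\<close> form a basis of \<open>U\<close>.  Being generated by the \<open>e\<^sup>\<beta>\<close>, they
  lie in the principal subspace, which is therefore \<open>U\<close>.
\<close>

section \<open>Schur polynomials\<close>

lemma of_nat_times_fock: "of_nat n * (u :: 'h::complex_vec fock) = of_nat n *\<^sub>C u"
  by (induction n) (simp_all add: distrib_right scaleC_add_left scaleC_one)

lemma single_zero_of_nat: "(of_nat n :: 'h::complex_vec gva) = Poly_Mapping.single 0 (of_nat n)"
  by (induction n) (simp_all add: single_add)

lemma of_nat_times_gva: "of_nat n * (v :: 'h::complex_vec gva) = of_nat n *\<^sub>C v"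
  by (induction n) (simp_all add: distrib_right scaleC_add_left scaleC_one)

lemma scaleC_single: "c *\<^sub>C Poly_Mapping.single \<alpha> u = Poly_Mapping.single \<alpha> (c *\<^sub>C u)"
  by (rule poly_mapping_eqI) (simp add: lookup_scaleC lookup_single when_def)

lemma scaleC_mult_gva: "(c *\<^sub>C v) * w = c *\<^sub>C (v * w)"
  and mult_scaleC_gva: "v * (c *\<^sub>C w) = c *\<^sub>C (v * w)" for v w :: "'h::complex_vec gva"
proof -
  have *: "c *\<^sub>C v = Poly_Mapping.single 0 (c *\<^sub>C 1) * v" for v :: "'h gva"
    by (induction v rule: poly_mapping_induct)
      (simp_all add: scaleC_single mult_single scaleC_mult_fock scaleC_add_right distrib_left)
  show "(c *\<^sub>C v) * w = c *\<^sub>C (v * w)"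
    by (simp add: *[of v] *[of "v * w"] mult.assoc)
  show "v * (c *\<^sub>C w) = c *\<^sub>C (v * w)"
    by (simp add: *[of w] *[of "v * w"] mult.left_commute)
qed

text \<open>Integer factors cancel through the complex scalar action, so the recursions below can
  stay in the form n X_n = ... without denominators.\<close>

lemma of_nat_Suc_cancel_gva:
  "of_nat (Suc n) * (u :: 'h::complex_vec gva) = of_nat (Suc n) * v \<Longrightarrow> u = v"
  unfolding of_nat_times_gva by (metis cvec.scale_cancel_left of_nat_neq_0)

text \<open>\<open>schur \<alpha> p\<close> is the coefficient of \<open>z\<^sup>p\<close> in \<open>exp (\<Sum>n>0. \<alpha>(-n) z\<^sup>n / n)\<close>.\<close>

fun schur :: "'h::complex_vec \<Rightarrow> nat \<Rightarrow> 'h fock" where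
  "schur \<alpha> 0 = 1"
| "schur \<alpha> (Suc n) = (1 / of_nat (Suc n)) *\<^sub>C (\<Sum>l=0..n. fgen \<alpha> l * schur \<alpha> (n - l))"

text \<open>This is F' = f' F for F = exp f, by coefficients: differentiating the exponent cancels
  its denominators and leaves the coefficients \<open>fgen \<alpha> l\<close>.\<close>

lemma of_nat_schur: "of_nat (Suc n) * schur \<alpha> (Suc n) = (\<Sum>l=0..n. fgen \<alpha> l * schur \<alpha> (n - l))"
  unfolding schur.simps of_nat_times_fock scaleC_scaleC
  by (simp add: scaleC_one del: of_nat_Suc)

abbreviation vgen :: "'h::complex_vec \<Rightarrow> nat \<Rightarrow> 'h gva" where
  "vgen x k \<equiv> Poly_Mapping.single 0 (fgen x k)"

definition vschur :: "'h::complex_vec \<Rightarrow> nat \<Rightarrow> 'h gva" where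
  "vschur \<alpha> p = Poly_Mapping.single \<alpha> (schur \<alpha> p)"

lemma vschur_0: "vschur \<alpha> 0 = vexp \<alpha>"
  by (simp add: vschur_def vexp_def)

lemma single_sum: "Poly_Mapping.single \<alpha> (sum f A) = (\<Sum>x\<in>A. Poly_Mapping.single \<alpha> (f x))"
  by (induction A rule: infinite_finite_induct) (simp_all add: single_add)

lemma of_nat_single_schur: "of_nat (Suc n) * Poly_Mapping.single \<gamma> (schur \<alpha> (Suc n)) =
    (\<Sum>l=0..n. vgen \<alpha> l * Poly_Mapping.single \<gamma> (schur \<alpha> (n - l)))"
  by (simp only: single_zero_of_nat mult_single of_nat_schur single_sum add_0)

lemmas of_nat_vschur = of_nat_single_schur[where \<alpha> = \<alpha> and \<gamma> = \<alpha> for \<alpha>, folded vschur_def]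

text \<open>The creation part of the field x(z), which is also the derivative of the exponent in
  \<open>schur\<close>.\<close>

definition bser :: "'h::complex_vec \<Rightarrow> 'h gva fps" where
  "bser x = Abs_fps (vgen x)"

text \<open>The creation part of the vertex operator of e^\<alpha>, including the shift of the
  charge by \<alpha>.\<close>

definition eser :: "'h::complex_vec \<Rightarrow> 'h gva fps" where
  "eser \<alpha> = Abs_fps (vschur \<alpha>)"

lemma eser_nth [simp]: "fps_nth (eser \<alpha>) n = vschur \<alpha> n"
  by (simp add: eser_def)

lemma bser_add: "bser (x + y) = bser x + bser y"
  by (rule fps_ext) (simp add: bser_def fgen_add single_add)

lemma bser_zero: "bser 0 = 0"
  using bser_add[of 0 0] by simp

lemma fps_deriv_eser: "fps_deriv (eser \<alpha>) = bser \<alpha> * eser \<alpha>"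
  by (rule fps_ext) (simp add: fps_mult_nth bser_def of_nat_vschur[simplified])

text \<open>The equation expresses (m + 1) F_(m+1) through lower coefficients, so the constant term
  determines F. Identities between exponentials are proved in this way.\<close>

lemma fps_linear_ode_unique:
  fixes F G :: "'h::complex_vec gva fps"
  assumes "fps_deriv F = b * F" "fps_deriv G = b * G" "fps_nth F 0 = fps_nth G 0"
  shows "F = G"
proof (rule fps_ext)
  fix n
  show "fps_nth F n = fps_nth G n"
  proof (induction n rule: less_induct)
    case (less n)
    show ?case
    proof (cases n)
      case (Suc m)
      have "of_nat (Suc m) * fps_nth F (Suc m) = of_nat (Suc m) * fps_nth G (Suc m)"
      proof -
        have "of_nat (Suc m) * fps_nth F (Suc m) = fps_nth (b * F) m"
          by (simp only: assms(1)[symmetric] fps_deriv_nth Suc_eq_plus1)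
        also have "\<dots> = fps_nth (b * G) m"
          unfolding fps_mult_nth by (intro sum.cong refl) (simp add: less Suc)
        also have "\<dots> = of_nat (Suc m) * fps_nth G (Suc m)"
          by (simp only: assms(2)[symmetric] fps_deriv_nth Suc_eq_plus1)
        finally show ?thesis .
      qed
      thus ?thesis using Suc of_nat_Suc_cancel_gva by blast
    qed (simp add: assms)
  qed
qed

text \<open>Both sides solve F' = \<open>bser (\<alpha> + \<beta>)\<close> F with constant term
  e^(\<alpha>+\<beta>).\<close>

lemma eser_add: "eser (\<alpha> + \<beta>) = eser \<alpha> * eser \<beta>"
proof (rule fps_linear_ode_unique[of _ "bser (\<alpha> + \<beta>)"])
  show "fps_deriv (eser \<alpha> * eser \<beta>) = bser (\<alpha> + \<beta>) * (eser \<alpha> * eser \<beta>)"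
    by (simp add: fps_deriv_eser bser_add algebra_simps)
qed (simp_all add: fps_deriv_eser vschur_0 vexp_def mult_single)

lemma eser_zero: "eser 0 = (1 :: 'h::complex_vec gva fps)"
  by (rule fps_linear_ode_unique[of _ 0]) (simp_all add: fps_deriv_eser bser_zero vschur_0 vexp_def)

section \<open>Creation operators\<close>

lemma series_pow_mult:
  fixes a :: "nat \<Rightarrow> 'h::complex_vec gva"
  assumes "\<And>j v. j \<ge> 1 \<Longrightarrow> A j v = a j * v"
  shows "series_pow A k n v = fps_nth (Abs_fps (\<lambda>j. if j = 0 then 0 else a j) ^ k) n * v"
proof (induction k arbitrary: n)
  case (Suc k)
  have "series_pow A (Suc k) n v = (\<Sum>j=1..n. a j * fps_nth (Abs_fps (\<lambda>j. if j = 0 then 0 else a j) ^ k) (n - j) * v)"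
    by (simp add: Suc assms mult.assoc)
  also have "\<dots> = (\<Sum>j=0..n. (if j = 0 then 0 else a j) * fps_nth (Abs_fps (\<lambda>j. if j = 0 then 0 else a j) ^ k) (n - j) * v)"
    by (rule sum.mono_neutral_cong_left) auto
  finally show ?case by (simp add: fps_mult_nth sum_distrib_right)
qed simp

text \<open>For multiplication operators \<open>series_exp\<close> multiplies by the coefficients of
  exp f, and exp f is the solution of F' = f' F with constant term 1. A closed form only has to
  satisfy this equation.\<close>

lemma series_exp_mult_unique:
  fixes a :: "nat \<Rightarrow> 'h::complex_vec gva"
  assumes A: "\<And>j v. j \<ge> 1 \<Longrightarrow> A j v = a j * v"
    and F: "fps_deriv F = Abs_fps (\<lambda>j. of_nat (Suc j) * a (Suc j)) * F" "fps_nth F 0 = 1"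
  shows "series_exp A n v = fps_nth F n * v"
proof -
  define f where "f = Abs_fps (\<lambda>j. if j = 0 then 0 else a j)"
  define X where "X n = (\<Sum>k\<le>n. (1 / fact k) *\<^sub>C fps_nth (f ^ k) n)" for n
  have f0: "fps_nth (f ^ k) n = 0" if "n < k" for k n
    using that by (intro startsby_zero_power_prefix[rule_format, of f]) (auto simp: f_def)
  have "fps_deriv f = Abs_fps (\<lambda>j. of_nat (Suc j) * a (Suc j))" (is "_ = ?b")
    by (rule fps_ext) (simp add: f_def)
  hence df: "fps_deriv (f ^ Suc k) = of_nat (Suc k) * (?b * f ^ k)" for k
    by (simp add: fps_deriv_power mult.assoc fps_of_nat del: of_nat_Suc power_Suc)
  \<comment> \<open>f^k starts in degree k, so the upper limit of the exponential sum may be raised;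
    one limit n then serves all coefficients up to n.\<close>
  have X_big: "X m = (\<Sum>k\<le>n. (1 / fact k) *\<^sub>C fps_nth (f ^ k) m)" if "m \<le> n" for m n
    unfolding X_def by (rule sum.mono_neutral_left) (use that f0 in auto)
  have "fps_deriv (Abs_fps X) = ?b * Abs_fps X"
  proof (rule fps_ext)
    fix n
    have "fps_nth (fps_deriv (Abs_fps X)) n = of_nat (Suc n) * X (Suc n)"
      by simp
    also have "\<dots> = (\<Sum>k\<le>Suc n. (1 / fact k) *\<^sub>C (of_nat (Suc n) * fps_nth (f ^ k) (Suc n)))"
      by (simp only: X_def sum_distrib_left mult_scaleC_gva)
    also have "\<dots> = (\<Sum>k\<le>n. (1 / fact (Suc k)) *\<^sub>C fps_nth (fps_deriv (f ^ Suc k)) n)"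
      by (subst sum.atMost_Suc_shift) (simp add: del: power_Suc fact_Suc of_nat_Suc)
    also have "\<dots> = (\<Sum>k\<le>n. (1 / fact k) *\<^sub>C fps_nth (?b * f ^ k) n)"
    proof (intro sum.cong refl)
      fix k
      have *: "fps_nth (fps_deriv (f ^ Suc k)) n = of_nat (Suc k) *\<^sub>C fps_nth (?b * f ^ k) n"
        unfolding df by (simp add: fps_of_nat[symmetric] of_nat_times_gva del: of_nat_Suc)
      have "(1 / fact (Suc k)) * of_nat (Suc k) = (1 / fact k :: complex)"
        by (simp add: fact_Suc del: of_nat_Suc)
      thus "(1 / fact (Suc k)) *\<^sub>C fps_nth (fps_deriv (f ^ Suc k)) n = (1 / fact k) *\<^sub>C fps_nth (?b * f ^ k) n"
        unfolding * scaleC_scaleC by (simp only:)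
    qed
    also have "\<dots> = (\<Sum>l=0..n. fps_nth ?b l * (\<Sum>k\<le>n. (1 / fact k) *\<^sub>C fps_nth (f ^ k) (n - l)))"
      unfolding fps_mult_nth cvec.scale_sum_right sum_distrib_left mult_scaleC_gva
      by (rule sum.swap)
    also have "\<dots> = fps_nth (?b * Abs_fps X) n"
      by (simp add: fps_mult_nth X_big[of "n - _" n])
    finally show "fps_nth (fps_deriv (Abs_fps X)) n = fps_nth (?b * Abs_fps X) n" .
  qed
  moreover have "fps_nth (Abs_fps X) 0 = 1"
    by (simp add: X_def scaleC_one)
  ultimately have "F = Abs_fps X"
    by (intro fps_linear_ode_unique[OF F(1)]) (simp_all only: F(2))
  moreover have "series_pow A k n v = fps_nth (f ^ k) n * v" for k
    unfolding f_def by (rule series_pow_mult) (rule A)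
  ultimately show ?thesis
    by (simp add: series_exp_def X_def sum_distrib_right scaleC_mult_gva)
qed

section \<open>Monomials in the Schur polynomials\<close>

lemma clinear_span_into:
  assumes "clinear f" "cvec.subspace T" "\<And>x. x \<in> S \<Longrightarrow> f x \<in> T" "v \<in> cvec.span S"
  shows "f v \<in> T"
  using assms(4)
  by (induction rule: cvec.span_induct_alt)
    (simp_all add: clinear_zero[OF assms(1)] clinear_add[OF assms(1)] clinear_scale[OF assms(1)]
      cvec.subspace_0 cvec.subspace_add cvec.subspace_scale assms)

lemma clinear_mult_left: "clinear (\<lambda>v. w * v)" for w :: "'h::complex_vec gva"
  by (rule clinearI) (simp_all add: distrib_left mult_scaleC_gva)

definition vmon :: "('h::complex_vec \<times> nat) list \<Rightarrow> 'h gva" where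
  "vmon xs = (\<Prod>x\<leftarrow>xs. vschur (fst x) (snd x))"

lemma vmon_simps [simp]: "vmon [] = vac" "vmon (x # xs) = vschur (fst x) (snd x) * vmon xs"
  by (simp_all add: vmon_def vexp_def)

lemma vmon_eq_single:
  "vmon xs = Poly_Mapping.single (\<Sum>x\<leftarrow>xs. fst x) (\<Prod>x\<leftarrow>xs. schur (fst x) (snd x))"
  by (induction xs) (simp_all add: vexp_def vschur_def mult_single)

text \<open>The charges are kept as a list because annihilation operators change only the indices of
  the factors. The degree is an integer so that lowering it past 0 gives the zero space.\<close>

definition vmon_deg :: "'h::complex_vec list \<Rightarrow> int \<Rightarrow> 'h gva set" where
  "vmon_deg bs d = cvec.span {vmon xs | xs. map fst xs = bs \<and> int (\<Sum>x\<leftarrow>xs. snd x) = d}"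

lemma vmon_deg_subspace: "cvec.subspace (vmon_deg bs d)"
  by (simp add: vmon_deg_def)

lemma vmon_in_deg: "map fst xs = bs \<Longrightarrow> d = int (\<Sum>x\<leftarrow>xs. snd x) \<Longrightarrow> vmon xs \<in> vmon_deg bs d"
  unfolding vmon_deg_def by (rule cvec.span_base) auto

lemma vmon_deg_neg: "d < 0 \<Longrightarrow> vmon_deg bs d = {0}"
proof -
  assume "d < 0"
  hence "{vmon xs | xs. map fst xs = bs \<and> int (\<Sum>x\<leftarrow>xs. snd x) = d} = {}"
    by (auto simp: not_less[symmetric])
  thus ?thesis unfolding vmon_deg_def by (simp only: cvec.span_empty)
qed

lemma vmon_deg_into:
  assumes "clinear f" "cvec.subspace T" "v \<in> vmon_deg bs d"
    and "\<And>xs. map fst xs = bs \<Longrightarrow> int (\<Sum>x\<leftarrow>xs. snd x) = d \<Longrightarrow> f (vmon xs) \<in> T"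
  shows "f v \<in> T"
  by (rule clinear_span_into[OF assms(1,2) _ assms(3)[unfolded vmon_deg_def]]) (use assms(4) in auto)

lemma vschur_vmon_deg:
  "v \<in> vmon_deg bs d \<Longrightarrow> e = int p + d \<Longrightarrow> vschur b p * v \<in> vmon_deg (b # bs) e"
proof (rule vmon_deg_into[OF clinear_mult_left vmon_deg_subspace])
  fix xs assume "e = int p + d" "map fst xs = bs" "int (\<Sum>x\<leftarrow>xs. snd x) = d"
  thus "vschur b p * vmon xs \<in> vmon_deg (b # bs) e"
    using vmon_in_deg[of "(b, p) # xs" "b # bs" e] by simp
qed

lemma vmon_deg_keys: "v \<in> vmon_deg bs d \<Longrightarrow> Poly_Mapping.keys v \<subseteq> {sum_list bs}"
proof -
  assume v: "v \<in> vmon_deg bs d"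
  have "clinear (\<lambda>v::'a gva. v)" by (rule clinearI) auto
  moreover have "cvec.subspace {w :: 'a gva. Poly_Mapping.keys w \<subseteq> {sum_list bs}}"
    unfolding cvec.subspace_def
    by (auto simp: lookup_add lookup_scaleC subset_iff in_keys_iff) (metis add.right_neutral)
  ultimately have "v \<in> {w. Poly_Mapping.keys w \<subseteq> {sum_list bs}}"
    using v by (rule vmon_deg_into) (auto simp: vmon_eq_single split: if_splits)
  thus ?thesis by simp
qed

text \<open>In every summand of \<open>series_pow A k n\<close> the indices of the operators
  \<open>A j\<close> add up to n.\<close>

lemma series_pow_graded:
  assumes "\<And>d. cvec.subspace (V d)" "\<And>j d v. j \<ge> 1 \<Longrightarrow> v \<in> V d \<Longrightarrow> A j v \<in> V (d - int j)" "v \<in> V d"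
  shows "series_pow A k n v \<in> V (d - int n)"
proof (induction k arbitrary: n)
  case 0
  show ?case using assms(3) cvec.subspace_0[OF assms(1)] by simp
next
  case (Suc k)
  have "A j (series_pow A k (n - j) v) \<in> V (d - int n)" if "j \<in> {1..n}" for j
    using assms(2)[OF _ Suc, of j "n - j"] that by (simp add: of_nat_diff algebra_simps)
  thus ?case by (auto intro: cvec.subspace_sum[OF assms(1)])
qed

lemma series_exp_graded:
  assumes "\<And>d. cvec.subspace (V d)" "\<And>j d v. j \<ge> 1 \<Longrightarrow> v \<in> V d \<Longrightarrow> A j v \<in> V (d - int j)" "v \<in> V d"
  shows "series_exp A n v \<in> V (d - int n)"
  unfolding series_exp_def
  by (intro cvec.subspace_sum cvec.subspace_scale assms(1) series_pow_graded[of V, OF assms])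

section \<open>Annihilation operators on the monomials\<close>

context
  fixes form :: "'h::complex_vec \<Rightarrow> 'h \<Rightarrow> complex"
  assumes form: "symmetric_bilinear form"
begin

lemma heis_single: "heis form x (int j) (Poly_Mapping.single \<beta> u) =
    Poly_Mapping.single \<beta> (if j = 0 then form x \<beta> *\<^sub>C u else annih form x j u)"
  by (rule poly_mapping_eqI)
    (auto simp: lookup_heis[OF form] lookup_single when_def annih_lin[OF form])

text \<open>For j > 0 the mode is a derivation of the Fock space that leaves charges alone; x(0) is
  a derivation because (x|\<alpha>) is additive in \<alpha>.\<close>

lemma heis_mult: "heis form x (int j) (v * w) = heis form x (int j) v * w + v * heis form x (int j) w"
proof (induction v rule: poly_mapping_induct)
  case (single \<alpha> u)
  show ?case
  proof (induction w rule: poly_mapping_induct)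
    case (single \<beta> t)
    show ?case
      by (simp add: heis_single mult_single annih_mult[OF form] form_simps[OF form] single_add
          scaleC_add_left scaleC_mult_fock mult_scaleC_fock)
  qed (simp add: distrib_left clinear_add[OF clinear_heis[OF form]] algebra_simps)
qed (simp add: distrib_right clinear_add[OF clinear_heis[OF form]] algebra_simps)

text \<open>Apply x(j) to the recursion for (n + 1) s_(n+1). Differentiating the generators leaves j
  (x|\<beta>) s_(n+1-j), from l = j - 1 only; the induction hypothesis turns the rest into the
  recursion for s_(n+1-j), with factor n + 1 - j. The total factor n + 1 cancels.\<close>

lemma annih_schur:
  assumes j: "j \<ge> 1"
  shows "annih form x j (schur \<beta> p) = (if j \<le> p then form x \<beta> *\<^sub>C schur \<beta> (p - j) else 0)"
proof (induction p rule: less_induct)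
  case (less p)
  show ?case
  proof (cases p)
    case 0
    thus ?thesis using j by (simp add: annih_one[OF form])
  next
    case (Suc n)
    let ?c = "form x \<beta>"
    have IH: "annih form x j (schur \<beta> (n - l)) = (if j \<le> n - l then ?c *\<^sub>C schur \<beta> (n - l - j) else 0)" for l
      using less[of "n - l"] Suc by simp
    have 1: "(\<Sum>l=0..n. (if j = l + 1 then of_nat j * ?c else 0) *\<^sub>C schur \<beta> (n - l)) =
        (if j \<le> Suc n then (of_nat j * ?c) *\<^sub>C schur \<beta> (Suc n - j) else 0)"
    proof -
      have "(\<Sum>l=0..n. (if j = l + 1 then of_nat j * ?c else 0) *\<^sub>C schur \<beta> (n - l)) =
          (\<Sum>l=0..n. if j - 1 = l then (of_nat j * ?c) *\<^sub>C schur \<beta> (n - l) else 0)"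
        using j by (intro sum.cong) auto
      also have "\<dots> = (if j \<le> Suc n then (of_nat j * ?c) *\<^sub>C schur \<beta> (Suc n - j) else 0)"
        using j by (auto simp: sum.delta)
      finally show ?thesis .
    qed
    have 2: "(\<Sum>l=0..n. fgen \<beta> l * annih form x j (schur \<beta> (n - l))) =
        (if j \<le> Suc n then (of_nat (Suc n - j) * ?c) *\<^sub>C schur \<beta> (Suc n - j) else 0)"
    proof (cases "j \<le> n")
      case True
      then obtain m where m: "n = m + j" using le_Suc_ex add.commute by metis
      have "(\<Sum>l=0..n. fgen \<beta> l * annih form x j (schur \<beta> (n - l))) =
          (\<Sum>l=0..m. ?c *\<^sub>C (fgen \<beta> l * schur \<beta> (m - l)))"
        unfolding IH by (rule sum.mono_neutral_cong_right) (auto simp: m mult_scaleC_fock)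
      also have "\<dots> = ?c *\<^sub>C (of_nat (Suc m) * schur \<beta> (Suc m))"
        by (simp only: of_nat_schur cvec.scale_sum_right)
      also have "\<dots> = (of_nat (Suc n - j) * ?c) *\<^sub>C schur \<beta> (Suc n - j)"
        by (simp add: m of_nat_times_fock scaleC_scaleC mult.commute Suc_diff_le del: of_nat_Suc schur.simps)
      finally show ?thesis using True by simp
    next
      case False
      have "(\<Sum>l=0..n. fgen \<beta> l * annih form x j (schur \<beta> (n - l))) = 0"
        unfolding IH by (rule sum.neutral) (use False in auto)
      \<comment> \<open>For j = n + 1 all terms of the sum vanish, in agreement with the factor
        \<open>Suc n - j\<close>, which is then 0.\<close>
      moreover have "j \<le> Suc n \<Longrightarrow> Suc n - j = 0" using False by simp
      ultimately show ?thesis by simp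
    qed
    have "annih form x j (schur \<beta> (Suc n)) =
        (1 / of_nat (Suc n)) *\<^sub>C (\<Sum>l=0..n. annih form x j (fgen \<beta> l * schur \<beta> (n - l)))"
      by (simp only: schur.simps annih_lin[OF form] clinear_sum[OF clinear_annih[OF form]])
    also have "(\<Sum>l=0..n. annih form x j (fgen \<beta> l * schur \<beta> (n - l))) =
        (if j \<le> Suc n then (of_nat j * ?c) *\<^sub>C schur \<beta> (Suc n - j) else 0) +
        (if j \<le> Suc n then (of_nat (Suc n - j) * ?c) *\<^sub>C schur \<beta> (Suc n - j) else 0)"
      unfolding 1[symmetric] 2[symmetric] annih_fgen_mult[OF form] sum.distrib ..
    also have "\<dots> = (if j \<le> Suc n then (of_nat (Suc n) * ?c) *\<^sub>C schur \<beta> (Suc n - j) else 0)"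
      by (simp only: scaleC_add_left[symmetric] distrib_right[symmetric] of_nat_add[symmetric]
          le_add_diff_inverse add_0_right split: if_split) simp
    finally show ?thesis
      unfolding Suc by (simp add: scaleC_scaleC del: of_nat_Suc schur.simps)
  qed
qed

lemma heis_vschur: "heis form x (int j) (vschur \<beta> p) =
    (if j \<le> p then form x \<beta> *\<^sub>C vschur \<beta> (p - j) else 0)"
  unfolding vschur_def heis_single by (cases "j = 0") (auto simp: annih_schur scaleC_single)

text \<open>By the Leibniz rule each term lowers the index of one factor by j and keeps all
  charges.\<close>

lemma heis_vmon: "heis form x (int j) (vmon xs) \<in> vmon_deg (map fst xs) (int (\<Sum>x\<leftarrow>xs. snd x) - int j)"
proof (induction xs)
  case Nil
  have "form x 0 = 0"
    using form_simps(4)[OF form, of x 0 0] by simp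
  hence "heis form x (int j) (vmon []) = 0"
    unfolding vmon_simps vexp_def heis_single by (simp add: annih_one[OF form])
  thus ?case by (simp only: cvec.subspace_0[OF vmon_deg_subspace])
next
  case (Cons b xs)
  have "heis form x (int j) (vmon (b # xs)) =
      heis form x (int j) (vschur (fst b) (snd b)) * vmon xs +
      vschur (fst b) (snd b) * heis form x (int j) (vmon xs)"
    by (simp add: heis_mult)
  moreover have "heis form x (int j) (vschur (fst b) (snd b)) * vmon xs
      \<in> vmon_deg (map fst (b # xs)) (int (\<Sum>x\<leftarrow>b # xs. snd x) - int j)"
    unfolding heis_vschur
    by (auto simp: scaleC_mult_gva of_nat_diff intro!: cvec.subspace_0[OF vmon_deg_subspace]
        cvec.subspace_scale[OF vmon_deg_subspace] vschur_vmon_deg vmon_in_deg)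
  moreover have "vschur (fst b) (snd b) * heis form x (int j) (vmon xs)
      \<in> vmon_deg (map fst (b # xs)) (int (\<Sum>x\<leftarrow>b # xs. snd x) - int j)"
    unfolding list.map by (rule vschur_vmon_deg[OF Cons]) simp
  ultimately show ?case by (simp only: cvec.subspace_add[OF vmon_deg_subspace])
qed

lemma heis_vmon_deg: "v \<in> vmon_deg bs d \<Longrightarrow> heis form x (int j) v \<in> vmon_deg bs (d - int j)"
  by (rule vmon_deg_into[OF clinear_heis[OF form] vmon_deg_subspace], assumption)
    (use heis_vmon in auto)

abbreviation "lower \<alpha> \<equiv> series_exp (lower_op form \<alpha>)"

lemma lower_vmon_deg: "v \<in> vmon_deg bs d \<Longrightarrow> lower \<alpha> q v \<in> vmon_deg bs (d - int q)"
proof (rule series_exp_graded[OF vmon_deg_subspace])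
  fix j d and v :: "'h gva" assume "v \<in> vmon_deg bs d"
  thus "lower_op form \<alpha> j v \<in> vmon_deg bs (d - int j)"
    unfolding lower_op_def[OF form] scaleC_fun_def
    by (intro cvec.subspace_scale[OF vmon_deg_subspace] heis_vmon_deg)
qed

lemma lower_0: "lower \<alpha> 0 v = v"
  by (simp add: series_exp_def scaleC_one)

lemma clinear_lower: "clinear (lower \<alpha> q)"
  by (rule clinear_series(2)[OF form])

text \<open>With a_j = \<alpha>(-j)/j the equation F' = f' F is the recursion of the Schur
  polynomials.\<close>

lemma raise_exp: "series_exp (raise_op form \<alpha>) p v = Poly_Mapping.single 0 (schur \<alpha> p) * v"
proof -
  have "series_exp (raise_op form \<alpha>) p v = fps_nth (Abs_fps (\<lambda>p. Poly_Mapping.single 0 (schur \<alpha> p))) p * v"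
  proof (rule series_exp_mult_unique)
    fix j :: nat and v :: "'h gva" assume "j \<ge> 1"
    moreover have "nat (int j - 1) = j - 1" by simp
    ultimately show "raise_op form \<alpha> j v = ((1 / of_nat j) *\<^sub>C vgen \<alpha> (j - 1)) * v"
      by (simp add: raise_op_def[OF form] scaleC_fun_def heis_def scaleC_mult_gva)
  next
    have *: "of_nat (Suc n) * ((1 / of_nat (Suc n)) *\<^sub>C vgen \<alpha> (Suc n - 1)) = vgen \<alpha> n" for n
      by (simp add: of_nat_times_gva scaleC_scaleC scaleC_one del: of_nat_Suc)
    show "fps_deriv (Abs_fps (\<lambda>p. Poly_Mapping.single 0 (schur \<alpha> p))) =
        Abs_fps (\<lambda>j. of_nat (Suc j) * ((1 / of_nat (Suc j)) *\<^sub>C vgen \<alpha> (Suc j - 1))) *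
        Abs_fps (\<lambda>p. Poly_Mapping.single 0 (schur \<alpha> p))"
      unfolding * by (rule fps_ext) (simp add: fps_mult_nth of_nat_single_schur[simplified])
  qed simp
  thus ?thesis by simp
qed

section \<open>Modes of e^\<alpha> on vectors of a single charge\<close>

lemma zpow_homogeneous: "Poly_Mapping.keys v \<subseteq> {\<gamma>} \<Longrightarrow>
    zpow form \<alpha> s v = (if form \<alpha> \<gamma> = s then v else 0)"
  by (rule poly_mapping_eqI) (auto simp: lookup_zpow[OF form] in_keys_iff)

lemma lower_keys: "Poly_Mapping.keys (lower \<alpha> q v) \<subseteq> Poly_Mapping.keys v"
  by (rule series_exp_keys[OF form]) (rule raise_lower_keys(2)[OF form])

text \<open>On charge \<gamma> the operator z^(\<alpha>(0)) is a single power of z, so the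
  projection becomes a condition on exponents; the shift of the charge and s_p(\<alpha>) combine
  into \<open>vschur \<alpha> p\<close>.\<close>

lemma vertex_mode_homogeneous:
  assumes "Poly_Mapping.keys v \<subseteq> {\<gamma>}"
  shows "vertex_mode form \<alpha> n v = Sum_any (\<lambda>(p, q).
     vschur \<alpha> p * (if form \<alpha> \<gamma> = - n - 1 - of_nat p + of_nat q then lower \<alpha> q v else 0))"
proof -
  have "vertex_summand form \<alpha> n v = (\<lambda>(p, q).
     vschur \<alpha> p * (if form \<alpha> \<gamma> = - n - 1 - of_nat p + of_nat q then lower \<alpha> q v else 0))"
  proof (intro ext, clarify)
    fix p q
    have "Poly_Mapping.keys (lower \<alpha> q v) \<subseteq> {\<gamma>}"
      using lower_keys assms by blast
    hence "Poly_Mapping.keys (Poly_Mapping.single 0 (schur \<alpha> p) * lower \<alpha> q v) \<subseteq> {\<gamma>}"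
      unfolding subset_iff in_keys_iff lookup_single_0_mult[OF form] by (metis mult_zero_right)
    from zpow_homogeneous[OF this]
    show "vertex_summand form \<alpha> n v (p, q) =
        vschur \<alpha> p * (if form \<alpha> \<gamma> = - n - 1 - of_nat p + of_nat q then lower \<alpha> q v else 0)"
      by (simp add: vertex_summand_def[OF form] raise_exp vschur_def mult_single flip: mult.assoc)
  qed
  thus ?thesis by (simp only: vertex_mode_alt[OF form])
qed

end

section \<open>Fields of products with Schur polynomials\<close>

text \<open>A finite form of the Cauchy product: terms with i > k - N meet coefficients of f below
  its lower bound N.\<close>

lemma fps_times_fls_nth:
  fixes F :: "'a::comm_ring_1 fps"
  assumes f: "\<And>k. k < N \<Longrightarrow> fls_nth f k = 0" and M: "nat (k - N) \<le> M"
  shows "fls_nth (fps_to_fls F * f) k = (\<Sum>i\<le>M. fps_nth F i * fls_nth f (k - int i))"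
proof -
  define g where "g = Abs_fps (\<lambda>n. fls_nth f (int n + N))"
  have f_eq: "f = fls_shift (- N) (fps_to_fls g)"
    by (rule fls_eqI) (use f in \<open>auto simp: g_def\<close>)
  have "fls_nth (fps_to_fls F * f) k = fls_nth (fps_to_fls (F * g)) (k - N)"
    by (simp add: f_eq fls_shifted_times_simps fls_times_fps_to_fls)
  also have "\<dots> = (\<Sum>i\<le>M. fps_nth F i * fls_nth f (k - int i))"
  proof (cases "k < N")
    case True
    thus ?thesis by (simp add: f)
  next
    case False
    have "fls_nth (fps_to_fls (F * g)) (k - N) =
        (\<Sum>i=0..nat (k - N). fps_nth F i * fps_nth g (nat (k - N) - i))"
      using False by (simp add: fps_mult_nth)
    also have "\<dots> = (\<Sum>i\<le>M. fps_nth F i * fls_nth f (k - int i))"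
    proof (rule sum.mono_neutral_cong_left)
      show "\<forall>i\<in>{..M} - {0..nat (k - N)}. fps_nth F i * fls_nth f (k - int i) = 0"
        using False by (auto simp: f)
    next
      fix i assume "i \<in> {0..nat (k - N)}"
      hence "int (nat (k - N) - i) + N = k - int i" using False by auto
      thus "fps_nth F i * fps_nth g (nat (k - N) - i) = fps_nth F i * fls_nth f (k - int i)"
        by (simp add: g_def)
    qed (use M in auto)
    finally show ?thesis .
  qed
  finally show ?thesis .
qed

lemma fls_lower_bound: "\<exists>N. \<forall>k<N. fls_nth f k = 0"
  using fls_eq0_below_subdegree by blast

lemma Sum_any_atMost: "(\<And>j. j > N \<Longrightarrow> g j = 0) \<Longrightarrow> Sum_any g = (\<Sum>j\<le>N. g j)" for N :: nat
  by (rule Sum_any.expand_superset) (auto simp: not_less[symmetric])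

lemma sum_triangle_swap:
  fixes f :: "nat \<Rightarrow> nat \<Rightarrow> 'a::comm_monoid_add"
  shows "(\<Sum>m\<le>n. \<Sum>i\<le>n - m. f m i) = (\<Sum>i\<le>n. \<Sum>m\<le>n - i. f m i)"
    and "(\<Sum>m\<le>n. \<Sum>i\<le>n - m. f m i) = (\<Sum>k\<le>n. \<Sum>m\<le>k. f m (k - m))"
proof -
  have 1: "(\<Sum>m\<le>n. \<Sum>i\<le>n - m. g m i) = (\<Sum>(m, i)\<in>{(m, i). m + i \<le> n}. g m i)"
    for g :: "nat \<Rightarrow> nat \<Rightarrow> 'a"
    by (subst sum.Sigma) (auto intro!: sum.cong)
  show "(\<Sum>m\<le>n. \<Sum>i\<le>n - m. f m i) = (\<Sum>i\<le>n. \<Sum>m\<le>n - i. f m i)"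
    unfolding 1 by (rule sum.reindex_bij_witness[of _ prod.swap prod.swap]) auto
  show "(\<Sum>m\<le>n. \<Sum>i\<le>n - m. f m i) = (\<Sum>k\<le>n. \<Sum>m\<le>k. f m (k - m))"
    unfolding 1 by (rule sum.triangle_reindex_eq)
qed

text \<open>Modes are indexed by complex numbers; this is the part of F(z) v with exponents in -n -
  1 + Z, divided by z^(-n-1), hence an ordinary Laurent series when F is a field.\<close>

definition field_series :: "(complex \<Rightarrow> 'h::complex_vec gva \<Rightarrow> 'h gva) \<Rightarrow> complex \<Rightarrow> 'h gva \<Rightarrow> 'h gva fls" where
  "field_series F n v = Abs_fls (\<lambda>k. F (n - of_int k) v)"

text \<open>The m-th divided derivative of \<open>bser x\<close>, that is, the coefficient of w^m in
  its value at z + w.\<close>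

definition hasse_bser :: "'h::complex_vec \<Rightarrow> nat \<Rightarrow> 'h gva fps" where
  "hasse_bser x m = Abs_fps (\<lambda>j. of_nat (m + j choose j) * vgen x (m + j))"

text \<open>Likewise the coefficient of w^a in \<open>eser \<beta>\<close> at z + w.\<close>

definition hasse_eser :: "'h::complex_vec \<Rightarrow> nat \<Rightarrow> 'h gva fps" where
  "hasse_eser \<beta> a = Abs_fps (\<lambda>j. of_nat (a + j choose j) * vschur \<beta> (a + j))"

lemma hasse_step:
  fixes f :: "nat \<Rightarrow> 'a::comm_ring_1"
  shows "fps_deriv (Abs_fps (\<lambda>j. of_nat (m + j choose j) * f (m + j))) =
    of_nat (Suc m) * Abs_fps (\<lambda>j. of_nat (Suc m + j choose j) * f (Suc m + j))"
proof (rule fps_ext)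
  fix j
  have "Suc j * (m + Suc j choose Suc j) = Suc m * (Suc m + j choose j)"
  proof -
    have "Suc j * (m + Suc j choose Suc j) = Suc (m + j) * (m + j choose j)"
      using Suc_times_binomial_eq[of "m + j" j] by (simp only: add_Suc_right mult.commute)
    also have "\<dots> = Suc m * (Suc m + j choose j)"
      using Suc_times_binomial_eq[of "m + j" m] binomial_symmetric[of m "m + j"]
        binomial_symmetric[of "Suc m" "Suc m + j"]
      by (simp del: binomial_Suc_Suc mult_Suc mult_Suc_right)
    finally show ?thesis .
  qed
  hence "of_nat (Suc j) * of_nat (m + Suc j choose Suc j) = (of_nat (Suc m) * of_nat (Suc m + j choose j) :: 'a)"
    by (simp only: of_nat_mult[symmetric])
  thus "fps_nth (fps_deriv (Abs_fps (\<lambda>j. of_nat (m + j choose j) * f (m + j)))) j =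
      fps_nth (of_nat (Suc m) * Abs_fps (\<lambda>j. of_nat (Suc m + j choose j) * f (Suc m + j))) j"
    unfolding fps_of_nat[symmetric] fps_mult_left_const_nth fps_deriv_nth fps_nth_Abs_fps
    by (simp only: mult.assoc[symmetric] Suc_eq_plus1[symmetric] add_Suc_right add_Suc)
qed

lemma of_nat_Suc_cancel_fps:
  "of_nat (Suc n) * (u :: 'h::complex_vec gva fps) = of_nat (Suc n) * v \<Longrightarrow> u = v"
proof (rule fps_ext)
  fix j assume "of_nat (Suc n) * u = of_nat (Suc n) * v"
  hence "fps_nth (of_nat (Suc n) * u) j = fps_nth (of_nat (Suc n) * v) j" by simp
  thus "fps_nth u j = fps_nth v j"
    unfolding fps_of_nat[symmetric] fps_mult_left_const_nth by (rule of_nat_Suc_cancel_gva)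
qed

lemma of_nat_Suc_cancel_fls:
  "of_nat (Suc n) * (u :: 'h::complex_vec gva fls) = of_nat (Suc n) * v \<Longrightarrow> u = v"
proof (rule fls_eqI)
  fix j assume "of_nat (Suc n) * u = of_nat (Suc n) * v"
  hence "fls_nth (of_nat (Suc n) * u) j = fls_nth (of_nat (Suc n) * v) j" by simp
  thus "fls_nth u j = fls_nth v j"
    unfolding fls_of_nat fls_mult_const_nth by (rule of_nat_Suc_cancel_gva)
qed

text \<open>The recursion of the Schur polynomials after the substitution \<open>w \<mapsto> z + w\<close>, by coefficients of \<open>w\<close>.\<close>

lemma hasse_eser_rec: "of_nat (Suc a) * hasse_eser \<beta> (Suc a) = (\<Sum>m\<le>a. hasse_bser \<beta> m * hasse_eser \<beta> (a - m))"
proof (induction a)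
  case 0
  have "hasse_eser \<beta> 0 = eser \<beta>" "hasse_bser \<beta> 0 = bser \<beta>"
    by (rule fps_ext; simp add: hasse_eser_def hasse_bser_def bser_def)+
  thus ?case
    using hasse_step[of 0 "vschur \<beta>", folded hasse_eser_def] by (simp add: fps_deriv_eser)
next
  case (Suc a)
  have dE: "fps_deriv (hasse_eser \<beta> m) = of_nat (Suc m) * hasse_eser \<beta> (Suc m)" for m
    unfolding hasse_eser_def by (rule hasse_step)
  have dB: "fps_deriv (hasse_bser \<beta> m) = of_nat (Suc m) * hasse_bser \<beta> (Suc m)" for m
    unfolding hasse_bser_def by (rule hasse_step)
  let ?t = "\<lambda>m. hasse_bser \<beta> m * hasse_eser \<beta> (Suc a - m)"
  \<comment> \<open>Differentiate the induction hypothesis in z. After a shift of the first sum,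
    each term \<open>?t m\<close> carries the weights m and \<open>Suc a - m\<close>, whose sum
    \<open>Suc a\<close> cancels.\<close>
  have "of_nat (Suc a) * (of_nat (Suc (Suc a)) * hasse_eser \<beta> (Suc (Suc a))) =
      fps_deriv (of_nat (Suc a) * hasse_eser \<beta> (Suc a))"
    by (simp add: dE fps_of_nat[symmetric] del: of_nat_Suc)
  also have "\<dots> = (\<Sum>m\<le>a. of_nat (Suc m) * ?t (Suc m)) +
      (\<Sum>m\<le>a. of_nat (Suc a - m) * ?t m)"
    unfolding Suc
    by (simp add: fps_deriv_sum dE dB sum.distrib Suc_diff_le algebra_simps del: of_nat_Suc)
  also have "(\<Sum>m\<le>a. of_nat (Suc m) * ?t (Suc m)) = (\<Sum>m\<le>Suc a. of_nat m * ?t m)"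
    by (subst sum.atMost_Suc_shift) simp
  also have "(\<Sum>m\<le>a. of_nat (Suc a - m) * ?t m) = (\<Sum>m\<le>Suc a. of_nat (Suc a - m) * ?t m)"
    by simp
  also have "(\<Sum>m\<le>Suc a. of_nat m * ?t m) + \<dots> = (\<Sum>m\<le>Suc a. of_nat (Suc a) * ?t m)"
    unfolding sum.distrib[symmetric] distrib_right[symmetric] of_nat_add[symmetric]
    by (intro sum.cong refl) (simp del: of_nat_Suc)
  also have "\<dots> = of_nat (Suc a) * (\<Sum>m\<le>Suc a. ?t m)"
    by (simp only: sum_distrib_left)
  finally show ?case by (rule of_nat_Suc_cancel_fps)
qed

text \<open>The coefficient of w^a in exp(sum \<beta>(-n) ((z + w)^n - z^n) / n); the charges cancel
  as well.\<close>

definition shifted_schur :: "'h::complex_vec \<Rightarrow> nat \<Rightarrow> 'h gva fps" where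
  "shifted_schur \<beta> a = hasse_eser \<beta> a * eser (- \<beta>)"

lemma shifted_schur_0: "shifted_schur \<beta> 0 = 1"
proof -
  have "hasse_eser \<beta> 0 = eser \<beta>"
    by (rule fps_ext) (simp add: hasse_eser_def)
  thus ?thesis by (simp add: shifted_schur_def eser_zero flip: eser_add)
qed

lemma shifted_schur_rec:
  "of_nat (Suc a) * shifted_schur \<beta> (Suc a) = (\<Sum>m\<le>a. hasse_bser \<beta> m * shifted_schur \<beta> (a - m))"
  using arg_cong[OF hasse_eser_rec[of a \<beta>], of "\<lambda>f. f * eser (- \<beta>)"]
  by (simp only: shifted_schur_def sum_distrib_right mult.assoc)

text \<open>Modes x(j) with j beyond this degree vanish on v, which makes sums over annihilation
  modes finite.\<close>

definition fil_deg :: "'h::complex_vec gva \<Rightarrow> nat" where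
  "fil_deg v = (LEAST d. v \<in> Fil d)"

context
  fixes form :: "'h::complex_vec \<Rightarrow> 'h \<Rightarrow> complex"
  assumes form: "symmetric_bilinear form"
begin

lemma fil_deg: "v \<in> Fil (fil_deg v)" for v :: "'h gva"
  unfolding fil_deg_def using Fil_exhaust[OF form] by (rule LeastI_ex)

lemma field_series_nth:
  fixes F :: "complex \<Rightarrow> 'h gva \<Rightarrow> 'h gva"
  assumes "F \<in> fields"
  shows "fls_nth (field_series F n v) k = F (n - of_int k) v"
proof -
  obtain N where "\<forall>j\<ge>N. F (n + of_nat j) v = 0" using fieldsD(2)[OF form assms] by blast
  hence "\<forall>\<^sub>\<infinity>j. F (n - of_int (- int j)) v = 0"
    by (auto simp: MOST_nat_le)
  thus ?thesis
    unfolding field_series_def by (rule nth_Abs_fls)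
qed

text \<open>
  The contribution of the annihilation part of \<open>\<partial>\<^sup>(\<^sup>m\<^sup>)x(z)\<close> to the normally ordered product with a field
  whose series are given by \<open>H\<close>.
\<close>

definition annih_series :: "'h \<Rightarrow> nat \<Rightarrow> ('h gva \<Rightarrow> 'h gva fls) \<Rightarrow> 'h gva \<Rightarrow> 'h gva fls" where
  "annih_series x m H v = (\<Sum>j\<le>fil_deg v. fls_const (((- 1) ^ m * of_nat (m + j choose j)) *\<^sub>C 1) *
     fls_shift (int (Suc m + j)) (H (heis form x (int j) v)))"

text \<open>The creation half of the divided derivative of x(z) multiplies from outside, which gives
  the first term; the annihilation half acts on v before F does.\<close>

lemma field_series_normal_ordered:
  fixes F :: "complex \<Rightarrow> 'h gva \<Rightarrow> 'h gva"
  assumes F: "F \<in> fields"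
  shows "field_series (normal_ordered form x (Suc m) F) n v =
    fps_to_fls (hasse_bser x m) * field_series F n v + annih_series x m (field_series F n) v"
proof (rule fls_eqI)
  fix k
  obtain N where N: "\<forall>k<N. fls_nth (field_series F n v) k = 0" using fls_lower_bound by blast
  let ?M = "nat (k - N)" and ?n = "n - of_int k"
  have "nop form x (Suc m) F ?n v = (\<Sum>j\<le>?M. of_nat (Suc m - 1 + j choose j) *\<^sub>C
     heis form x (- int (Suc m + j)) (F (?n + of_nat j) v))"
    unfolding nop_def[OF form]
  proof (rule Sum_any_atMost)
    fix j assume "j > ?M"
    hence "fls_nth (field_series F n v) (k - int j) = 0" using N by auto
    hence "F (?n + of_nat j) v = 0" by (simp add: field_series_nth[OF F] algebra_simps)
    thus "of_nat (Suc m - 1 + j choose j) *\<^sub>C heis form x (- int (Suc m + j)) (F (?n + of_nat j) v) = 0"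
      by (simp add: clinear_zero[OF clinear_heis[OF form]])
  qed
  also have "\<dots> = (\<Sum>j\<le>?M. fps_nth (hasse_bser x m) j * fls_nth (field_series F n v) (k - int j))"
  proof (intro sum.cong refl)
    fix j
    have "n - of_int (k - int j) = ?n + of_nat j" by simp
    moreover have "nat (- (- int (Suc m + j)) - 1) = m + j" by simp
    ultimately show "of_nat (Suc m - 1 + j choose j) *\<^sub>C heis form x (- int (Suc m + j)) (F (?n + of_nat j) v) =
        fps_nth (hasse_bser x m) j * fls_nth (field_series F n v) (k - int j)"
      unfolding field_series_nth[OF F] hasse_bser_def heis_def
      by (simp add: of_nat_times_gva scaleC_mult_gva diff_diff_eq2 diff_add_eq)
  qed
  also have "\<dots> = fls_nth (fps_to_fls (hasse_bser x m) * field_series F n v) k"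
    by (rule fps_times_fls_nth[symmetric]) (use N in auto)
  finally have 1: "nop form x (Suc m) F ?n v = \<dots>" .
  have "noq form x (Suc m) F ?n v = (\<Sum>j\<le>fil_deg v. (- ((- 1) ^ Suc m) * of_nat (Suc m - 1 + j choose j)) *\<^sub>C
     F (?n - of_nat (Suc m + j)) (heis form x (int j) v))"
    unfolding noq_def[OF form]
    by (rule Sum_any_atMost)
      (simp add: heis_Fil(2)[OF form fil_deg] clinear_zero[OF fieldsD(1)[OF form F]])
  also have "\<dots> = fls_nth (annih_series x m (field_series F n) v) k"
    unfolding annih_series_def fls_nth_sum
  proof (intro sum.cong refl)
    fix j
    have "n - of_int (k + int (Suc m + j)) = ?n - of_nat (Suc m + j)" by simp
    thus "(- ((- 1) ^ Suc m) * of_nat (Suc m - 1 + j choose j)) *\<^sub>C F (?n - of_nat (Suc m + j)) (heis form x (int j) v) =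
      fls_nth (fls_const (((- 1) ^ m * of_nat (m + j choose j)) *\<^sub>C 1) *
       fls_shift (int (Suc m + j)) (field_series F n (heis form x (int j) v))) k"
      by (simp only: fls_mult_const_nth fls_shift_nth field_series_nth[OF F] scaleC_mult_gva) simp
  qed
  finally have 2: "noq form x (Suc m) F ?n v = \<dots>" .
  show "fls_nth (field_series (normal_ordered form x (Suc m) F) n v) k = fls_nth
    (fps_to_fls (hasse_bser x m) * field_series F n v + annih_series x m (field_series F n) v) k"
    by (simp add: field_series_nth[OF normal_ordered_fields[OF form F]] normal_ordered_split[OF form F] 1 2)
qed

end

lemma fls_shift_sum: "fls_shift m (sum f I) = (\<Sum>i\<in>I. fls_shift m (f i))"
  by (rule fls_eqI) (simp add: fls_nth_sum)

lemma eser_uminus: "eser (- \<alpha>) * eser \<alpha> = 1"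
  by (simp add: eser_zero flip: eser_add)

lemma of_nat_times_fls_const:
  "of_nat (Suc p) * fls_const ((1 / of_nat (Suc p)) *\<^sub>C 1 :: 'h::complex_vec gva) = 1"
  unfolding fls_of_nat fls_const_mult_const of_nat_times_gva scaleC_scaleC
  by (simp add: scaleC_one del: of_nat_Suc)

text \<open>
  Series in \<open>e\<^sup>\<delta> exp (\<Sum>n>0. \<delta>(-n) z\<^sup>n / n) S((z))\<close>; the exponential factor is divided out, so that the
  condition makes sense coefficientwise.
\<close>

definition twisted :: "'h::complex_vec gva set \<Rightarrow> 'h \<Rightarrow> 'h gva fls set" where
  "twisted S \<delta> = {f. \<forall>k. fls_nth (fps_to_fls (eser (- \<delta>)) * f) k \<in> S}"

lemma twisted_sum:
  assumes "cvec.subspace S" "\<And>i. i \<in> I \<Longrightarrow> f i \<in> twisted S \<delta>"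
  shows "sum f I \<in> twisted S \<delta>"
  using assms(2) by (auto simp: twisted_def sum_distrib_left fls_nth_sum intro!: cvec.subspace_sum[OF assms(1)])

lemma twisted_shift: "f \<in> twisted S \<delta> \<Longrightarrow> fls_shift m f \<in> twisted S \<delta>"
  by (simp add: twisted_def fls_shifted_times_simps)

lemma twisted_scale:
  assumes "cvec.subspace S" "f \<in> twisted S \<delta>"
  shows "fls_const (c *\<^sub>C 1) * f \<in> twisted S \<delta>"
proof -
  have "fps_to_fls (eser (- \<delta>)) * (fls_const (c *\<^sub>C 1) * f) = fls_const (c *\<^sub>C 1) * (fps_to_fls (eser (- \<delta>)) * f)"
    by (rule mult.left_commute)
  thus ?thesis
    using assms unfolding twisted_def
    by (simp only: mem_Collect_eq fls_mult_const_nth scaleC_mult_gva mult_1)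
      (blast intro: cvec.subspace_scale)
qed

text \<open>Dividing by the exponential of \<delta> - \<beta> instead of \<delta> releases a factor
  \<open>eser \<beta>\<close> that cancels the denominator of \<open>shifted_schur\<close>. What
  remains, \<open>hasse_eser \<beta> a\<close>, has multiples of the \<open>vschur \<beta> p\<close>
  as coefficients, and these preserve S.\<close>

lemma twisted_shifted_schur:
  assumes S: "cvec.subspace S" "\<And>p v. v \<in> S \<Longrightarrow> vschur \<beta> p * v \<in> S" and f: "f \<in> twisted S \<delta>"
  shows "fps_to_fls (shifted_schur \<beta> a) * f \<in> twisted S (\<delta> - \<beta>)"
proof -
  let ?g = "fps_to_fls (eser (- \<delta>)) * f"
  obtain N where N: "\<forall>k<N. fls_nth ?g k = 0" using fls_lower_bound by blast
  have "eser (- (\<delta> - \<beta>)) * shifted_schur \<beta> a = hasse_eser \<beta> a * eser (- \<delta>)"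
  proof -
    have "eser (- (\<delta> - \<beta>)) = eser (- \<delta>) * eser \<beta>"
      by (simp flip: eser_add)
    hence "eser (- (\<delta> - \<beta>)) * shifted_schur \<beta> a = hasse_eser \<beta> a * eser (- \<delta>) * (eser (- \<beta>) * eser \<beta>)"
      by (simp add: shifted_schur_def mult_ac)
    thus ?thesis by (simp add: eser_uminus)
  qed
  hence eq: "fps_to_fls (eser (- (\<delta> - \<beta>))) * (fps_to_fls (shifted_schur \<beta> a) * f) = fps_to_fls (hasse_eser \<beta> a) * ?g"
    by (simp only: mult.assoc[symmetric] fls_times_fps_to_fls[symmetric])
  have "fls_nth (fps_to_fls (hasse_eser \<beta> a) * ?g) k \<in> S" for k
  proof -
    have "fls_nth (fps_to_fls (hasse_eser \<beta> a) * ?g) k =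
        (\<Sum>i\<le>nat (k - N). fps_nth (hasse_eser \<beta> a) i * fls_nth ?g (k - int i))"
      by (rule fps_times_fls_nth) (use N in auto)
    also have "\<dots> \<in> S"
      using f S(2) by (auto simp: hasse_eser_def of_nat_times_gva mult.assoc scaleC_mult_gva twisted_def
          intro!: cvec.subspace_sum[OF S(1)] cvec.subspace_scale[OF S(1)])
    finally show ?thesis .
  qed
  thus ?thesis unfolding twisted_def mem_Collect_eq eq by blast
qed

context
  fixes form :: "'h::complex_vec \<Rightarrow> 'h \<Rightarrow> complex"
  assumes form: "symmetric_bilinear form"
begin

lemma clinear_state_field: "clinear (state_field form)"
  using is_state_field[OF form] by (simp add: is_state_field_def)

lemma state_field_vgen:
  "state_field form (vgen x m * a) = normal_ordered form x (Suc m) (state_field form a)"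
proof -
  have "heis form x (- int (Suc m)) a = vgen x m * a"
    by (simp add: heis_def)
  thus ?thesis
    using is_state_field[OF form] unfolding is_state_field_def by (metis le_add1 plus_1_eq_Suc)
qed

lemma state_field_fields: "state_field form a \<in> fields"
proof (induction a rule: poly_mapping_induct)
  case (single \<alpha> u)
  show ?case
  proof (induction u rule: fock_induct)
    case one
    show ?case
      using vertex_mode_fields[OF form, of \<alpha>] state_field_vexp[OF form, of \<alpha>] by (simp add: vexp_def)
  next
    case (fgen x k u)
    have "Poly_Mapping.single \<alpha> (fgen x k * u) = vgen x k * Poly_Mapping.single \<alpha> u"
      by (simp add: mult_single)
    thus ?case using normal_ordered_fields[OF form fgen] by (simp add: state_field_vgen)
  next
    case (add u v)
    thus ?case
      by (simp only: single_add clinear_add[OF clinear_state_field] cvec.subspace_add[OF fields_subspace[OF form]])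
  next
    case (scale c u)
    thus ?case
      by (simp add: clinear_scale[OF clinear_state_field] cvec.subspace_scale[OF fields_subspace[OF form]]
          flip: scaleC_single)
  qed
next
  case (add a b)
  thus ?case
    by (simp only: clinear_add[OF clinear_state_field] cvec.subspace_add[OF fields_subspace[OF form]])
qed

definition vseries :: "'h gva \<Rightarrow> complex \<Rightarrow> 'h gva \<Rightarrow> 'h gva fls" where
  "vseries a = field_series (state_field form a)"

lemma vseries_nth: "fls_nth (vseries a n v) k = state_field form a (n - of_int k) v"
  unfolding vseries_def by (rule field_series_nth[OF form state_field_fields])

lemma vseries_add: "vseries (a + b) n v = vseries a n v + vseries b n v"
  by (rule fls_eqI) (simp add: vseries_nth clinear_add[OF clinear_state_field] plus_fun_def)

lemma vseries_zero: "vseries 0 n v = 0"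
  using vseries_add[of 0 0] by simp

lemma vseries_sum: "vseries (sum f I) n v = (\<Sum>i\<in>I. vseries (f i) n v)"
  by (induction I rule: infinite_finite_induct) (simp_all add: vseries_add vseries_zero)

lemma vseries_of_nat: "vseries (of_nat k * a) n v = of_nat k * vseries a n v"
  by (induction k) (simp_all add: vseries_add vseries_zero distrib_right)

lemma vseries_vgen: "vseries (vgen x m * a) n v =
    fps_to_fls (hasse_bser x m) * vseries a n v + annih_series form x m (vseries a n) v"
  unfolding vseries_def state_field_vgen
  by (rule field_series_normal_ordered[OF form state_field_fields])

text \<open>Annihilation modes act on the argument of the \<open>H i\<close>, while the factors
  \<open>T i\<close> multiply afterwards and do not depend on that argument.\<close>

lemma annih_series_sum: "annih_series form x m (\<lambda>v. \<Sum>i\<in>I. T i * H i v) v =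
    (\<Sum>i\<in>I. T i * annih_series form x m (H i) v)"
  unfolding annih_series_def[OF form] fls_shift_sum sum_distrib_left
  by (subst sum.swap) (simp add: fls_shifted_times_simps mult.left_commute)

text \<open>
  The annihilation factors of \<open>exp (\<Sum>n>0. \<beta>(-n) w\<^sup>n / n)\<close> inside a normally ordered product; \<open>p\<close> is the
  exponent of \<open>w\<close>.
\<close>

fun annih_exp :: "'h \<Rightarrow> ('h gva \<Rightarrow> 'h gva fls) \<Rightarrow> nat \<Rightarrow> 'h gva \<Rightarrow> 'h gva fls" where
  "annih_exp \<beta> H 0 = H"
| "annih_exp \<beta> H (Suc p) = (\<lambda>v. fls_const ((1 / of_nat (Suc p)) *\<^sub>C 1) *
     (\<Sum>m\<le>p. annih_series form \<beta> m (annih_exp \<beta> H (p - m)) v))"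

lemma annih_exp_rec: "of_nat (Suc p) * annih_exp \<beta> H (Suc p) v =
    (\<Sum>m\<le>p. annih_series form \<beta> m (annih_exp \<beta> H (p - m)) v)"
  by (simp only: annih_exp.simps mult.assoc[symmetric] of_nat_times_fls_const mult_1)

text \<open>Multiplying the state by exp(sum \<beta>(-n) w^n / n) puts the normally ordered
  exponential of the fields w^n/n times the (n-1)-st divided derivative of \<beta>(z) around its
  field. The creation half of that exponent sums to the exponent of \<open>shifted_schur\<close>;
  this is the coefficient of w^p.\<close>

lemma vseries_schur: "vseries (Poly_Mapping.single 0 (schur \<beta> p) * a) n v =
    (\<Sum>i\<le>p. fps_to_fls (shifted_schur \<beta> i) * annih_exp \<beta> (vseries a n) (p - i) v)"
proof (induction p arbitrary: v rule: less_induct)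
  case (less p)
  show ?case
  proof (cases p)
    case 0
    thus ?thesis by (simp add: shifted_schur_0)
  next
    case (Suc q)
    define B T where "B = (\<lambda>i. fps_to_fls (hasse_bser \<beta> i))"
      and "T = (\<lambda>i. fps_to_fls (shifted_schur \<beta> i))"
    define G where "G = annih_exp \<beta> (vseries a n)"
    define s where "s = (\<lambda>i. Poly_Mapping.single 0 (schur \<beta> i) :: 'h gva)"
    have T: "of_nat (Suc k) * T (Suc k) = (\<Sum>m\<le>k. B m * T (k - m))" for k
    proof -
      have "(\<Sum>m\<le>k. B m * T (k - m)) = fps_to_fls (\<Sum>m\<le>k. hasse_bser \<beta> m * shifted_schur \<beta> (k - m))"
        unfolding B_def T_def by (rule fls_eqI) (simp add: fls_nth_sum fps_sum_nth fls_times_fps_to_fls[symmetric])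
      also have "\<dots> = of_nat (Suc k) * T (Suc k)"
        unfolding shifted_schur_rec[symmetric] T_def by (simp add: fls_times_fps_to_fls del: of_nat_Suc)
      finally show ?thesis ..
    qed
    have IH: "vseries (s (q - m) * a) n w = (\<Sum>i\<le>q - m. T i * G (q - m - i) w)" for m w
      unfolding s_def T_def G_def by (rule less.IH) (use Suc in simp)
    have "of_nat (Suc q) * s (Suc q) = (\<Sum>m\<le>q. vgen \<beta> m * s (q - m))"
      unfolding s_def of_nat_single_schur atLeast0AtMost ..
    hence "of_nat (Suc q) * vseries (s (Suc q) * a) n v = vseries (\<Sum>m\<le>q. vgen \<beta> m * (s (q - m) * a)) n v"
      by (simp only: vseries_of_nat[symmetric] mult.assoc[symmetric] sum_distrib_right[symmetric])
    also have "\<dots> = (\<Sum>m\<le>q. B m * vseries (s (q - m) * a) n v) +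
        (\<Sum>m\<le>q. annih_series form \<beta> m (vseries (s (q - m) * a) n) v)"
      by (simp only: vseries_sum vseries_vgen sum.distrib B_def)
    \<comment> \<open>Regrouping by k = m + i collects the recursion of
      \<open>shifted_schur\<close>, which contributes the weight k.\<close>
    also have "(\<Sum>m\<le>q. B m * vseries (s (q - m) * a) n v) = (\<Sum>m\<le>q. \<Sum>i\<le>q - m. B m * T i * G (q - (m + i)) v)"
      by (simp only: IH sum_distrib_left mult.assoc diff_diff_left)
    also have "\<dots> = (\<Sum>k\<le>q. \<Sum>m\<le>k. B m * T (k - m) * G (q - k) v)"
      by (subst sum_triangle_swap(2)) (auto intro!: sum.cong)
    also have "\<dots> = (\<Sum>k\<le>q. of_nat (Suc k) * T (Suc k) * G (q - k) v)"
      by (simp only: T sum_distrib_right)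
    also have "\<dots> = (\<Sum>k\<le>Suc q. of_nat k * (T k * G (Suc q - k) v))"
      by (subst sum.atMost_Suc_shift) (simp add: mult.assoc del: of_nat_Suc)
    \<comment> \<open>Regrouping by i collects the recursion of \<open>annih_exp\<close>, with
      weight \<open>Suc q - i\<close>. The two weights add up to \<open>Suc q\<close>, which cancels
      at the end.\<close>
    also have "(\<Sum>m\<le>q. annih_series form \<beta> m (vseries (s (q - m) * a) n) v) =
        (\<Sum>m\<le>q. \<Sum>i\<le>q - m. T i * annih_series form \<beta> m (G (q - m - i)) v)"
      by (simp only: IH[abs_def] annih_series_sum)
    also have "\<dots> = (\<Sum>i\<le>q. T i * (\<Sum>m\<le>q - i. annih_series form \<beta> m (G (q - i - m)) v))"
      by (subst sum_triangle_swap(1)) (simp add: sum_distrib_left add.commute)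
    also have "\<dots> = (\<Sum>i\<le>q. of_nat (Suc q - i) * (T i * G (Suc q - i) v))"
    proof (intro sum.cong refl)
      fix i assume "i \<in> {..q}"
      hence "Suc q - i = Suc (q - i)" by auto
      thus "T i * (\<Sum>m\<le>q - i. annih_series form \<beta> m (G (q - i - m)) v) = of_nat (Suc q - i) * (T i * G (Suc q - i) v)"
        unfolding G_def annih_exp_rec[symmetric] by (simp only: mult.left_commute)
    qed
    also have "\<dots> = (\<Sum>i\<le>Suc q. of_nat (Suc q - i) * (T i * G (Suc q - i) v))"
      by simp
    also have "(\<Sum>k\<le>Suc q. of_nat k * (T k * G (Suc q - k) v)) + \<dots> =
        (\<Sum>k\<le>Suc q. of_nat (Suc q) * (T k * G (Suc q - k) v))"
      unfolding sum.distrib[symmetric] distrib_right[symmetric] of_nat_add[symmetric]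
      by (intro sum.cong refl) (simp del: of_nat_Suc)
    also have "\<dots> = of_nat (Suc q) * (\<Sum>k\<le>Suc q. T k * G (Suc q - k) v)"
      by (simp only: sum_distrib_left)
    finally show ?thesis
      unfolding Suc s_def T_def G_def by (rule of_nat_Suc_cancel_fls)
  qed
qed

lemma annih_series_twisted:
  assumes S: "cvec.subspace S" and V: "\<And>x j v. v \<in> V \<Longrightarrow> heis form x (int j) v \<in> V"
    and H: "\<And>v. v \<in> V \<Longrightarrow> H v \<in> twisted S \<delta>" and v: "v \<in> V"
  shows "annih_series form x m H v \<in> twisted S \<delta>"
  unfolding annih_series_def[OF form]
  by (intro twisted_sum[OF S] twisted_scale[OF S] twisted_shift H V v)

lemma annih_exp_twisted:
  assumes S: "cvec.subspace S" and V: "\<And>x j v. v \<in> V \<Longrightarrow> heis form x (int j) v \<in> V"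
    and H: "\<And>v. v \<in> V \<Longrightarrow> H v \<in> twisted S \<delta>" and v: "v \<in> V"
  shows "annih_exp \<beta> H p v \<in> twisted S \<delta>"
  using v
proof (induction p arbitrary: v rule: less_induct)
  case (less p)
  show ?case
  proof (cases p)
    case 0
    thus ?thesis using H less.prems by simp
  next
    case (Suc q)
    have "annih_series form \<beta> m (annih_exp \<beta> H (q - m)) v \<in> twisted S \<delta>" for m
      by (rule annih_series_twisted[OF S V _ less.prems], assumption)
        (rule less.IH, use Suc in auto)
    thus ?thesis
      unfolding Suc annih_exp.simps by (intro twisted_scale[OF S] twisted_sum[OF S])
  qed
qed

text \<open>Annihilation only moves the argument within V, and \<open>shifted_schur \<beta>\<close>
  lowers the twist by \<beta>: every Schur factor of the state uses up its own charge of the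
  twist.\<close>

lemma vseries_schur_twisted:
  assumes S: "cvec.subspace S" "\<And>p v. v \<in> S \<Longrightarrow> vschur \<beta> p * v \<in> S"
    and V: "\<And>x j v. v \<in> V \<Longrightarrow> heis form x (int j) v \<in> V"
    and H: "\<And>v. v \<in> V \<Longrightarrow> vseries a n v \<in> twisted S \<delta>" and v: "v \<in> V"
  shows "vseries (Poly_Mapping.single 0 (schur \<beta> p) * a) n v \<in> twisted S (\<delta> - \<beta>)"
  unfolding vseries_schur
  by (intro twisted_sum[OF S(1)] twisted_shifted_schur[OF S] annih_exp_twisted[OF S(1) V H v])

text \<open>The creation part of the field is \<open>eser \<alpha>\<close> itself; dividing it out
  leaves z^(\<alpha>(0)) and the annihilation part, whose coefficients on v lie in S.\<close>

lemma vseries_vexp_twisted: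
  assumes S: "cvec.subspace S" and v: "\<And>q. lower form \<alpha> q v \<in> S" and keys: "Poly_Mapping.keys v \<subseteq> {\<gamma>}"
  shows "vseries (vexp \<alpha>) n v \<in> twisted S \<alpha>"
proof -
  obtain d where d: "v \<in> Fil d" using Fil_exhaust[OF form] by blast
  define g where "g k = (\<Sum>q\<le>d. if form \<alpha> \<gamma> = - n - 1 + of_int k + of_nat q then lower form \<alpha> q v else 0)" for k
  \<comment> \<open>A nonzero \<open>g k\<close> needs (\<alpha>|\<gamma>) + n + 1 = k + q with q
    \<le> d. The floor only serves to define N for arbitrary complex values.\<close>
  define N where "N = \<lfloor>Re (form \<alpha> \<gamma> + n + 1)\<rfloor> - int d"
  have cond: "form \<alpha> \<gamma> \<noteq> - n - 1 + of_int k + of_nat q" if "k < N" "q \<le> d" for k q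
  proof
    assume "form \<alpha> \<gamma> = - n - 1 + of_int k + of_nat q"
    hence "form \<alpha> \<gamma> + n + 1 = of_int (k + int q)" by simp
    hence "Re (form \<alpha> \<gamma> + n + 1) = of_int (k + int q)" by simp
    hence "\<lfloor>Re (form \<alpha> \<gamma> + n + 1)\<rfloor> = k + int q" by simp
    thus False using that by (simp add: N_def)
  qed
  have g0: "g k = 0" if "k < N" for k
    unfolding g_def using cond[OF that] by (intro sum.neutral) auto
  have nth: "fls_nth (Abs_fls g) k = g k" for k
    by (rule nth_Abs_fls_lower_bound[of N]) (use g0 in auto)
  have "vseries (vexp \<alpha>) n v = fps_to_fls (eser \<alpha>) * Abs_fls g"
  proof (rule fls_eqI)
    fix k
    let ?f = "\<lambda>(p, q). vschur \<alpha> p *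
      (if form \<alpha> \<gamma> = - (n - of_int k) - 1 - of_nat p + of_nat q then lower form \<alpha> q v else 0)"
    have c: "form \<alpha> \<gamma> = - (n - of_int k) - 1 - of_nat p + of_nat q \<longleftrightarrow>
        form \<alpha> \<gamma> = - n - 1 + of_int (k - int p) + of_nat q" for p q
      by (simp add: algebra_simps)
    have "fls_nth (vseries (vexp \<alpha>) n v) k = Sum_any ?f"
      unfolding vseries_nth state_field_vexp[OF form] by (rule vertex_mode_homogeneous[OF form keys])
    also have "\<dots> = (\<Sum>pq\<in>{..nat (k - N)} \<times> {..d}. ?f pq)"
    proof (rule Sum_any.expand_superset)
      show "{pq. ?f pq \<noteq> 0} \<subseteq> {..nat (k - N)} \<times> {..d}"
      proof clarify
        fix p q assume nz: "vschur \<alpha> p *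
          (if form \<alpha> \<gamma> = - (n - of_int k) - 1 - of_nat p + of_nat q then lower form \<alpha> q v else 0) \<noteq> 0"
        hence "lower form \<alpha> q v \<noteq> 0" "form \<alpha> \<gamma> = - n - 1 + of_int (k - int p) + of_nat q"
          unfolding c by (auto split: if_splits)
        moreover from this have q: "q \<le> d" using lower_exp_zero[OF form d] by (metis not_le)
        ultimately have "\<not> k - int p < N" using cond by blast
        thus "p \<in> {..nat (k - N)} \<and> q \<in> {..d}" using q by auto
      qed
    qed simp
    also have "\<dots> = (\<Sum>p\<le>nat (k - N). vschur \<alpha> p * g (k - int p))"
      unfolding g_def sum_distrib_left c by (simp only: sum.cartesian_product)
    also have "\<dots> = fls_nth (fps_to_fls (eser \<alpha>) * Abs_fls g) k"
      by (subst fps_times_fls_nth[of N]) (auto simp: nth g0)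
    finally show "fls_nth (vseries (vexp \<alpha>) n v) k = fls_nth (fps_to_fls (eser \<alpha>) * Abs_fls g) k" .
  qed
  hence "fps_to_fls (eser (- \<alpha>)) * vseries (vexp \<alpha>) n v = Abs_fls g"
    by (simp add: eser_uminus flip: mult.assoc fls_times_fps_to_fls)
  moreover have "g k \<in> S" for k
    unfolding g_def using v cvec.subspace_0[OF S] by (auto intro!: cvec.subspace_sum[OF S])
  ultimately show ?thesis by (simp add: twisted_def nth)
qed

end

section \<open>The span of the monomials as a subalgebra\<close>

definition vmon_span :: "'h::complex_vec set \<Rightarrow> 'h gva set" where
  "vmon_span B = cvec.span {vmon xs | xs. fst ` set xs \<subseteq> B}"

lemma vmon_span_subspace: "cvec.subspace (vmon_span B)"
  by (simp add: vmon_span_def)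

lemma vmon_in_span: "fst ` set xs \<subseteq> B \<Longrightarrow> vmon xs \<in> vmon_span B"
  unfolding vmon_span_def by (rule cvec.span_base) auto

lemma vmon_span_into:
  assumes "clinear f" "cvec.subspace T" "v \<in> vmon_span B"
    and "\<And>xs. fst ` set xs \<subseteq> B \<Longrightarrow> f (vmon xs) \<in> T"
  shows "f v \<in> T"
  by (rule clinear_span_into[OF assms(1,2) _ assms(3)[unfolded vmon_span_def]]) (use assms(4) in auto)

lemma clinear_id: "clinear (\<lambda>v. v)"
  by (rule clinearI) auto

lemma vschur_vmon_span: "b \<in> B \<Longrightarrow> v \<in> vmon_span B \<Longrightarrow> vschur b p * v \<in> vmon_span B"
proof (rule vmon_span_into[OF clinear_mult_left vmon_span_subspace])
  fix xs :: "('a \<times> nat) list" assume "b \<in> B" "fst ` set xs \<subseteq> B"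
  thus "vschur b p * vmon xs \<in> vmon_span B"
    using vmon_in_span[of "(b, p) # xs" B] by simp
qed

lemma vmon_deg_le_span: "v \<in> vmon_deg bs d \<Longrightarrow> set bs \<subseteq> B \<Longrightarrow> v \<in> vmon_span B"
proof (rule vmon_deg_into[OF clinear_id vmon_span_subspace])
  fix xs :: "('a \<times> nat) list" assume "map fst xs = bs" "set bs \<subseteq> B"
  thus "vmon xs \<in> vmon_span B" by (intro vmon_in_span) (metis set_map)
qed

lemma vac_in_span: "vac \<in> vmon_span B"
  using vmon_in_span[of "[]" B] by (simp del: vmon_simps) (simp add: vmon_simps(1))

lemma clinear_charge_part: "clinear (charge_part \<alpha>)"
  by (rule clinearI) (simp_all add: charge_part_def lookup_add lookup_scaleC single_add scaleC_single)

text \<open>Monomials are homogeneous. This is needed because \<open>modified_field\<close>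
  multiplies charge components separately.\<close>

lemma charge_part_span: "v \<in> vmon_span B \<Longrightarrow> charge_part \<alpha> v \<in> vmon_span B"
proof (rule vmon_span_into[OF clinear_charge_part vmon_span_subspace])
  fix xs :: "('a \<times> nat) list" assume "fst ` set xs \<subseteq> B"
  hence "vmon xs \<in> vmon_span B" by (rule vmon_in_span)
  thus "charge_part \<alpha> (vmon xs) \<in> vmon_span B"
    using cvec.subspace_0[OF vmon_span_subspace]
    by (cases "\<alpha> = (\<Sum>x\<leftarrow>xs. fst x)") (auto simp: charge_part_def vmon_eq_single lookup_single when_def)
qed

lemma vmon_span_gva_on:
  assumes "zmod.span B = L" "v \<in> vmon_span B"
  shows "v \<in> gva_on L"
proof (rule vmon_span_into[OF clinear_id _ assms(2)])
  show "cvec.subspace (gva_on L)"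
    unfolding cvec.subspace_def gva_on_def
    by (auto simp: lookup_add lookup_scaleC subset_iff in_keys_iff) (metis add.right_neutral)
next
  fix xs :: "('a \<times> nat) list" assume "fst ` set xs \<subseteq> B"
  hence "(\<Sum>x\<leftarrow>xs. fst x) \<in> zmod.span B"
    by (induction xs) (auto intro: zmod.span_add zmod.span_base zmod.span_zero)
  thus "vmon xs \<in> gva_on L"
    using assms(1) by (auto simp: gva_on_def vmon_eq_single split: if_splits)
qed

context
  fixes form :: "'h::complex_vec \<Rightarrow> 'h \<Rightarrow> complex"
  assumes form: "symmetric_bilinear form"
begin

lemma heis_vmon_span: "v \<in> vmon_span B \<Longrightarrow> heis form x (int j) v \<in> vmon_span B"
  by (rule vmon_span_into[OF clinear_heis[OF form] vmon_span_subspace], assumption)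
    (rule vmon_deg_le_span[OF heis_vmon[OF form]], simp)

lemma lower_vmon_span: "v \<in> vmon_span B \<Longrightarrow> lower form \<alpha> q v \<in> vmon_span B"
  by (rule vmon_span_into[OF clinear_lower[OF form] vmon_span_subspace], assumption)
    (rule vmon_deg_le_span[OF lower_vmon_deg[OF form vmon_in_deg[OF refl refl]]], simp)

text \<open>Write the state as Schur polynomials times e^\<alpha>, \<alpha> its total charge. The
  field of e^\<alpha> has twist \<alpha> and the factors use it up; at twist 0 the coefficients
  themselves lie in the span.\<close>

lemma state_field_vmon:
  assumes xs: "fst ` set xs \<subseteq> B" and v: "v \<in> vmon_span B"
  shows "state_field form (vmon xs) n v \<in> vmon_span B"
proof (rule vmon_span_into[OF fieldsD(1)[OF form state_field_fields[OF form]] vmon_span_subspace v])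
  fix ys :: "('h \<times> nat) list" assume ys: "fst ` set ys \<subseteq> B"
  \<comment> \<open>The field of e^\<alpha> is handled on one charge at a time; nonnegative
    Heisenberg modes preserve the charge.\<close>
  define V where "V = {v \<in> vmon_span B. Poly_Mapping.keys v \<subseteq> {\<Sum>y\<leftarrow>ys. fst y}}"
  define schurs where "schurs zs = (\<Prod>z\<leftarrow>zs. Poly_Mapping.single 0 (schur (fst z) (snd z)) :: 'h gva)" for zs
  have V: "heis form x (int j) w \<in> V" if "w \<in> V" for x j w
    using that heis_keys[OF form, of x "int j" w] by (auto simp: V_def heis_vmon_span)
  \<comment> \<open>Here \<alpha> is independent of the factors, as the induction removes them one
    at a time.\<close>
  have *: "vseries form (schurs zs * vexp \<alpha>) n w \<in> twisted (vmon_span B) (\<alpha> - (\<Sum>z\<leftarrow>zs. fst z))"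
    if "w \<in> V" "fst ` set zs \<subseteq> B" for \<alpha> w zs
    using that
  proof (induction zs arbitrary: w)
    case Nil
    thus ?case
      using vseries_vexp_twisted[OF form vmon_span_subspace[of B] lower_vmon_span, of w]
      by (auto simp: schurs_def V_def)
  next
    case (Cons z zs)
    have "vseries form (Poly_Mapping.single 0 (schur (fst z) (snd z)) * (schurs zs * vexp \<alpha>)) n w
        \<in> twisted (vmon_span B) (\<alpha> - (\<Sum>z\<leftarrow>zs. fst z) - fst z)"
    proof (rule vseries_schur_twisted[OF form vmon_span_subspace _ V])
      show "vschur (fst z) p * u \<in> vmon_span B" if "u \<in> vmon_span B" for p u
        using Cons.prems(2) that by (intro vschur_vmon_span) auto
      show "vseries form (schurs zs * vexp \<alpha>) n u \<in> twisted (vmon_span B) (\<alpha> - (\<Sum>z\<leftarrow>zs. fst z))"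
        if "u \<in> V" for u
        using Cons.prems(2) that by (intro Cons.IH) auto
    qed (use Cons.prems(1) in auto)
    thus ?case by (simp add: schurs_def mult.assoc algebra_simps)
  qed
  have eq: "schurs zs * vexp (\<Sum>z\<leftarrow>zs. fst z) = vmon zs" for zs
  proof -
    have "schurs zs = Poly_Mapping.single 0 (\<Prod>z\<leftarrow>zs. schur (fst z) (snd z))"
      by (induction zs) (simp_all add: schurs_def mult_single)
    thus ?thesis by (simp add: vexp_def vmon_eq_single mult_single)
  qed
  have "vmon ys \<in> V"
    using vmon_in_span[OF ys] by (auto simp: V_def vmon_eq_single split: if_splits)
  from *[OF this xs, of "\<Sum>x\<leftarrow>xs. fst x"]
  have "fls_nth (vseries form (vmon xs) n (vmon ys)) 0 \<in> vmon_span B"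
    by (simp add: twisted_def eq eser_zero)
  thus "state_field form (vmon xs) n (vmon ys) \<in> vmon_span B"
    by (simp add: vseries_nth[OF form])
qed

lemma state_field_closed:
  assumes "u \<in> vmon_span B" "v \<in> vmon_span B"
  shows "state_field form u n v \<in> vmon_span B"
proof (rule vmon_span_into[where f = "\<lambda>u. state_field form u n v", OF _ vmon_span_subspace assms(1)])
  show "clinear (\<lambda>u. state_field form u n v)"
    by (rule clinearI)
      (simp_all add: clinear_add[OF clinear_state_field[OF form]] clinear_scale[OF clinear_state_field[OF form]]
        plus_fun_def scaleC_fun_def)
qed (rule state_field_vmon[OF _ assms(2)])

text \<open>The cocycle only puts scalars in front of products of charge components, and translation
  is a mode applied to the vacuum, so closure under the unmodified products suffices.\<close>

lemma gv_subalgebra_vmon_span: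
  assumes "zmod.span B = L"
  shows "gv_subalgebra form \<epsilon> L (vmon_span B)"
  unfolding gv_subalgebra_def translation_def modified_field_def
  using vmon_span_gva_on[OF assms]
  by (auto intro!: vmon_span_subspace vac_in_span state_field_closed charge_part_span
      cvec.subspace_sum[OF vmon_span_subspace] cvec.subspace_scale[OF vmon_span_subspace])

lemma modified_field_vexp:
  assumes "Poly_Mapping.keys v \<subseteq> {\<gamma>}"
  shows "modified_field form \<epsilon> (vexp \<beta>) n v = \<epsilon> \<beta> \<gamma> *\<^sub>C vertex_mode form \<beta> n v"
proof -
  have c: "charge_part \<beta> (vexp \<beta>) = vexp \<beta>" "Poly_Mapping.keys (vexp \<beta> :: 'h gva) = {\<beta>}"
    by (simp_all add: charge_part_def vexp_def)
  show ?thesis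
  proof (cases "v = 0")
    case True
    thus ?thesis
      using clinear_zero[OF fieldsD(1)[OF form vertex_mode_fields[OF form]]] by (simp add: modified_field_def)
  next
    case False
    hence "Poly_Mapping.keys v = {\<gamma>}" using assms by (metis keys_eq_empty subset_singletonD)
    moreover from this have "charge_part \<gamma> v = v"
      by (intro poly_mapping_eqI) (auto simp: charge_part_def lookup_single when_def in_keys_iff)
    ultimately show ?thesis by (simp add: modified_field_def c state_field_vexp[OF form])
  qed
qed

text \<open>On vectors of charge \<gamma> and degree d this is the mode -1 - p - (\<beta>|\<gamma>)
  of e^\<beta>: a lowering by q must be matched by a creation part of degree p + q.\<close>

definition vmode :: "'h \<Rightarrow> nat \<Rightarrow> nat \<Rightarrow> 'h gva \<Rightarrow> 'h gva" where
  "vmode \<beta> p d v = (\<Sum>q\<le>d. vschur \<beta> (p + q) * lower form \<beta> q v)"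

lemma clinear_vmode: "clinear (vmode \<beta> p d)"
  unfolding vmode_def
  by (rule clinearI)
    (simp_all add: clinear_add[OF clinear_lower[OF form]] clinear_scale[OF clinear_lower[OF form]]
      distrib_left sum.distrib mult_scaleC_gva cvec.scale_sum_right)

lemma vertex_mode_eq_vmode:
  assumes v: "v \<in> vmon_deg bs (int d)"
  shows "vertex_mode form \<beta> (of_int (- 1 - int p) - form \<beta> (sum_list bs)) v = vmode \<beta> p d v"
proof -
  let ?n = "of_int (- 1 - int p) - form \<beta> (sum_list bs)"
  let ?f = "\<lambda>(i, q). vschur \<beta> i *
    (if form \<beta> (sum_list bs) = - ?n - 1 - of_nat i + of_nat q then lower form \<beta> q v else 0)"
  have c: "form \<beta> (sum_list bs) = - ?n - 1 - of_nat i + of_nat q \<longleftrightarrow> i = p + q" for i q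
  proof -
    have "form \<beta> (sum_list bs) = - ?n - 1 - of_nat i + of_nat q \<longleftrightarrow> of_nat i = (of_nat (p + q) :: complex)"
      by (auto simp: algebra_simps)
    thus ?thesis by (simp only: of_nat_eq_iff)
  qed
  have 0: "lower form \<beta> q v = 0" if "q > d" for q
    using lower_vmon_deg[OF form v, of \<beta> q] vmon_deg_neg[of "int d - int q" bs] that by simp
  have "vertex_mode form \<beta> ?n v = Sum_any ?f"
    by (rule vertex_mode_homogeneous[OF form vmon_deg_keys[OF v]])
  also have "\<dots> = (\<Sum>iq\<in>(\<lambda>q. (p + q, q)) ` {..d}. ?f iq)"
  proof (rule Sum_any.expand_superset)
    show "{iq. ?f iq \<noteq> 0} \<subseteq> (\<lambda>q. (p + q, q)) ` {..d}"
      unfolding c using 0 by (fastforce simp: not_less[symmetric] split: if_splits)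
  qed simp
  also have "\<dots> = vmode \<beta> p d v"
    unfolding vmode_def c by (subst sum.reindex) (auto simp: inj_on_def)
  finally show ?thesis .
qed

end

section \<open>Unitriangularity\<close>

text \<open>The order in which the vectors \<open>\<Psi>\<close> are unitriangular with respect to the monomials.\<close>

definition mode_less :: "(('h \<times> nat) \<times> ('h \<times> nat)) set" where
  "mode_less = {(x, y). fst x = fst y \<and> snd x < snd y}"

text \<open>The error terms of \<Psi>. The fixed total degree bounds all indices, which permits
  induction from larger to smaller lists.\<close>

definition larger_span :: "('h::complex_vec \<times> nat) list \<Rightarrow> 'h gva set" where
  "larger_span xs = cvec.span {vmon ys | ys. (xs, ys) \<in> lex mode_less \<and>
     map fst ys = map fst xs \<and> (\<Sum>y\<leftarrow>ys. snd y) = (\<Sum>x\<leftarrow>xs. snd x)}"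

text \<open>The factor s_p(\<beta>) corresponds to the mode -1 - p; p = 0 gives the mode -1, which
  produces e^\<beta> from the vacuum.\<close>

definition mode_list :: "('h \<times> nat) list \<Rightarrow> ('h \<times> int) list" where
  "mode_list = map (\<lambda>x. (fst x, - 1 - int (snd x)))"

lemma larger_span_subspace: "cvec.subspace (larger_span xs)"
  by (simp add: larger_span_def)

lemma vmon_in_larger_span: "(xs, ys) \<in> lex mode_less \<Longrightarrow> map fst ys = map fst xs \<Longrightarrow>
    (\<Sum>y\<leftarrow>ys. snd y) = (\<Sum>x\<leftarrow>xs. snd x) \<Longrightarrow> vmon ys \<in> larger_span xs"
  unfolding larger_span_def by (rule cvec.span_base) auto

lemma larger_span_into:
  assumes "clinear f" "cvec.subspace T" "v \<in> larger_span xs"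
    and "\<And>ys. (xs, ys) \<in> lex mode_less \<Longrightarrow> map fst ys = map fst xs \<Longrightarrow>
      (\<Sum>y\<leftarrow>ys. snd y) = (\<Sum>x\<leftarrow>xs. snd x) \<Longrightarrow> f (vmon ys) \<in> T"
  shows "f v \<in> T"
  by (rule clinear_span_into[OF assms(1,2) _ assms(3)[unfolded larger_span_def]]) (use assms(4) in auto)

lemma larger_span_le_deg:
  assumes "v \<in> larger_span xs"
  shows "v \<in> vmon_deg (map fst xs) (int (\<Sum>x\<leftarrow>xs. snd x))"
  by (rule larger_span_into[OF clinear_id vmon_deg_subspace assms]) (simp add: vmon_in_deg)

context
  fixes form :: "'h::complex_vec \<Rightarrow> 'h \<Rightarrow> complex"
  assumes form: "symmetric_bilinear form"
begin

text \<open>The summand q = 0 is the leading monomial. For q > 0 the head index rises to p + q,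
  which is lexicographically larger whatever the tail, and the tail loses q, so the total degree is
  kept.\<close>

lemma vmode_vmon:
  assumes ys: "map fst ys = map fst xs" "(\<Sum>y\<leftarrow>ys. snd y) = (\<Sum>x\<leftarrow>xs. snd x)"
  shows "vmode form \<beta> p (\<Sum>x\<leftarrow>xs. snd x) (vmon ys) - vmon ((\<beta>, p) # ys) \<in> larger_span ((\<beta>, p) # xs)"
proof -
  let ?d = "\<Sum>x\<leftarrow>xs. snd x"
  have "vmode form \<beta> p ?d (vmon ys) - vmon ((\<beta>, p) # ys) =
      (\<Sum>q\<in>{..?d} - {0}. vschur \<beta> (p + q) * lower form \<beta> q (vmon ys))"
    unfolding vmode_def[OF form]
    by (subst sum.remove[of _ 0]) (auto simp: lower_0[OF form])
  also have "\<dots> \<in> larger_span ((\<beta>, p) # xs)"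
  proof (rule cvec.subspace_sum[OF larger_span_subspace])
    fix q assume q: "q \<in> {..?d} - {0}"
    have "lower form \<beta> q (vmon ys) \<in> vmon_deg (map fst xs) (int ?d - int q)"
      by (rule lower_vmon_deg[OF form]) (use ys in \<open>auto intro: vmon_in_deg\<close>)
    thus "vschur \<beta> (p + q) * lower form \<beta> q (vmon ys) \<in> larger_span ((\<beta>, p) # xs)"
    proof (rule vmon_deg_into[OF clinear_mult_left larger_span_subspace])
      fix zs :: "('h \<times> nat) list" assume zs: "map fst zs = map fst xs" "int (\<Sum>z\<leftarrow>zs. snd z) = int ?d - int q"
      hence "vmon ((\<beta>, p + q) # zs) \<in> larger_span ((\<beta>, p) # xs)"
        using q by (intro vmon_in_larger_span) (auto simp: mode_less_def dest: map_eq_imp_length_eq)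
      thus "vschur \<beta> (p + q) * vmon zs \<in> larger_span ((\<beta>, p) # xs)" by simp
    qed
  qed
  finally show ?thesis .
qed

text \<open>Induction from the innermost operator. The shift in \<Psi> pairs \<beta> with the charge
  already built, so each operator acts as \<open>vmode\<close> up to a cocycle value; c is the
  product of these values.\<close>

lemma Psi_rev_triangular:
  assumes "two_cocycle \<epsilon>"
  shows "\<exists>c w. c \<noteq> 0 \<and> w \<in> larger_span xs \<and> Psi_rev form \<epsilon> (mode_list xs) = c *\<^sub>C (vmon xs + w)"
proof (induction xs)
  case Nil
  show ?case
    by (rule exI[of _ 1], rule exI[of _ 0])
      (simp add: mode_list_def scaleC_one cvec.subspace_0[OF larger_span_subspace])
next
  case (Cons x xs)
  obtain \<beta> p where x: "x = (\<beta>, p)" by (cases x)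
  let ?d = "\<Sum>x\<leftarrow>xs. snd x" and ?\<gamma> = "sum_list (map fst xs)"
  obtain c w where cw: "c \<noteq> 0" "w \<in> larger_span xs" "Psi_rev form \<epsilon> (mode_list xs) = c *\<^sub>C (vmon xs + w)"
    using Cons by blast
  have deg: "c *\<^sub>C (vmon xs + w) \<in> vmon_deg (map fst xs) (int ?d)"
    by (intro cvec.subspace_scale cvec.subspace_add vmon_deg_subspace larger_span_le_deg cw vmon_in_deg refl)
  have f0: "form \<beta> 0 = 0"
    using form_simps(4)[OF form, of \<beta> 0 0] by simp
  have "(\<Sum>x\<leftarrow>mode_list xs. form \<beta> (fst x)) = form \<beta> ?\<gamma>"
    by (induction xs) (simp_all add: mode_list_def f0 form_simps[OF form])
  moreover have "Psi_rev form \<epsilon> (mode_list (x # xs)) = modified_field form \<epsilon> (vexp \<beta>)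
      (of_int (- 1 - int p) - (\<Sum>x\<leftarrow>mode_list xs. form \<beta> (fst x))) (Psi_rev form \<epsilon> (mode_list xs))"
    by (simp add: mode_list_def x)
  ultimately have "Psi_rev form \<epsilon> (mode_list (x # xs)) =
      \<epsilon> \<beta> ?\<gamma> *\<^sub>C vmode form \<beta> p ?d (c *\<^sub>C (vmon xs + w))"
    by (simp only: cw(3) modified_field_vexp[OF form vmon_deg_keys[OF deg]] vertex_mode_eq_vmode[OF form deg])
  also have "\<dots> = (\<epsilon> \<beta> ?\<gamma> * c) *\<^sub>C (vmode form \<beta> p ?d (vmon xs) + vmode form \<beta> p ?d w)"
    by (simp add: clinear_add[OF clinear_vmode[OF form]] clinear_scale[OF clinear_vmode[OF form]] scaleC_scaleC)
  also have "\<dots> = (\<epsilon> \<beta> ?\<gamma> * c) *\<^sub>C (vmon (x # xs) +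
      ((vmode form \<beta> p ?d (vmon xs) - vmon (x # xs)) + vmode form \<beta> p ?d w))"
    by simp
  finally have eq: "Psi_rev form \<epsilon> (mode_list (x # xs)) = \<dots>" .
  \<comment> \<open>The leading terms of the image of w keep the head index p over a tail larger
    than xs; all other terms have a larger head.\<close>
  have "vmode form \<beta> p ?d w \<in> larger_span (x # xs)"
  proof (rule larger_span_into[OF clinear_vmode[OF form] larger_span_subspace cw(2)])
    fix ys assume ys: "(xs, ys) \<in> lex mode_less" "map fst ys = map fst xs" "(\<Sum>y\<leftarrow>ys. snd y) = ?d"
    have "vmon ((\<beta>, p) # ys) \<in> larger_span (x # xs)"
      unfolding x by (rule vmon_in_larger_span) (use ys in auto)
    from cvec.subspace_add[OF larger_span_subspace vmode_vmon[OF ys(2,3), of \<beta> p, folded x] this]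
    show "vmode form \<beta> p ?d (vmon ys) \<in> larger_span (x # xs)" by (simp add: x)
  qed
  moreover have "vmode form \<beta> p ?d (vmon xs) - vmon (x # xs) \<in> larger_span (x # xs)"
    unfolding x by (rule vmode_vmon) simp_all
  moreover have "\<epsilon> \<beta> ?\<gamma> * c \<noteq> 0"
    using assms cw(1) by (simp add: two_cocycle_def)
  ultimately show ?case
    using eq cvec.subspace_add[OF larger_span_subspace] by blast
qed

end

section \<open>Algebraic independence of the Schur polynomials\<close>

text \<open>The free algebra is reused as the polynomial ring in variables X_(b,n), n > 0, with
  X_(b,0) = 1.\<close>

definition schur_var :: "'h \<Rightarrow> nat \<Rightarrow> 'h free_fock" where
  "schur_var b n = (if n = 0 then 1 else Poly_Mapping.single {#(b, n)#} 1)"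

text \<open>The solution \<open>t\<^sub>0, t\<^sub>1, \<dots>\<close> of \<open>(n + 1) X\<^sub>n\<^sub>+\<^sub>1 = \<Sum>l\<le>n. t\<^sub>l X\<^sub>n\<^sub>-\<^sub>l\<close> with \<open>X\<^sub>0 = 1\<close>.\<close>

fun newton :: "'h \<Rightarrow> nat \<Rightarrow> 'h free_fock" where
  "newton b n = of_nat (Suc n) * schur_var b (Suc n) - (\<Sum>l<n. newton b l * schur_var b (n - l))"

declare newton.simps [simp del]

lemma newton_rec: "(\<Sum>l=0..n. newton b l * schur_var b (n - l)) = of_nat (Suc n) * schur_var b (Suc n)"
proof -
  have "{0..n} = insert n {..<n}" by auto
  hence "(\<Sum>l=0..n. newton b l * schur_var b (n - l)) =
      newton b n * schur_var b 0 + (\<Sum>l<n. newton b l * schur_var b (n - l))"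
    by simp
  thus ?thesis by (simp add: newton.simps[of b n] schur_var_def)
qed

lemma scaleC_free_fock: "c *\<^sub>C p = Poly_Mapping.single {#} c * p" for p :: "'h free_fock"
  by (induction p rule: poly_mapping_induct)
    (simp_all add: mult_single distrib_left scaleC_add_right scaleC_single scaleC_complex_def)

lemma of_nat_times_free_fock: "of_nat n * p = of_nat n *\<^sub>C p" for p :: "'h free_fock"
  by (induction n) (simp_all add: distrib_right scaleC_add_left scaleC_one)

text \<open>Let \<open>fgen x k\<close> act as multiplication by t_k(x), where t_k extends
  \<open>newton b k\<close> linearly from B. The recursion of the Schur polynomials becomes the one
  that defines \<open>newton\<close>, so s_n(b) acts as the variable X_(b,n).\<close>

lemma schur_coordinates:
  assumes B: "cvec.independent B"
  shows "\<exists>A :: 'h::complex_vec fock \<Rightarrow> 'h free_fock. clinear A \<and> A 1 = 1 \<and>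
    (\<forall>b\<in>B. \<forall>n u. A (schur b n * u) = schur_var b n * A u)"
proof -
  interpret vector_space_pair "scaleC :: complex \<Rightarrow> 'h \<Rightarrow> 'h" "scaleC :: complex \<Rightarrow> 'h free_fock \<Rightarrow> 'h free_fock"
    by (simp add: vector_space_pair_def cvec.vector_space_axioms)
  have "\<forall>n. \<exists>t. clinear t \<and> (\<forall>b\<in>B. t b = newton b n)"
    by (intro allI linear_independent_extend[OF B])
  then obtain t where t: "\<And>n. clinear (t n)" "\<And>n b. b \<in> B \<Longrightarrow> t n b = newton b n"
    by metis
  have "\<exists>A :: 'h fock \<Rightarrow> 'h free_fock. clinear A \<and> A 1 = 1 \<and> range A \<subseteq> UNIV \<and>
      (\<forall>x k u. A (fgen x k * u) = t k x * A u)"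
    by (rule fock_act_exists)
      (simp_all add: clinear_add[OF t(1)] clinear_scale[OF t(1)] algebra_simps scaleC_free_fock)
  then obtain A :: "'h fock \<Rightarrow> 'h free_fock" where A: "clinear A" "A 1 = 1"
      "\<And>x k u. A (fgen x k * u) = t k x * A u" by blast
  have "A (schur b n * u) = schur_var b n * A u" if b: "b \<in> B" for b n u
  proof (induction n rule: less_induct)
    case (less n)
    show ?case
    proof (cases n)
      case 0
      thus ?thesis by (simp add: schur_var_def)
    next
      case (Suc m)
      have "A (schur b (Suc m) * u) = (1 / of_nat (Suc m)) *\<^sub>C (\<Sum>l=0..m. A (fgen b l * (schur b (m - l) * u)))"
        by (simp only: schur.simps scaleC_mult_fock sum_distrib_right mult.assoc clinear_scale[OF A(1)]
            clinear_sum[OF A(1)])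
      also have "(\<Sum>l=0..m. A (fgen b l * (schur b (m - l) * u))) = (\<Sum>l=0..m. newton b l * schur_var b (m - l)) * A u"
        unfolding sum_distrib_right A(3) t(2)[OF b]
        by (intro sum.cong refl) (simp add: less Suc mult.assoc)
      also have "(1 / of_nat (Suc m)) *\<^sub>C \<dots> = schur_var b (Suc m) * A u"
        unfolding newton_rec mult.assoc of_nat_times_free_fock[of _ "_ * A u"] scaleC_scaleC
        by (simp add: scaleC_one del: of_nat_Suc)
      finally show ?thesis by (simp only: Suc)
    qed
  qed
  thus ?thesis using A(1,2) by (intro exI[of _ A] conjI ballI allI)
qed

lemma one_free_fock: "(1 :: 'h free_fock) = Poly_Mapping.single {#} 1"
  unfolding zero_multiset_def[symmetric] by (rule single_one[symmetric])

lemma schur_var_prod: "(\<Prod>x\<leftarrow>xs. schur_var (fst x) (snd x)) =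
    Poly_Mapping.single (mset (filter (\<lambda>x. snd x \<noteq> 0) xs)) 1"
proof (induction xs)
  case Nil
  show ?case by (simp only: list.map prod_list.Nil filter.simps mset.simps one_free_fock)
next
  case (Cons x xs)
  show ?case
  proof (cases "snd x = 0")
    case True
    thus ?thesis by (simp add: Cons schur_var_def[of _ 0])
  next
    case False
    thus ?thesis by (simp add: Cons schur_var_def[of _ "snd x"] mult_single)
  qed
qed

text \<open>The functional for xs takes the component of the charge of xs and reads off the
  coefficient of the monomial in the variables X_(b,n) that belongs to xs.\<close>

lemma vmon_coordinates:
  fixes B :: "'h::complex_vec set"
  assumes B: "cvec.independent B"
  obtains \<phi> :: "('h \<times> nat) list \<Rightarrow> 'h gva \<Rightarrow> complex" where "\<And>xs. clinear (\<phi> xs)"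
    and "\<And>xs ys. fst ` set ys \<subseteq> B \<Longrightarrow> \<phi> xs (vmon ys) =
      (if (\<Sum>x\<leftarrow>xs. fst x) = (\<Sum>y\<leftarrow>ys. fst y) \<and>
          mset (filter (\<lambda>x. snd x \<noteq> 0) xs) = mset (filter (\<lambda>x. snd x \<noteq> 0) ys) then 1 else 0)"
proof -
  obtain A :: "'h fock \<Rightarrow> 'h free_fock" where A: "clinear A" "A 1 = 1"
      "\<And>b n u. b \<in> B \<Longrightarrow> A (schur b n * u) = schur_var b n * A u"
    using schur_coordinates[OF B] by blast
  define \<phi> where "\<phi> xs v = Poly_Mapping.lookup (A (Poly_Mapping.lookup v (\<Sum>x\<leftarrow>xs. fst x)))
    (mset (filter (\<lambda>x. snd x \<noteq> 0) xs))" for xs :: "('h \<times> nat) list" and v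
  have "clinear (\<phi> xs)" for xs
    by (rule clinearI)
      (simp_all add: \<phi>_def lookup_add lookup_scaleC clinear_add[OF A(1)] clinear_scale[OF A(1)])
  moreover have "\<phi> xs (vmon ys) =
      (if (\<Sum>x\<leftarrow>xs. fst x) = (\<Sum>y\<leftarrow>ys. fst y) \<and>
          mset (filter (\<lambda>x. snd x \<noteq> 0) xs) = mset (filter (\<lambda>x. snd x \<noteq> 0) ys) then 1 else 0)"
    if ys: "fst ` set ys \<subseteq> B" for xs ys
  proof -
    have "A (\<Prod>y\<leftarrow>ys. schur (fst y) (snd y)) = (\<Prod>y\<leftarrow>ys. schur_var (fst y) (snd y))"
      using ys by (induction ys) (simp_all add: A)
    thus ?thesis
      by (auto simp: \<phi>_def vmon_eq_single lookup_single when_def schur_var_prod clinear_zero[OF A(1)])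
  qed
  ultimately show thesis by (rule that)
qed

text \<open>The coordinates of the sum with respect to B are the multiplicities in the list, and
  natural numbers embed in the complex numbers.\<close>

lemma sum_list_independent:
  assumes B: "cvec.independent B" and "set bs \<subseteq> B" "set cs \<subseteq> B" "sum_list bs = sum_list cs"
  shows "mset bs = mset cs"
proof (rule multiset_eqI)
  fix b
  have span: "sum_list ds \<in> cvec.span B" if "set ds \<subseteq> B" for ds
    using that by (induction ds) (simp_all add: cvec.span_zero cvec.span_add cvec.span_base)
  have rep: "cvec.representation B (sum_list ds) b = of_nat (count (mset ds) b)" if "set ds \<subseteq> B" for ds
    using that
  proof (induction ds)
    case (Cons d ds)
    have d: "d \<in> cvec.span B" and ds: "sum_list ds \<in> cvec.span B"
      using Cons.prems span[of ds] by (simp_all add: cvec.span_base)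
    have "cvec.representation B d b = (if b = d then 1 else 0)"
      using cvec.representation_basis[OF B, of d] Cons.prems by simp
    moreover have "cvec.representation B (sum_list ds) b = of_nat (count (mset ds) b)"
      using Cons by simp
    moreover have "cvec.representation B (d + sum_list ds) b =
        cvec.representation B d b + cvec.representation B (sum_list ds) b"
      using cvec.representation_add[OF B d ds] cvec.representation_add[OF B ds d]
      by (simp add: add.commute)
    ultimately show ?case by simp
  qed (simp add: cvec.representation_zero)
  show "count (mset bs) b = count (mset cs) b"
    using rep[OF assms(2)] rep[OF assms(3)] assms(4) by (metis of_nat_eq_iff)
qed

text \<open>Factors of degree \<open>0\<close> are invisible to \<open>schur_var\<close>; the charge restores them.\<close>

lemma mset_filter_charges:
  fixes xs ys :: "('h \<times> nat) list"
  assumes "mset (map fst xs) = mset (map fst ys)"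
    and f: "mset (filter (\<lambda>x. snd x \<noteq> 0) xs) = mset (filter (\<lambda>x. snd x \<noteq> 0) ys)"
  shows "mset xs = mset ys"
proof -
  define Z where "Z zs = filter_mset (\<lambda>x. snd x = 0) (mset zs)" for zs :: "('h \<times> nat) list"
  have split: "mset zs = Z zs + mset (filter (\<lambda>x. snd x \<noteq> 0) zs)" for zs
    using multiset_partition[of "mset zs" "\<lambda>x. snd x = 0"] by (simp add: Z_def)
  have "image_mset fst (mset xs) = image_mset fst (mset ys)"
    using assms(1) by simp
  hence "image_mset fst (Z xs) = image_mset fst (Z ys)"
    unfolding split[of xs] split[of ys] f by simp
  moreover have "Z zs = image_mset (\<lambda>b. (b, 0)) (image_mset fst (Z zs))" for zs
  proof -
    have "image_mset (\<lambda>x. (fst x, 0)) (Z zs) = image_mset (\<lambda>x. x) (Z zs)"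
      by (rule image_mset_cong) (auto simp: Z_def prod_eq_iff)
    thus ?thesis by (simp add: multiset.map_comp comp_def)
  qed
  ultimately have "Z xs = Z ys" by metis
  thus ?thesis unfolding split[of xs] split[of ys] f by simp
qed

section \<open>Canonical index lists\<close>

text \<open>The lists of the theorem with the outermost operator first and p = -1 - m in place of m;
  reversal makes the charges weakly decrease, and within one charge the p as well.\<close>

definition canonical :: "('h \<times> 'h) set \<Rightarrow> ('h \<times> nat) list \<Rightarrow> bool" where
  "canonical r = sorted_wrt (\<lambda>x y. (fst y, fst x) \<in> r \<and> (fst x = fst y \<longrightarrow> snd y \<le> snd x))"

lemma canonical_simps: "canonical r []"
  "canonical r (x # xs) \<longleftrightarrow>
     (\<forall>y\<in>set xs. (fst y, fst x) \<in> r \<and> (fst x = fst y \<longrightarrow> snd y \<le> snd x)) \<and> canonical r xs"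
  by (simp_all add: canonical_def)

text \<open>Insertion sort, by charge first and by p within one charge.\<close>

lemma canonical_exists:
  assumes r: "linear_order_on B r" and ys: "fst ` set ys \<subseteq> B"
  shows "\<exists>xs. canonical r xs \<and> mset xs = mset ys"
proof -
  have tot: "total_on B r" and refl: "refl_on B r" and trans: "trans r" and anti: "antisym r"
    using r by (auto simp: linear_order_on_def partial_order_on_def preorder_on_def)
  have ins: "\<exists>zs. canonical r zs \<and> mset zs = add_mset y (mset xs)"
    if "canonical r xs" "fst ` set xs \<subseteq> B" "fst y \<in> B" for y xs
    using that
  proof (induction xs)
    case Nil
    thus ?case by (intro exI[of _ "[y]"]) (simp add: canonical_simps)
  next
    case (Cons x xs)
    show ?case
    proof (cases "(fst x, fst y) \<in> r \<and> (fst y = fst x \<longrightarrow> snd x \<le> snd y)")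
      case True
      have "(fst z, fst y) \<in> r \<and> (fst y = fst z \<longrightarrow> snd z \<le> snd y)" if "z \<in> set xs" for z
      proof -
        have z: "(fst z, fst x) \<in> r" "fst x = fst z \<longrightarrow> snd z \<le> snd x"
          using Cons.prems(1) that by (auto simp: canonical_simps)
        moreover have "(fst z, fst y) \<in> r" using z True trans by (blast dest: transD)
        \<comment> \<open>The charge of x lies between those of z and y, so antisymmetry makes all
          three equal.\<close>
        moreover have "fst x = fst z" if "fst y = fst z"
          using that z True anti by (metis antisymD)
        ultimately show ?thesis using True by force
      qed
      thus ?thesis
        using Cons.prems True by (intro exI[of _ "y # x # xs"]) (auto simp: canonical_simps)
    next
      case False
      have x: "fst x \<in> B" using Cons.prems by simp
      have yx: "(fst y, fst x) \<in> r \<and> (fst x = fst y \<longrightarrow> snd y \<le> snd x)"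
      proof (cases "fst x = fst y")
        case True
        thus ?thesis using False refl x by (auto dest: refl_onD)
      next
        case neq: False
        hence "(fst x, fst y) \<in> r \<or> (fst y, fst x) \<in> r"
          using tot x Cons.prems(3) by (auto simp: total_on_def)
        thus ?thesis using False neq by auto
      qed
      obtain zs where zs: "canonical r zs" "mset zs = add_mset y (mset xs)"
        using Cons by (auto simp: canonical_simps)
      have "set zs = insert y (set xs)"
        using arg_cong[OF zs(2), of set_mset] by simp
      thus ?thesis
        using Cons.prems zs yx by (intro exI[of _ "x # zs"]) (auto simp: canonical_simps)
    qed
  qed
  show ?thesis
    using ys
  proof (induction ys)
    case Nil
    show ?case by (intro exI[of _ "[]"]) (simp add: canonical_simps)
  next
    case (Cons y ys)
    then obtain xs where xs: "canonical r xs" "mset xs = mset ys" by auto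
    moreover have "set xs = set ys" using xs(2) by (rule mset_eq_setD)
    ultimately show ?case using ins[of xs y] Cons.prems by auto
  qed
qed

text \<open>Different heads would each occur in the tail of the other list and hence be related both
  ways.\<close>

lemma sorted_wrt_unique:
  assumes "\<And>x y. R x y \<Longrightarrow> R y x \<Longrightarrow> x = y" "sorted_wrt R xs" "sorted_wrt R ys" "mset xs = mset ys"
  shows "xs = ys"
  using assms(2-4)
proof (induction xs arbitrary: ys)
  case (Cons x xs)
  obtain y ys' where ys: "ys = y # ys'"
    using Cons.prems(3) by (cases ys) auto
  have "x = y"
  proof (rule ccontr)
    assume "x \<noteq> y"
    hence "x \<in> set ys'" "y \<in> set xs"
      using Cons.prems(3) ys by (metis list.set_intros(1) mset_eq_setD set_ConsD)+
    hence "R x y" "R y x" using Cons.prems(1,2) ys by auto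
    thus False using assms(1) \<open>x \<noteq> y\<close> by blast
  qed
  thus ?case using Cons.IH[of ys'] Cons.prems ys by simp
qed simp

lemma canonical_charges:
  assumes "antisym r" "canonical r xs" "canonical r ys" "mset (map fst xs) = mset (map fst ys)"
  shows "map fst xs = map fst ys"
proof (rule sorted_wrt_unique[OF _ _ _ assms(4)])
  show "x = y" if "(y, x) \<in> r" "(x, y) \<in> r" for x y
    using that assms(1) by (auto dest: antisymD)
  have "sorted_wrt (\<lambda>x y. (y, x) \<in> r) (map fst zs)" if "canonical r zs" for zs :: "('a \<times> nat) list"
    using that unfolding canonical_def sorted_wrt_map by (rule sorted_wrt_mono_rel[rotated]) auto
  thus "sorted_wrt (\<lambda>x y. (y, x) \<in> r) (map fst xs)" "sorted_wrt (\<lambda>x y. (y, x) \<in> r) (map fst ys)"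
    using assms by blast+
qed

text \<open>At the first difference the entry of ys comes from a later place of xs and has the same
  charge as the entry of xs there, so its index is smaller.\<close>

lemma canonical_maximal:
  assumes "canonical r xs" "mset ys = mset xs" "map fst ys = map fst xs"
  shows "ys = xs \<or> (ys, xs) \<in> lex mode_less"
  using assms
proof (induction xs arbitrary: ys)
  case (Cons x xs)
  obtain y ys' where ys: "ys = y # ys'"
    using Cons.prems(3) by (cases ys) auto
  show ?case
  proof (cases "y = x")
    case True
    thus ?thesis using Cons.IH[of ys'] Cons.prems ys by (auto simp: canonical_simps)
  next
    case False
    hence "y \<in> set xs" using Cons.prems(2) ys by (metis list.set_intros(1) mset_eq_setD set_ConsD)
    hence "snd y \<le> snd x" using Cons.prems ys by (auto simp: canonical_simps)
    hence "(y, x) \<in> mode_less"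
      using False Cons.prems(3) ys by (auto simp: mode_less_def prod_eq_iff)
    moreover have "length ys' = length xs"
      using Cons.prems(3) ys by (auto dest: map_eq_imp_length_eq)
    ultimately show ?thesis using ys by simp
  qed
qed simp

section \<open>Well-foundedness of the lexicographic order, downwards and upwards\<close>

lemma wf_mode_less: "wf mode_less"
  by (rule wf_subset[OF wf_measure[of snd]]) (auto simp: mode_less_def)

lemma trans_lex_mode_less: "trans (lex mode_less)"
proof (rule transI)
  have "trans mode_less" by (auto simp: trans_def mode_less_def)
  thus "(x, z) \<in> lex mode_less" if "(x, y) \<in> lex mode_less" "(y, z) \<in> lex mode_less" for x y z
    using that lexord_trans[of x y mode_less z] by (auto simp: lexord_lex)
qed

lemma lex_mode_less_bounded:
  "(xs, ys) \<in> lex mode_less \<Longrightarrow> (\<And>y. y \<in> set ys \<Longrightarrow> snd y \<le> d) \<Longrightarrow>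
    (ys, xs) \<in> lex {(y, x). (x, y) \<in> mode_less \<and> snd y \<le> d}"
proof (induction xs arbitrary: ys)
  case (Cons x xs)
  obtain y ys' where ys: "ys = y # ys'"
    using Cons.prems(1) by (cases ys) auto
  show ?case using Cons.IH[of ys'] Cons.prems ys by auto
qed simp

lemma wf_bounded_mode_less: "wf {(y, x). (x, y) \<in> mode_less \<and> snd y \<le> d}"
  by (rule wf_subset[OF wf_measure[of "\<lambda>x. d - snd x"]]) (auto simp: mode_less_def)

lemma Psi_index_eq: "Psi_index r B = (\<lambda>xs. rev (mode_list xs)) ` {xs. canonical r xs \<and> fst ` set xs \<subseteq> B}"
proof -
  have P: "rev (mode_list xs) \<in> Psi_index r B \<longleftrightarrow> canonical r xs \<and> fst ` set xs \<subseteq> B" for xs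
  proof -
    have "canonical r xs \<longleftrightarrow> sorted_wrt (\<lambda>x y. (fst x, fst y) \<in> r \<and> (fst x = fst y \<longrightarrow> snd x \<ge> snd y)) (rev (mode_list xs))"
      unfolding sorted_wrt_rev mode_list_def sorted_wrt_map canonical_def by (auto simp: eq_commute)
    moreover have "fst ` set (rev (mode_list xs)) = fst ` set xs" "snd ` set (rev (mode_list xs)) \<subseteq> {..<0}"
      by (auto simp: mode_list_def image_image)
    ultimately show ?thesis
      unfolding Psi_index_def sorted_wrt_iff_nth_less by auto
  qed
  show ?thesis
  proof (intro equalityI subsetI)
    fix zs assume zs: "zs \<in> Psi_index r B"
    \<comment> \<open>The modes are negative, so \<open>nat (- 1 - m)\<close> inverts p = -1 -
      m.\<close>
    define xs where "xs = map (\<lambda>z. (fst z, nat (- 1 - snd z))) (rev zs)"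
    have "mode_list xs = rev zs"
      unfolding mode_list_def xs_def map_map
      by (rule map_idI) (use zs in \<open>auto simp: Psi_index_def prod_eq_iff\<close>)
    hence "zs = rev (mode_list xs)" by simp
    thus "zs \<in> (\<lambda>xs. rev (mode_list xs)) ` {xs. canonical r xs \<and> fst ` set xs \<subseteq> B}"
      using zs P[of xs] by blast
  qed (use P in auto)
qed

section \<open>The principal subspace\<close>

text \<open>In a linear relation take an R-minimal index i with nonzero coefficient. The functional
  of i kills every other term that occurs, but not its own.\<close>

lemma triangular_independent:
  fixes f :: "'i \<Rightarrow> 'v::complex_vec" and \<phi> :: "'i \<Rightarrow> 'v \<Rightarrow> complex"
  assumes R: "wf R" and \<phi>: "\<And>i. clinear (\<phi> i)" and diag: "\<And>i. i \<in> I \<Longrightarrow> \<phi> i (f i) \<noteq> 0"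
    and tri: "\<And>i j. i \<in> I \<Longrightarrow> j \<in> I \<Longrightarrow> \<phi> i (f j) \<noteq> 0 \<Longrightarrow> i = j \<or> (j, i) \<in> R"
  shows "inj_on f I" and "cvec.independent (f ` I)"
proof -
  show "inj_on f I"
  proof (rule inj_onI)
    fix i j assume ij: "i \<in> I" "j \<in> I" "f i = f j"
    hence "\<phi> i (f j) \<noteq> 0" "\<phi> j (f i) \<noteq> 0" using diag by metis+
    thus "i = j" using tri ij R by (metis wf_not_sym)
  qed
  show "cvec.independent (f ` I)"
    unfolding cvec.independent_explicit_module
  proof (intro allI impI)
    fix t u v
    assume t: "finite t" "t \<subseteq> f ` I" "(\<Sum>v\<in>t. u v *\<^sub>C v) = 0" "v \<in> t"
    show "u v = 0"
    proof (rule ccontr)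
      assume "u v \<noteq> 0"
      define J where "J = {i \<in> I. f i \<in> t \<and> u (f i) \<noteq> 0}"
      have "J \<noteq> {}" using t \<open>u v \<noteq> 0\<close> by (auto simp: J_def)
      then obtain i where i: "i \<in> J" "\<And>j. (j, i) \<in> R \<Longrightarrow> j \<notin> J"
        using R by (metis wfE_min ex_in_conv)
      have zero: "u w * \<phi> i w = 0" if w: "w \<in> t - {f i}" for w
      proof (rule ccontr)
        assume nz: "u w * \<phi> i w \<noteq> 0"
        obtain j where j: "j \<in> I" "w = f j" using w t(2) by auto
        hence "i = j \<or> (j, i) \<in> R" using tri[of i j] i nz by (auto simp: J_def)
        thus False using j i(2)[of j] w nz by (auto simp: J_def)
      qed
      have "(\<Sum>w\<in>t. u w * \<phi> i w) = u (f i) * \<phi> i (f i) + (\<Sum>w\<in>t - {f i}. u w * \<phi> i w)"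
        using i(1) t(1) by (intro sum.remove) (auto simp: J_def)
      also have "(\<Sum>w\<in>t - {f i}. u w * \<phi> i w) = 0"
        by (rule sum.neutral) (use zero in blast)
      finally have "(\<Sum>w\<in>t. u w * \<phi> i w) = u (f i) * \<phi> i (f i)" by simp
      moreover have "(\<Sum>w\<in>t. u w * \<phi> i w) = \<phi> i (\<Sum>w\<in>t. u w *\<^sub>C w)"
        by (simp add: clinear_sum[OF \<phi>] clinear_scale[OF \<phi>] scaleC_complex_def)
      ultimately show False
        using t i diag[of i] by (simp add: J_def clinear_zero[OF \<phi>])
    qed
  qed
qed

lemma vmon_mset: "mset xs = mset ys \<Longrightarrow> vmon xs = vmon ys"
  unfolding vmon_def prod_mset_prod_list[symmetric] mset_map by simp

theorem theorem5p1:
  fixes form :: "'h::complex_vec \<Rightarrow> 'h \<Rightarrow> complex"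
    and \<epsilon> :: "'h \<Rightarrow> 'h \<Rightarrow> complex"
    and L B :: "'h set"
    and r :: "('h \<times> 'h) set"
  assumes "symmetric_bilinear form"
    and "two_cocycle \<epsilon>"
    and "Z_basis B L"
    and "C_basis B UNIV"
    and "linear_order_on B r"
  shows "inj_on (Psi form \<epsilon>) (Psi_index r B) \<and>
         C_basis (Psi form \<epsilon> ` Psi_index r B) (principal_subspace form \<epsilon> L B)"
proof -
  note form = assms(1)
  define I where "I = {xs. canonical r xs \<and> fst ` set xs \<subseteq> B}"
  define f where "f xs = Psi_rev form \<epsilon> (mode_list xs)" for xs
  have anti: "antisym r"
    using assms(5) by (simp add: linear_order_on_def partial_order_on_def)
  have B: "cvec.independent B"
    using assms(4) by (simp add: C_basis_def)
  have span: "zmod.span B = L"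
    using assms(3) by (simp add: Z_basis_def)
  have image: "Psi form \<epsilon> ` Psi_index r B = f ` I"
    unfolding Psi_index_eq I_def[symmetric] image_image Psi_def f_def by simp
  have tri: "\<exists>c w. c \<noteq> 0 \<and> w \<in> larger_span xs \<and> f xs = c *\<^sub>C (vmon xs + w)" for xs
    unfolding f_def by (rule Psi_rev_triangular[OF form assms(2)])

  \<comment> \<open>Linear independence of the vectors \<Psi>\<close>
  obtain \<phi> :: "('h \<times> nat) list \<Rightarrow> 'h gva \<Rightarrow> complex" where \<phi>: "\<And>xs. clinear (\<phi> xs)"
    "\<And>xs ys. fst ` set ys \<subseteq> B \<Longrightarrow> \<phi> xs (vmon ys) =
      (if (\<Sum>x\<leftarrow>xs. fst x) = (\<Sum>y\<leftarrow>ys. fst y) \<and>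
          mset (filter (\<lambda>x. snd x \<noteq> 0) xs) = mset (filter (\<lambda>x. snd x \<noteq> 0) ys) then 1 else 0)"
    by (rule vmon_coordinates[OF B], rule that)
  have \<phi>_vmon: "mset ys = mset xs" if "fst ` set xs \<subseteq> B" "fst ` set ys \<subseteq> B" "\<phi> xs (vmon ys) \<noteq> 0" for xs ys
  proof -
    have eq: "sum_list (map fst xs) = sum_list (map fst ys)"
        "mset (filter (\<lambda>x. snd x \<noteq> 0) xs) = mset (filter (\<lambda>x. snd x \<noteq> 0) ys)"
      using that(3) \<phi>(2)[OF that(2), of xs] by (auto split: if_splits)
    have "mset (map fst xs) = mset (map fst ys)"
      by (rule sum_list_independent[OF B _ _ eq(1)]) (use that in auto)
    from mset_filter_charges[OF this eq(2)] show ?thesis ..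
  qed
  \<comment> \<open>If the functional of xs does not vanish on w, some monomial zs > ys of w is a
    rearrangement of xs. The charges of ys and xs then form the same list, and xs is the largest
    such rearrangement, so ys < zs \<le> xs.\<close>
  have \<phi>_larger: "(ys, xs) \<in> lex mode_less" if "xs \<in> I" "ys \<in> I" "w \<in> larger_span ys" "\<phi> xs w \<noteq> 0" for xs ys w
  proof (rule ccontr)
    assume no: "(ys, xs) \<notin> lex mode_less"
    have "\<phi> xs w \<in> {0}"
    proof (rule larger_span_into[OF \<phi>(1) _ that(3)])
      fix zs assume zs: "(ys, zs) \<in> lex mode_less" "map fst zs = map fst ys"
      show "\<phi> xs (vmon zs) \<in> {0}"
      proof (rule ccontr)
        assume nz: "\<phi> xs (vmon zs) \<notin> {0}"
        have zsB: "fst ` set zs \<subseteq> B"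
          using zs(2) that(2) by (metis (mono_tags, lifting) I_def mem_Collect_eq set_map)
        have m: "mset zs = mset xs"
          by (rule \<phi>_vmon) (use nz zsB that(1) in \<open>auto simp: I_def\<close>)
        hence "mset (map fst xs) = mset (map fst ys)"
          using zs(2) by (metis mset_map)
        hence "map fst xs = map fst ys"
          using that(1,2) by (intro canonical_charges[OF anti]) (auto simp: I_def)
        hence "zs = xs \<or> (zs, xs) \<in> lex mode_less"
          using m zs(2) that(1) by (intro canonical_maximal[of r]) (auto simp: I_def)
        thus False using zs(1) no trans_lex_mode_less by (meson transD)
      qed
    qed (simp add: cvec.subspace_def)
    thus False using that(4) by simp
  qed
  have diag: "\<phi> xs (f xs) \<noteq> 0" if "xs \<in> I" for xs
  proof -
    obtain c w where cw: "c \<noteq> 0" "w \<in> larger_span xs" "f xs = c *\<^sub>C (vmon xs + w)" using tri by blast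
    have "\<phi> xs w = 0"
      using \<phi>_larger[OF that that cw(2)] wf_mode_less by (metis wf_lex wf_not_refl)
    thus ?thesis
      using cw(1) that by (simp add: cw(3) clinear_add[OF \<phi>(1)] clinear_scale[OF \<phi>(1)] \<phi>(2) I_def scaleC_complex_def)
  qed
  have off: "xs = ys \<or> (ys, xs) \<in> lex mode_less" if "xs \<in> I" "ys \<in> I" "\<phi> xs (f ys) \<noteq> 0" for xs ys
  proof (rule ccontr)
    assume no: "\<not> (xs = ys \<or> (ys, xs) \<in> lex mode_less)"
    obtain c w where cw: "c \<noteq> 0" "w \<in> larger_span ys" "f ys = c *\<^sub>C (vmon ys + w)" using tri by blast
    have "\<phi> xs w = 0" using \<phi>_larger[OF that(1,2) cw(2)] no by blast
    moreover have "\<phi> xs (vmon ys) = 0"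
    proof (rule ccontr)
      assume "\<phi> xs (vmon ys) \<noteq> 0"
      hence m: "mset ys = mset xs" using \<phi>_vmon that by (auto simp: I_def)
      hence "map fst ys = map fst xs"
        using that by (intro canonical_charges[OF anti]) (auto simp: I_def)
      hence "ys = xs \<or> (ys, xs) \<in> lex mode_less"
        using m that(1) by (intro canonical_maximal[of r]) (auto simp: I_def)
      thus False using no by blast
    qed
    ultimately show False
      using that(3) by (simp add: cw(3) clinear_add[OF \<phi>(1)] clinear_scale[OF \<phi>(1)] scaleC_complex_def)
  qed
  have independent: "inj_on f I" "cvec.independent (f ` I)"
    using triangular_independent[of "lex mode_less" \<phi> I f, OF wf_lex[OF wf_mode_less] \<phi>(1) diag off]
    by blast+

  have inj: "inj_on (Psi form \<epsilon>) (Psi_index r B)"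
  proof (rule inj_onI)
    fix zs zs' assume "zs \<in> Psi_index r B" "zs' \<in> Psi_index r B" and eq: "Psi form \<epsilon> zs = Psi form \<epsilon> zs'"
    then obtain xs ys where "zs = rev (mode_list xs)" "zs' = rev (mode_list ys)" "xs \<in> I" "ys \<in> I"
      unfolding Psi_index_eq I_def by blast
    thus "zs = zs'" using eq inj_onD[OF independent(1), of xs ys] by (simp add: Psi_def f_def)
  qed

  \<comment> \<open>The vectors \<Psi> span the monomials\<close>
  have spanning: "vmon_span B \<subseteq> cvec.span (f ` I)"
  proof -
    \<comment> \<open>Induction from larger to smaller lists of degree d. The charges stand in the
      order of the canonical list cs, so the canonical rearrangement ys of xs has the same list of
      charges and is at least xs.\<close>
    have sorted: "vmon xs \<in> cvec.span (f ` I)"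
      if "canonical r cs" "fst ` set cs \<subseteq> B" "map fst xs = map fst cs" "(\<Sum>x\<leftarrow>xs. snd x) = d" for cs xs d
      using wf_lex[OF wf_bounded_mode_less[of d]] that(3,4)
    proof (induction xs rule: wf_induct_rule)
      case (less xs)
      have xsB: "fst ` set xs \<subseteq> B" using less.prems(1) that(2) by (metis set_map)
      obtain ys where ys: "canonical r ys" "mset ys = mset xs"
        using canonical_exists[OF assms(5) xsB] by blast
      have fst_ys: "map fst ys = map fst cs"
        by (rule canonical_charges[OF anti ys(1) that(1)]) (use ys(2) less.prems(1) in \<open>metis mset_map\<close>)
      have sum_ys: "(\<Sum>y\<leftarrow>ys. snd y) = d"
        using ys(2) less.prems(2) by (metis mset_map sum_mset_sum_list)
      have ys_ge: "xs = ys \<or> (xs, ys) \<in> lex mode_less"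
        by (rule canonical_maximal[OF ys(1)]) (use ys(2) fst_ys less.prems(1) in auto)
      have "ys \<in> I"
        using ys(1) fst_ys that(2) unfolding I_def by (metis (mono_tags, lifting) mem_Collect_eq set_map)
      obtain c w where cw: "c \<noteq> 0" "w \<in> larger_span ys" "f ys = c *\<^sub>C (vmon ys + w)" using tri by blast
      have w: "w \<in> cvec.span (f ` I)"
      proof (rule larger_span_into[OF clinear_id cvec.subspace_span cw(2)])
        fix zs assume zs: "(ys, zs) \<in> lex mode_less" "map fst zs = map fst ys"
          "(\<Sum>z\<leftarrow>zs. snd z) = (\<Sum>y\<leftarrow>ys. snd y)"
        have "snd z \<le> d" if "z \<in> set zs" for z
          using member_le_sum_list[of "snd z" "map snd zs"] that zs(3) sum_ys by auto
        moreover have "(xs, zs) \<in> lex mode_less"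
          using ys_ge zs(1) trans_lex_mode_less by (metis transD)
        ultimately show "vmon zs \<in> cvec.span (f ` I)"
          using zs fst_ys sum_ys by (intro less.IH lex_mode_less_bounded) auto
      qed
      \<comment> \<open>The triangular relation is solved for its leading monomial; rearranging the
        factors does not change it.\<close>
      have "vmon xs = (1 / c) *\<^sub>C f ys - w"
        using cw(1) vmon_mset[OF ys(2)] by (simp add: cw(3) scaleC_scaleC scaleC_one)
      moreover have "f ys \<in> cvec.span (f ` I)"
        using \<open>ys \<in> I\<close> by (intro cvec.span_base imageI)
      ultimately show ?case by (simp only: cvec.span_diff cvec.span_scale w)
    qed
    have "vmon xs \<in> cvec.span (f ` I)" if xs: "fst ` set xs \<subseteq> B" for xs
    proof -
      obtain cs where cs: "canonical r cs" "mset cs = mset xs"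
        using canonical_exists[OF assms(5) xs] by blast
      moreover have "fst ` set cs \<subseteq> B" using xs cs(2) by (metis mset_eq_setD)
      ultimately show ?thesis using sorted[of cs cs] vmon_mset[OF cs(2)] by simp
    qed
    thus ?thesis unfolding vmon_span_def by (intro cvec.span_minimal cvec.subspace_span) auto
  qed

  \<comment> \<open>Identification with the principal subspace\<close>
  have le: "principal_subspace form \<epsilon> L B \<subseteq> vmon_span B"
  proof -
    have "vexp b \<in> vmon_span B" if "b \<in> B" for b
      using vmon_in_span[of "[(b, 0)]" B] that by (simp add: vschur_0 vexp_def)
    thus ?thesis
      using gv_subalgebra_vmon_span[OF form span, of \<epsilon>]
      unfolding principal_subspace_def generated_gv_subalgebra_def by blast
  qed
  \<comment> \<open>Each \<Psi> arises from the vacuum by modes of the e^\<beta>, so it lies in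
    every subalgebra that contains them.\<close>
  have ge: "cvec.span (f ` I) \<subseteq> principal_subspace form \<epsilon> L B"
    unfolding principal_subspace_def generated_gv_subalgebra_def
  proof (rule Inter_greatest)
    fix U assume "U \<in> {U. gv_subalgebra form \<epsilon> L U \<and> vexp ` B \<subseteq> U}"
    hence U: "cvec.subspace U" "vac \<in> U" "vexp ` B \<subseteq> U"
        "\<And>u v n. u \<in> U \<Longrightarrow> v \<in> U \<Longrightarrow> modified_field form \<epsilon> u n v \<in> U"
      by (auto simp: gv_subalgebra_def)
    have "Psi_rev form \<epsilon> zs \<in> U" if "fst ` set zs \<subseteq> B" for zs
      using that U by (induction zs) auto
    hence "f xs \<in> U" if "xs \<in> I" for xs
      using that by (auto simp: f_def I_def mode_list_def image_image)
    thus "cvec.span (f ` I) \<subseteq> U" by (intro cvec.span_minimal U) auto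
  qed
  show ?thesis
    using inj independent(2) le ge spanning unfolding C_basis_def image by blast
qed

end
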